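(* Let $\Omega\subset\mathbb{R}^N$ be a bounded open connected set, $p\in(1,\infty)$, $r,s\in(0,1)$, and $\alpha,\beta\ge 1$ with $\alpha+\beta=p$. Let $$\lambda_p=\inf\left\{\mathcal{J}_p(w,z): (w,z)\in W^{1,p}_0(\Omega)\times W^{1,p}_0(\Omega),\ wz\neq 0\right\}.$$ Then the infimum $\lambda_p$ is attained at some pair $(u_p,v_p)\in W^{1,p}_0(\Omega)\times W^{1,p}_0(\Omega)$ with $u_pv_p\ne 0$, where neither $u_p$ nor $v_p$ changes sign a.e. in $\Omega$ (each of them is either $\ge 0$ a.e. in $\Omega$ or $\le 0$ a.e. in $\Omega$). Moreover, $\lambda_p$ is the first (smallest) variational eigenvalue of the system $$ \left\{ \begin{array}{rclcl} -\Delta_p u + (-\Delta)_p^r u & = & \frac{2\alpha}{\alpha+\beta}\lambda |u|^{\alpha-2}|v|^{\beta}u & \mbox{in} & \Omega \\ -\Delta_p v + (-\Delta)_p^s v& = & \frac{2\beta}{\alpha+\beta}\lambda |u|^{\alpha}|v|^{\beta-2}v & \mbox{in} & \Omega \\ u=v& =& 0&\mbox{on} & \mathbb{R}^N \setminus \Omega, \end{array} \right. $$ and $(u_p,v_p)$ is an associated eigenpair, i.e. $(u_p,v_p)$ is a weak solution of this system with $\lambda=\lambda_p$.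
   Context: Functions in $W^{1,p}_0(\Omega)$ are extended by $0$ to all of $\mathbb{R}^N$. For $t\in(0,1)$ the Gagliardo seminorm is given by $$[w]_{p,t}^p=\iint_{\mathbb{R}^{2N}}\frac{|w(x)-w(y)|^p}{|x-y|^{N+tp}}\,dx\,dy,$$ which is finite for $w\in W_0^{1,p}(\Omega)$. The energy functional is $$\mathcal{J}_p(w,z)=\frac12\,\frac{\|\nabla w\|_{L^p(\Omega)}^p+[w]_{p,r}^p+\|\nabla z\|_{L^p(\Omega)}^p+[z]_{p,s}^p}{\int_\Omega |w|^\alpha|z|^\beta\,dx}.$$ The condition $wz\ne0$ means that the product $wz$ is not a.e. zero in $\Omega$. Operators: $\Delta_p u=\mathrm{div}(|\nabla u|^{p-2}\nabla u)$ and $(-\Delta)_p^t u(x)=2\,\mathrm{P.V.}\int_{\mathbb{R}^N}\frac{|u(x)-u(y)|^{p-2}(u(x)-u(y))}{|x-y|^{N+tp}}\,dy$. Weak solution: set $\mathcal{E}_p(w,\psi)=\int_\Omega|\nabla w|^{p-2}\nabla w\cdot\nabla\psi\,dx$ and $\mathcal{E}_{t,p}(w,\psi)=\iint_{\mathbb{R}^{2N}}\frac{|w(x)-w(y)|^{p-2}(w(x)-w(y))(\psi(x)-\psi(y))}{|x-y|^{N+tp}}\,dx\,dy$. A pair $(u,v)\in W^{1,p}_0(\Omega)\times W^{1,p}_0(\Omega)$ is a weak solution of the system if for all $\psi,\varphi\in W^{1,p}_0(\Omega)$ $$\mathcal{E}_p(u,\psi)+\mathcal{E}_{r,p}(u,\psi)=\lambda\tfrac{2\alpha}{\alpha+\beta}\int_\Omega|u|^{\alpha-2}u|v|^\beta\psi\,dx,\qquad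 \mathcal{E}_p(v,\varphi)+\mathcal{E}_{s,p}(v,\varphi)=\lambda\tfrac{2\beta}{\alpha+\beta}\int_\Omega|u|^{\alpha}|v|^{\beta-2}v\,\varphi\,dx.$$ An eigenvalue is a $\lambda\in\mathbb{R}$ for which the system has a nontrivial weak solution $(u,v)$, which is then called an eigenpair associated to $\lambda$. *)

theory Defs
  imports "HOL-Analysis.Analysis"
begin

text \<open>
  The Euclidean space $R^N$ is a type of class \<^class>\<open>euclidean_space\<close>, with $N$ = \<open>DIM('a)\<close>.
  An element of a function space is a Borel representative of its class (every class of functions
  modulo null sets has one); with this choice the map $(x,y) \mapsto w(x) - w(y)$ is measurable for
  \<open>lborel \<Otimes>\<^sub>M lborel\<close>. Everything below is invariant under changing representatives on null
  subsets of \<open>\<Omega>\<close>.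
\<close>

primrec Ck :: "nat \<Rightarrow> ('a::euclidean_space \<Rightarrow> real) \<Rightarrow> bool" where
  "Ck 0 f \<longleftrightarrow> continuous_on UNIV f"
| "Ck (Suc k) f \<longleftrightarrow> (\<forall>x. f differentiable (at x)) \<and>
     (\<forall>b\<in>Basis. Ck k (\<lambda>x. frechet_derivative f (at x) b))"

definition test_functions :: "'a::euclidean_space set \<Rightarrow> ('a \<Rightarrow> real) set" where
  "test_functions \<Omega> = {\<phi>. (\<forall>k. Ck k \<phi>) \<and> compact (closure {x. \<phi> x \<noteq> 0}) \<and> closure {x. \<phi> x \<noteq> 0} \<subseteq> \<Omega>}"

definition Lp_space :: "'a::euclidean_space set \<Rightarrow> real \<Rightarrow> ('a \<Rightarrow> 'b::euclidean_space) set" where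
  "Lp_space \<Omega> p = {f. set_borel_measurable lborel \<Omega> f \<and>
                      set_integrable lborel \<Omega> (\<lambda>x. norm (f x) powr p)}"

definition loc_integrable :: "'a::euclidean_space set \<Rightarrow> ('a \<Rightarrow> 'b::euclidean_space) \<Rightarrow> bool" where
  "loc_integrable \<Omega> f \<longleftrightarrow> (\<forall>K. compact K \<and> K \<subseteq> \<Omega> \<longrightarrow> set_integrable lborel K f)"

definition has_weak_gradient ::
    "'a::euclidean_space set \<Rightarrow> ('a \<Rightarrow> real) \<Rightarrow> ('a \<Rightarrow> 'a) \<Rightarrow> bool" where
  "has_weak_gradient \<Omega> u g \<longleftrightarrow> loc_integrable \<Omega> u \<and> loc_integrable \<Omega> g \<and>
     (\<forall>\<phi>\<in>test_functions \<Omega>. \<forall>b\<in>Basis.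
        (LINT x:\<Omega>|lborel. u x * frechet_derivative \<phi> (at x) b)
          = - (LINT x:\<Omega>|lborel. (g x \<bullet> b) * \<phi> x))"

text \<open>The weak gradient is unique only up to null subsets of the open set \<open>\<Omega>\<close>, and is only ever
  used inside integrals over \<open>\<Omega>\<close>.\<close>

definition weak_gradient :: "'a::euclidean_space set \<Rightarrow> ('a \<Rightarrow> real) \<Rightarrow> 'a \<Rightarrow> 'a" where
  "weak_gradient \<Omega> u = (SOME g. has_weak_gradient \<Omega> u g)"

definition W1p :: "'a::euclidean_space set \<Rightarrow> real \<Rightarrow> ('a \<Rightarrow> real) set" where
  "W1p \<Omega> p = {u \<in> Lp_space \<Omega> p. \<exists>g\<in>Lp_space \<Omega> p. has_weak_gradient \<Omega> u g}"

definition W1p_norm :: "'a::euclidean_space set \<Rightarrow> real \<Rightarrow> ('a \<Rightarrow> real) \<Rightarrow> real" where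
  "W1p_norm \<Omega> p u = ((LINT x:\<Omega>|lborel. \<bar>u x\<bar> powr p)
      + (LINT x:\<Omega>|lborel. norm (weak_gradient \<Omega> u x) powr p)) powr (1 / p)"

text \<open>Closure of the test functions in $W^{1,p}(\Omega)$; its elements are extended by $0$ to the
  whole space.\<close>

definition W1p0 :: "'a::euclidean_space set \<Rightarrow> real \<Rightarrow> ('a \<Rightarrow> real) set" where
  "W1p0 \<Omega> p = {u \<in> W1p \<Omega> p. (\<forall>x. x \<notin> \<Omega> \<longrightarrow> u x = 0) \<and>
     (\<forall>\<epsilon>>0. \<exists>\<phi>\<in>test_functions \<Omega>. W1p_norm \<Omega> p (\<lambda>x. u x - \<phi> x) < \<epsilon>)}"

text \<open>
  For arguments in $W^{1,p}_0(\Omega)$ with $\Omega$ bounded and open, $0 < t < 1$ and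
  $\alpha + \beta = p$, all integrands below are absolutely integrable, so the convention that a
  divergent integral is \<open>0\<close> is never used. Since \<open>0 powr a = 0\<close>, expressions such as
  $|a|^{p-2} a$ vanish at $a = 0$ for every exponent, and the kernels vanish on the diagonal
  (a null set).
\<close>

definition gagliardo_pow :: "real \<Rightarrow> real \<Rightarrow> ('a::euclidean_space \<Rightarrow> real) \<Rightarrow> real" where
  "gagliardo_pow p t w = (LINT (x, y)|(lborel \<Otimes>\<^sub>M lborel).
      \<bar>w x - w y\<bar> powr p / norm (x - y) powr (real DIM('a) + t * p))"

definition J_energy :: "'a::euclidean_space set \<Rightarrow> real \<Rightarrow> real \<Rightarrow> real \<Rightarrow> real \<Rightarrow> real
    \<Rightarrow> ('a \<Rightarrow> real) \<Rightarrow> ('a \<Rightarrow> real) \<Rightarrow> real" where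
  "J_energy \<Omega> p r s \<alpha> \<beta> w z = 1 / 2 *
     (((LINT x:\<Omega>|lborel. norm (weak_gradient \<Omega> w x) powr p) + gagliardo_pow p r w
       + (LINT x:\<Omega>|lborel. norm (weak_gradient \<Omega> z x) powr p) + gagliardo_pow p s z)
      / (LINT x:\<Omega>|lborel. \<bar>w x\<bar> powr \<alpha> * \<bar>z x\<bar> powr \<beta>))"

definition admissible_pairs ::
    "'a::euclidean_space set \<Rightarrow> real \<Rightarrow> (('a \<Rightarrow> real) \<times> ('a \<Rightarrow> real)) set" where
  "admissible_pairs \<Omega> p = {(w, z). w \<in> W1p0 \<Omega> p \<and> z \<in> W1p0 \<Omega> p \<and>
      \<not> (AE x in lborel. x \<in> \<Omega> \<longrightarrow> w x * z x = 0)}"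

definition lambda_inf ::
    "'a::euclidean_space set \<Rightarrow> real \<Rightarrow> real \<Rightarrow> real \<Rightarrow> real \<Rightarrow> real \<Rightarrow> real" where
  "lambda_inf \<Omega> p r s \<alpha> \<beta> = (INF (w, z)\<in>admissible_pairs \<Omega> p. J_energy \<Omega> p r s \<alpha> \<beta> w z)"

definition form_loc ::
    "'a::euclidean_space set \<Rightarrow> real \<Rightarrow> ('a \<Rightarrow> real) \<Rightarrow> ('a \<Rightarrow> real) \<Rightarrow> real" where
  "form_loc \<Omega> p w \<psi> = (LINT x:\<Omega>|lborel.
      norm (weak_gradient \<Omega> w x) powr (p - 2) * (weak_gradient \<Omega> w x \<bullet> weak_gradient \<Omega> \<psi> x))"

definition form_nonloc ::
    "real \<Rightarrow> real \<Rightarrow> ('a::euclidean_space \<Rightarrow> real) \<Rightarrow> ('a \<Rightarrow> real) \<Rightarrow> real" where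
  "form_nonloc t p w \<psi> = (LINT (x, y)|(lborel \<Otimes>\<^sub>M lborel).
      \<bar>w x - w y\<bar> powr (p - 2) * (w x - w y) * (\<psi> x - \<psi> y)
        / norm (x - y) powr (real DIM('a) + t * p))"

definition weak_solution :: "'a::euclidean_space set \<Rightarrow> real \<Rightarrow> real \<Rightarrow> real \<Rightarrow> real \<Rightarrow> real
    \<Rightarrow> real \<Rightarrow> ('a \<Rightarrow> real) \<Rightarrow> ('a \<Rightarrow> real) \<Rightarrow> bool" where
  "weak_solution \<Omega> p r s \<alpha> \<beta> lam u v \<longleftrightarrow> u \<in> W1p0 \<Omega> p \<and> v \<in> W1p0 \<Omega> p \<and>
     (\<forall>\<psi>\<in>W1p0 \<Omega> p. form_loc \<Omega> p u \<psi> + form_nonloc r p u \<psi>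
        = lam * (2 * \<alpha> / (\<alpha> + \<beta>))
            * (LINT x:\<Omega>|lborel. \<bar>u x\<bar> powr (\<alpha> - 2) * u x * \<bar>v x\<bar> powr \<beta> * \<psi> x)) \<and>
     (\<forall>\<phi>\<in>W1p0 \<Omega> p. form_loc \<Omega> p v \<phi> + form_nonloc s p v \<phi>
        = lam * (2 * \<beta> / (\<alpha> + \<beta>))
            * (LINT x:\<Omega>|lborel. \<bar>u x\<bar> powr \<alpha> * \<bar>v x\<bar> powr (\<beta> - 2) * v x * \<phi> x))"

definition eigenpair :: "'a::euclidean_space set \<Rightarrow> real \<Rightarrow> real \<Rightarrow> real \<Rightarrow> real \<Rightarrow> real
    \<Rightarrow> real \<Rightarrow> ('a \<Rightarrow> real) \<Rightarrow> ('a \<Rightarrow> real) \<Rightarrow> bool" where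
  "eigenpair \<Omega> p r s \<alpha> \<beta> lam u v \<longleftrightarrow> weak_solution \<Omega> p r s \<alpha> \<beta> lam u v \<and>
     \<not> (AE x in lborel. x \<in> \<Omega> \<longrightarrow> u x = 0 \<and> v x = 0)"

definition eigenvalue :: "'a::euclidean_space set \<Rightarrow> real \<Rightarrow> real \<Rightarrow> real \<Rightarrow> real \<Rightarrow> real
    \<Rightarrow> real \<Rightarrow> bool" where
  "eigenvalue \<Omega> p r s \<alpha> \<beta> lam \<longleftrightarrow> (\<exists>u v. eigenpair \<Omega> p r s \<alpha> \<beta> lam u v)"

definition no_sign_change :: "'a::euclidean_space set \<Rightarrow> ('a \<Rightarrow> real) \<Rightarrow> bool" where
  "no_sign_change \<Omega> u \<longleftrightarrow> (AE x in lborel. x \<in> \<Omega> \<longrightarrow> 0 \<le> u x) \<or> (AE x in lborel. x \<in> \<Omega> \<longrightarrow> u x \<le> 0)"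

end

theory Submission
  imports Defs "HOL-Complex_Analysis.Great_Picard"
begin

text \<open>
  Write \<open>E\<close> for the numerator and \<open>G\<close> for the denominator of the energy functional, which is then \<open>E / (2 G)\<close>.
  As \<open>E\<close> is a sum of \<open>p\<close>-th powers of \<open>L\<^sup>p\<close> norms and \<open>p = \<alpha> + \<beta> \<ge> 2\<close>, Clarkson's inequality gives
  \<open>E ((w + w') / 2) + E ((w - w') / 2) \<le> (E w + E w') / 2\<close>.
  A minimizing sequence normalized by \<open>G = 1\<close> has bounded Gagliardo seminorms, which already yields an \<open>L\<^sup>p\<close>
  Cauchy subsequence (no Rellich theorem for the gradient is needed). Its midpoints then satisfy
  \<open>G \<rightarrow> 1\<close> and are nearly minimizing, so Clarkson's inequality makes the gradients Cauchy as well
  (no weak compactness is needed). The sequence may be taken among nonnegative test functions, because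
  \<open>sqrt (\<phi>\<^sup>2 + \<epsilon>\<^sup>2) - \<epsilon>\<close> is a test function with no larger energy; hence the signs.
  The Euler-Lagrange equations follow from the global inequality \<open>E \<ge> 2 \<lambda> G\<close>, since \<open>G\<close> lies above its
  tangent even where it is not differentiable. Testing the system with the solution itself shows that
  no eigenvalue is smaller.
\<close>

section \<open>Inequalities for powers\<close>

text \<open>Both \<open>E\<close> and \<open>G\<close> are homogeneous of degree \<alpha> + \<beta>
  = p. This permits the normalization and turns minimality into an inequality without a quotient,
  valid for all pairs, also for those with \<open>G = 0\<close>; midpoints and variations can then
  be inserted without checking admissibility. Passing from w to |w| inside the Sobolev space would
  call for a weak chain rule; smoothing the absolute value of an approximating test function needs
  only the classical one. Boundedness of \<Omega> acts through the nonlocal term: a function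
  vanishing off \<Omega> interacts with a ball outside \<Omega>, so the seminorm controls the L^p
  norm. This bounds minimizing sequences and also shows that an eigenpair cannot have
  \<open>G = 0\<close>. The coefficients 2\<alpha>/p and 2\<beta>/p of the system add up to 2, so
  testing both equations with the solution and adding gives exactly
  \<open>E = 2 \<mu> G\<close>.\<close>

lemma powr_above_tangent:
  fixes a b q :: real
  assumes "0 \<le> a" "0 \<le> b" "1 \<le> q"
  shows "b powr q + q * b powr (q - 1) * (a - b) \<le> a powr q"
\<comment> \<open>At the endpoint 0 no derivative is used: for \<open>a = 0\<close> the claim is
  \<open>b powr q \<le> q * b powr q\<close>, and for \<open>b = 0\<close> the left side vanishes
  because \<open>0 powr\<close> any exponent is 0.\<close>
proof (cases "a = 0 \<or> b = 0")
  case True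
  have "b powr (q - 1) * b = b powr q"
    using powr_mult_base[of b "q - 1"] assms by (simp add: mult_ac)
  then have "q * (b powr (q - 1) * b) = q * b powr q" by (simp only:)
  moreover have "b powr q \<le> q * b powr q"
    using assms mult_right_mono[of 1 q "b powr q"] by simp
  ultimately show ?thesis using True assms by (auto simp: mult.assoc)
next
  case False
  with assms have "a > 0" "b > 0" by auto
  have "a powr q - b powr q \<ge> (q * b powr (q - 1)) * (a - b)"
  proof (rule convex_on_imp_above_tangent[where A="{0<..}"])
    show "convex_on {0<..} (\<lambda>x. x powr q)" using powr_convex assms by auto
    show "((\<lambda>x. x powr q) has_real_derivative q * b powr (q - 1)) (at b within {0<..})"
      using \<open>b > 0\<close> by (auto intro!: derivative_eq_intros)
  qed (use \<open>a > 0\<close> \<open>b > 0\<close> in \<open>auto simp: interior_open\<close>)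
  then show ?thesis by simp
qed

text \<open>Extends convexity to the closed half line: averaging the tangent inequality at the
  intermediate point \<open>z\<close> with weights \<open>1 - t\<close> and \<open>t\<close> makes
  the linear terms cancel.\<close>

lemma convex_on_powr_nonneg:
  assumes "1 \<le> q"
  shows "convex_on {0::real..} (\<lambda>x. x powr q)"
proof (rule convex_onI)
  fix t x y :: real
  assume t: "0 < t" "t < 1" and xy: "x \<in> {0..}" "y \<in> {0..}"
  define z where "z = (1 - t) *\<^sub>R x + t *\<^sub>R y"
  have "z \<ge> 0" using t xy by (simp add: z_def)
  have "(1 - t) * (z powr q + q * z powr (q - 1) * (x - z)) + t * (z powr q + q * z powr (q - 1) * (y - z))
     \<le> (1 - t) * x powr q + t * y powr q"
    using t xy \<open>z \<ge> 0\<close> assms by (intro add_mono mult_left_mono powr_above_tangent) auto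
  moreover have "(1 - t) * (z powr q + q * z powr (q - 1) * (x - z)) + t * (z powr q + q * z powr (q - 1) * (y - z))
     = z powr q + q * z powr (q - 1) * ((1 - t) * x + t * y - z)"
    by (simp add: algebra_simps)
  ultimately show "((1 - t) *\<^sub>R x + t *\<^sub>R y) powr q \<le> (1 - t) * x powr q + t * y powr q"
    by (simp add: z_def)
qed simp

text \<open>Cauchy-Schwarz reduces the claim to the scalar tangent inequality for the norms. The
  convention \<open>0 powr a = 0\<close> selects the subgradient 0 at \<open>y = 0\<close>, so that
  q = 1 is covered although the norm is not differentiable there.\<close>

lemma norm_powr_above_tangent:
  fixes x y :: "'a::real_inner"
  assumes "1 \<le> q"
  shows "norm y powr q + q * norm y powr (q - 2) * (y \<bullet> (x - y)) \<le> norm x powr q"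
proof (cases "y = 0")
  case False
  have "y \<bullet> (x - y) \<le> norm y * (norm x - norm y)"
    using norm_cauchy_schwarz[of y x]
    by (simp add: inner_diff_right power2_norm_eq_inner[symmetric] algebra_simps power2_eq_square)
  then have "q * norm y powr (q - 2) * (y \<bullet> (x - y)) \<le> q * norm y powr (q - 2) * (norm y * (norm x - norm y))"
    using assms by (intro mult_left_mono) auto
  also have "\<dots> = q * norm y powr (q - 1) * (norm x - norm y)"
    using False powr_mult_base[of "norm y" "q - 2"] by (simp add: mult_ac)
  finally show ?thesis
    using powr_above_tangent[OF norm_ge_zero norm_ge_zero assms, of y x] by linarith
qed simp

text \<open>The ratios \<open>x / (x + y)\<close> and \<open>y / (x + y)\<close> lie in the unit
  interval, where the q-th power is at most the identity, and they add up to 1.\<close>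

lemma powr_add_superadditive:
  fixes x y q :: real
  assumes "0 \<le> x" "0 \<le> y" "1 \<le> q"
  shows "x powr q + y powr q \<le> (x + y) powr q"
proof (cases "x + y = 0")
  case False
  with assms have "x + y > 0" by simp
  have *: "z powr q \<le> (z / (x + y)) * (x + y) powr q" if "0 \<le> z" "z \<le> x + y" for z
  proof -
    have "(z / (x + y)) powr q \<le> (z / (x + y)) powr 1"
      using that \<open>x + y > 0\<close> assms by (intro powr_mono') auto
    then have "z powr q / (x + y) powr q \<le> z / (x + y)"
      using that \<open>x + y > 0\<close> by (simp add: powr_divide)
    then show ?thesis using \<open>x + y > 0\<close> by (simp add: field_simps)
  qed
  have "x powr q + y powr q \<le> (x / (x + y)) * (x + y) powr q + (y / (x + y)) * (x + y) powr q"
    using assms by (intro add_mono *) auto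
  also have "\<dots> = (x / (x + y) + y / (x + y)) * (x + y) powr q" by (simp only: distrib_right)
  also have "x / (x + y) + y / (x + y) = 1" using \<open>x + y > 0\<close> by (simp add: add_divide_distrib[symmetric])
  finally show ?thesis by simp
next
  case True
  with assms have "x = 0" "y = 0" by auto
  then show ?thesis by simp
qed

text \<open>Convexity at the points \<open>a / (1 - t)\<close> and \<open>b / t\<close>. As t tends
  to 0 the factor of \<open>a powr q\<close> tends to 1, at the price of a large factor in front of
  \<open>b powr q\<close>; this lets energies pass to limits without losing a constant.\<close>

lemma powr_convex_comb:
  fixes a b q t :: real
  assumes "0 \<le> a" "0 \<le> b" "1 \<le> q" "0 < t" "t < 1"
  shows "(a + b) powr q \<le> (1 - t) powr (1 - q) * a powr q + t powr (1 - q) * b powr q"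
proof -
  have "((1 - t) *\<^sub>R (a / (1 - t)) + t *\<^sub>R (b / t)) powr q
      \<le> (1 - t) * (a / (1 - t)) powr q + t * (b / t) powr q"
    using assms convex_on_powr_nonneg[of q] by (intro convex_onD) auto
  also have "(1 - t) * (a / (1 - t)) powr q = (1 - t) powr (1 - q) * a powr q"
    using assms by (simp add: powr_divide powr_diff)
  also have "t * (b / t) powr q = t powr (1 - q) * b powr q"
    using assms by (simp add: powr_divide powr_diff)
  also have "(1 - t) *\<^sub>R (a / (1 - t)) + t *\<^sub>R (b / t) = a + b"
    using assms by simp
  finally show ?thesis .
qed

lemma norm_add_powr_convex_comb:
  fixes a b :: "'a::real_normed_vector"
  assumes "1 \<le> q" "0 < t" "t < 1"
  shows "norm (a + b) powr q \<le> (1 - t) powr (1 - q) * norm a powr q + t powr (1 - q) * norm b powr q"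
proof -
  have "norm (a + b) powr q \<le> (norm a + norm b) powr q"
    using assms by (intro powr_mono2 norm_triangle_ineq) auto
  also have "\<dots> \<le> (1 - t) powr (1 - q) * norm a powr q + t powr (1 - q) * norm b powr q"
    using assms by (intro powr_convex_comb) auto
  finally show ?thesis .
qed

lemma norm_add_powr_le:
  fixes a b :: "'a::real_normed_vector"
  assumes "1 \<le> q"
  shows "norm (a + b) powr q \<le> 2 powr (q - 1) * (norm a powr q + norm b powr q)"
proof -
  have "(1/2::real) powr (1 - q) = 2 powr (q - 1)"
    by (simp add: powr_divide powr_diff)
  then show ?thesis
    using norm_add_powr_convex_comb[of q "1/2" a b] assms by (simp add: algebra_simps)
qed

lemma norm_diff_powr_le:
  fixes a b :: "'a::real_normed_vector"
  assumes "1 \<le> q"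
  shows "norm (a - b) powr q \<le> 2 powr (q - 1) * (norm a powr q + norm b powr q)"
  using norm_add_powr_le[of q a "-b"] assms by simp

text \<open>The p-th power is the (p/2)-th power of the square, with p/2 \<ge> 1. Superadditivity
  merges the two terms, the parallelogram law turns the sum of squares into an average, and
  convexity splits the average.\<close>

lemma clarkson_pointwise:
  fixes a b :: "'a::real_inner"
  assumes "2 \<le> p"
  shows "norm ((1/2) *\<^sub>R (a + b)) powr p + norm ((1/2) *\<^sub>R (a - b)) powr p
    \<le> 1/2 * norm a powr p + 1/2 * norm b powr p"
proof -
  have sq: "norm x powr p = ((norm x)\<^sup>2) powr (p/2)" for x :: 'a
    by (simp add: powr_powr flip: powr_numeral)
  have par: "(norm ((1/2) *\<^sub>R (a + b)))\<^sup>2 + (norm ((1/2) *\<^sub>R (a - b)))\<^sup>2 = 1/2 * (norm a)\<^sup>2 + 1/2 * (norm b)\<^sup>2"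
    by (simp add: power2_norm_eq_inner inner_add_left inner_add_right inner_diff_left inner_diff_right inner_commute field_simps)
  have "norm ((1/2) *\<^sub>R (a + b)) powr p + norm ((1/2) *\<^sub>R (a - b)) powr p
     \<le> (1/2 * (norm a)\<^sup>2 + 1/2 * (norm b)\<^sup>2) powr (p/2)"
    unfolding sq par[symmetric] using assms by (intro powr_add_superadditive) auto
  also have "\<dots> \<le> 1/2 * ((norm a)\<^sup>2) powr (p/2) + 1/2 * ((norm b)\<^sup>2) powr (p/2)"
    using convex_onD[OF convex_on_powr_nonneg[of "p/2"], of "1/2" "(norm a)\<^sup>2" "(norm b)\<^sup>2"] assms by simp
  finally show ?thesis unfolding sq .
qed

text \<open>A version of Young's inequality with a small parameter and no conjugate exponent: the
  two terms on the right answer for the cases \<open>b \<le> e * M\<close> and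
  \<open>b > e * M\<close>.\<close>

lemma powr_mult_le_eps:
  fixes M b e p :: real
  assumes "0 \<le> M" "0 \<le> b" "1 \<le> p" "0 < e"
  shows "M powr (p - 1) * b \<le> e * M powr p + e powr (1 - p) * b powr p"
proof (cases "b \<le> e * M")
  case True
  have "M powr (p - 1) * b \<le> M powr (p - 1) * (e * M)"
    using True by (intro mult_left_mono) auto
  also have "\<dots> = e * M powr p"
    using assms powr_mult_base[of M "p - 1"] by (simp add: mult_ac)
  also have "\<dots> \<le> e * M powr p + e powr (1 - p) * b powr p" by simp
  finally show ?thesis .
next
  case False
  then have "M \<le> b / e" using assms by (simp add: field_simps)
  then have "M powr (p - 1) * b \<le> (b / e) powr (p - 1) * b"
    using assms by (intro mult_right_mono powr_mono2) auto
  also have "\<dots> = e powr (1 - p) * b powr p"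
    using assms powr_mult_base[of b "p - 1"] powr_minus_divide[of e "p - 1"]
    by (simp add: powr_divide mult.commute)
  also have "\<dots> \<le> e * M powr p + e powr (1 - p) * b powr p" using assms by simp
  finally show ?thesis .
qed

text \<open>A mean value bound drawn from the tangent inequality at each of the two points in turn,
  so that the point 0 and the exponent 1 need no separate case.\<close>

lemma powr_diff_le:
  fixes x y M q :: real
  assumes "0 \<le> x" "x \<le> M" "0 \<le> y" "y \<le> M" "1 \<le> q"
  shows "\<bar>x powr q - y powr q\<bar> \<le> q * M powr (q - 1) * \<bar>x - y\<bar>"
proof -
  have *: "u powr q - v powr q \<le> q * M powr (q - 1) * \<bar>u - v\<bar>"
    if "0 \<le> u" "u \<le> M" "0 \<le> v" "v \<le> M" for u v
  proof -
    have "u powr q - v powr q \<le> q * u powr (q - 1) * (u - v)"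
      using powr_above_tangent[of v u q] that assms by (simp add: algebra_simps)
    also have "\<dots> \<le> q * u powr (q - 1) * \<bar>u - v\<bar>"
      using assms by (intro mult_left_mono) auto
    also have "\<dots> \<le> q * M powr (q - 1) * \<bar>u - v\<bar>"
      using assms that by (intro mult_right_mono mult_left_mono powr_mono2) auto
    finally show ?thesis .
  qed
  show ?thesis using *[of x y] *[of y x] assms by (auto simp: abs_le_iff abs_minus_commute)
qed

text \<open>Changing one factor at a time and bounding every value by the maximum \<open>M\<close>
  leaves \<open>M powr (p - 1)\<close> times the differences, which the parametrized Young
  inequality separates. After integration the first term is small through \<open>e\<close>, the
  second through the L^p distances.\<close>

lemma powr_prod_diff_le:
  fixes a b c d \<alpha> \<beta> e :: real
  assumes "1 \<le> \<alpha>" "1 \<le> \<beta>" "0 < e"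
  defines "p \<equiv> \<alpha> + \<beta>"
  shows "\<bar>\<bar>a\<bar> powr \<alpha> * \<bar>b\<bar> powr \<beta> - \<bar>c\<bar> powr \<alpha> * \<bar>d\<bar> powr \<beta>\<bar>
    \<le> 2 * p * e * (\<bar>a\<bar> powr p + \<bar>b\<bar> powr p + \<bar>c\<bar> powr p + \<bar>d\<bar> powr p)
      + p * e powr (1 - p) * (\<bar>a - c\<bar> powr p + \<bar>b - d\<bar> powr p)"
proof -
  define M where "M = max (max \<bar>a\<bar> \<bar>b\<bar>) (max \<bar>c\<bar> \<bar>d\<bar>)"
  have M: "\<bar>a\<bar> \<le> M" "\<bar>b\<bar> \<le> M" "\<bar>c\<bar> \<le> M" "\<bar>d\<bar> \<le> M" "0 \<le> M" unfolding M_def by linarith+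
  have p: "1 \<le> p" "\<alpha> \<le> p" "\<beta> \<le> p" using assms by (auto simp: p_def)
  have Mp: "M powr p \<le> \<bar>a\<bar> powr p + \<bar>b\<bar> powr p + \<bar>c\<bar> powr p + \<bar>d\<bar> powr p"
    unfolding M_def max_def by (auto simp: add_increasing add_increasing2)
  have "\<bar>a\<bar> powr \<alpha> * \<bar>b\<bar> powr \<beta> - \<bar>c\<bar> powr \<alpha> * \<bar>d\<bar> powr \<beta>
      = (\<bar>a\<bar> powr \<alpha> - \<bar>c\<bar> powr \<alpha>) * \<bar>b\<bar> powr \<beta> + \<bar>c\<bar> powr \<alpha> * (\<bar>b\<bar> powr \<beta> - \<bar>d\<bar> powr \<beta>)"
    by (simp add: algebra_simps)
  then have "\<bar>\<bar>a\<bar> powr \<alpha> * \<bar>b\<bar> powr \<beta> - \<bar>c\<bar> powr \<alpha> * \<bar>d\<bar> powr \<beta>\<bar>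
      \<le> \<bar>\<bar>a\<bar> powr \<alpha> - \<bar>c\<bar> powr \<alpha>\<bar> * \<bar>b\<bar> powr \<beta> + \<bar>c\<bar> powr \<alpha> * \<bar>\<bar>b\<bar> powr \<beta> - \<bar>d\<bar> powr \<beta>\<bar>"
    using abs_triangle_ineq[of "(\<bar>a\<bar> powr \<alpha> - \<bar>c\<bar> powr \<alpha>) * \<bar>b\<bar> powr \<beta>"
      "\<bar>c\<bar> powr \<alpha> * (\<bar>b\<bar> powr \<beta> - \<bar>d\<bar> powr \<beta>)"] by (simp add: abs_mult)
  also have "\<dots> \<le> (\<alpha> * M powr (\<alpha> - 1) * \<bar>a - c\<bar>) * M powr \<beta> + M powr \<alpha> * (\<beta> * M powr (\<beta> - 1) * \<bar>b - d\<bar>)"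
  proof (intro add_mono mult_mono)
    show "\<bar>\<bar>a\<bar> powr \<alpha> - \<bar>c\<bar> powr \<alpha>\<bar> \<le> \<alpha> * M powr (\<alpha> - 1) * \<bar>a - c\<bar>"
      using M assms by (intro order.trans[OF powr_diff_le[of "\<bar>a\<bar>" M "\<bar>c\<bar>" \<alpha>]] mult_left_mono) auto
    show "\<bar>\<bar>b\<bar> powr \<beta> - \<bar>d\<bar> powr \<beta>\<bar> \<le> \<beta> * M powr (\<beta> - 1) * \<bar>b - d\<bar>"
      using M assms by (intro order.trans[OF powr_diff_le[of "\<bar>b\<bar>" M "\<bar>d\<bar>" \<beta>]] mult_left_mono) auto
  qed (use assms M in \<open>auto intro!: powr_mono2\<close>)
  also have "\<dots> = M powr (p - 1) * (\<alpha> * \<bar>a - c\<bar> + \<beta> * \<bar>b - d\<bar>)"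
  proof -
    have "M powr (p - 1) = M powr (\<alpha> - 1) * M powr \<beta>" "M powr \<alpha> * M powr (\<beta> - 1) = M powr (p - 1)"
      by (simp_all add: p_def powr_add[symmetric] algebra_simps)
    note e = this
    have "(\<alpha> * M powr (\<alpha> - 1) * \<bar>a - c\<bar>) * M powr \<beta> + M powr \<alpha> * (\<beta> * M powr (\<beta> - 1) * \<bar>b - d\<bar>)
        = \<alpha> * \<bar>a - c\<bar> * (M powr (\<alpha> - 1) * M powr \<beta>) + \<beta> * \<bar>b - d\<bar> * (M powr \<alpha> * M powr (\<beta> - 1))"
      by (simp only: mult_ac)
    then show ?thesis unfolding e(2) unfolding e(1)[symmetric] by (simp add: distrib_left mult_ac)
  qed
  also have "\<dots> \<le> p * (M powr (p - 1) * \<bar>a - c\<bar> + M powr (p - 1) * \<bar>b - d\<bar>)"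
    using mult_right_mono[OF p(2), of "M powr (p - 1) * \<bar>a - c\<bar>"]
      mult_right_mono[OF p(3), of "M powr (p - 1) * \<bar>b - d\<bar>"] by (simp add: algebra_simps)
  also have "\<dots> \<le> p * ((e * M powr p + e powr (1 - p) * \<bar>a - c\<bar> powr p) + (e * M powr p + e powr (1 - p) * \<bar>b - d\<bar> powr p))"
    using assms p M by (intro mult_left_mono add_mono powr_mult_le_eps) auto
  also have "\<dots> = 2 * p * e * M powr p + p * e powr (1 - p) * (\<bar>a - c\<bar> powr p + \<bar>b - d\<bar> powr p)"
    by (simp add: algebra_simps)
  also have "\<dots> \<le> 2 * p * e * (\<bar>a\<bar> powr p + \<bar>b\<bar> powr p + \<bar>c\<bar> powr p + \<bar>d\<bar> powr p)
      + p * e powr (1 - p) * (\<bar>a - c\<bar> powr p + \<bar>b - d\<bar> powr p)"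
    using assms p by (intro add_right_mono mult_left_mono Mp) auto
  finally show ?thesis .
qed

lemma powr_prod_le:
  fixes a b \<alpha> \<beta> :: real
  assumes "0 \<le> \<alpha>" "0 \<le> \<beta>" "0 \<le> a" "0 \<le> b"
  shows "a powr \<alpha> * b powr \<beta> \<le> a powr (\<alpha> + \<beta>) + b powr (\<alpha> + \<beta>)"
proof -
  define M where "M = max a b"
  have "a powr \<alpha> * b powr \<beta> \<le> M powr \<alpha> * M powr \<beta>"
    using assms by (intro mult_mono powr_mono2) (auto simp: M_def)
  also have "\<dots> = M powr (\<alpha> + \<beta>)" by (simp add: powr_add)
  also have "\<dots> \<le> a powr (\<alpha> + \<beta>) + b powr (\<alpha> + \<beta>)"
    by (auto simp: M_def max_def)
  finally show ?thesis .
qed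

section \<open>The space of p-integrable functions\<close>

text \<open>Stated for an arbitrary measure and for vector values, so that gradients under
  \<open>lborel\<close> and difference quotients under the product measure obey the same lemmas. It
  speaks of functions, not of classes.\<close>

definition in_Lp :: "'a measure \<Rightarrow> real \<Rightarrow> ('a \<Rightarrow> 'b::euclidean_space) \<Rightarrow> bool" where
  "in_Lp M p f \<longleftrightarrow> f \<in> borel_measurable M \<and> integrable M (\<lambda>x. norm (f x) powr p)"

lemma in_LpD:
  assumes "in_Lp M p f"
  shows "f \<in> borel_measurable M" "integrable M (\<lambda>x. norm (f x) powr p)"
  using assms by (auto simp: in_Lp_def)

lemma in_Lp_bound:
  assumes "f \<in> borel_measurable M" "integrable M g" "AE x in M. norm (f x) powr p \<le> g x"
  shows "in_Lp M p f"
proof -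
  have [measurable]: "f \<in> borel_measurable M" by fact
  have "integrable M (\<lambda>x. norm (f x) powr p)"
    by (rule Bochner_Integration.integrable_bound[OF assms(2)]) (use assms(3) in \<open>auto elim!: eventually_mono\<close>)
  then show ?thesis by (simp add: in_Lp_def)
qed

lemma in_Lp_scaleR: "in_Lp M p f \<Longrightarrow> in_Lp M p (\<lambda>x. c *\<^sub>R f x)"
  by (auto simp: in_Lp_def powr_mult)

lemma Lp_integral_scaleR:
  "(LINT x|M. norm (c *\<^sub>R f x) powr p) = \<bar>c\<bar> powr p * (LINT x|M. norm (f x) powr p)"
  by (simp add: powr_mult)

lemma in_Lp_add:
  assumes "in_Lp M p f" "in_Lp M p g" "1 \<le> p"
  shows "in_Lp M p (\<lambda>x. f x + g x)"
proof (rule in_Lp_bound)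
  show "integrable M (\<lambda>x. 2 powr (p - 1) * (norm (f x) powr p + norm (g x) powr p))"
    using assms by (auto simp: in_Lp_def)
  show "AE x in M. norm (f x + g x) powr p \<le> 2 powr (p - 1) * (norm (f x) powr p + norm (g x) powr p)"
    using assms by (intro AE_I2 norm_add_powr_le) auto
qed (use assms in \<open>auto simp: in_Lp_def\<close>)

lemma in_Lp_diff:
  assumes "in_Lp M p f" "in_Lp M p g" "1 \<le> p"
  shows "in_Lp M p (\<lambda>x. f x - g x)"
  using in_Lp_add[OF assms(1) in_Lp_scaleR[OF assms(2), of "-1"] assms(3)] by simp

lemma in_Lp_cong_AE:
  assumes "in_Lp M p f" "g \<in> borel_measurable M" "AE x in M. f x = g x"
  shows "in_Lp M p g"
  using assms(2) in_LpD(2)[OF assms(1)]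
  by (rule in_Lp_bound) (use assms(3) in auto)

lemma Lp_integral_add_convex_comb:
  assumes "in_Lp M p f" "in_Lp M p g" "1 \<le> p" "0 < t" "t < 1"
  shows "(LINT x|M. norm (f x + g x) powr p)
     \<le> (1 - t) powr (1 - p) * (LINT x|M. norm (f x) powr p) + t powr (1 - p) * (LINT x|M. norm (g x) powr p)"
proof -
  have "(LINT x|M. norm (f x + g x) powr p)
     \<le> (LINT x|M. (1 - t) powr (1 - p) * norm (f x) powr p + t powr (1 - p) * norm (g x) powr p)"
    using in_LpD(2)[OF in_Lp_add[OF assms(1-3)]] assms
    by (intro integral_mono norm_add_powr_convex_comb) (auto simp: in_Lp_def)
  then show ?thesis using assms by (simp add: in_Lp_def)
qed

lemma Lp_integral_add_le:
  assumes "in_Lp M p f" "in_Lp M p g" "1 \<le> p"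
  shows "(LINT x|M. norm (f x + g x) powr p)
     \<le> 2 powr (p - 1) * ((LINT x|M. norm (f x) powr p) + (LINT x|M. norm (g x) powr p))"
proof -
  have "(LINT x|M. norm (f x + g x) powr p)
     \<le> (LINT x|M. 2 powr (p - 1) * (norm (f x) powr p + norm (g x) powr p))"
    using in_LpD(2)[OF in_Lp_add[OF assms(1-3)]] assms
    by (intro integral_mono norm_add_powr_le) (auto simp: in_Lp_def)
  then show ?thesis using assms by (simp add: in_Lp_def)
qed

lemma Lp_integral_diff_le:
  assumes "in_Lp M p f" "in_Lp M p g" "1 \<le> p"
  shows "(LINT x|M. norm (f x - g x) powr p)
     \<le> 2 powr (p - 1) * ((LINT x|M. norm (f x) powr p) + (LINT x|M. norm (g x) powr p))"
  using Lp_integral_add_le[OF assms(1) in_Lp_scaleR[OF assms(2), of "-1"] assms(3)] by simp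

lemma clarkson_integral:
  assumes "in_Lp M p f" "in_Lp M p g" "2 \<le> p"
  shows "(LINT x|M. norm ((1/2) *\<^sub>R (f x + g x)) powr p) + (LINT x|M. norm ((1/2) *\<^sub>R (f x - g x)) powr p)
     \<le> 1/2 * (LINT x|M. norm (f x) powr p) + 1/2 * (LINT x|M. norm (g x) powr p)"
proof -
  have i: "integrable M (\<lambda>x. norm ((1/2) *\<^sub>R (f x + g x)) powr p)" "integrable M (\<lambda>x. norm ((1/2) *\<^sub>R (f x - g x)) powr p)"
    using in_Lp_scaleR[OF in_Lp_add[OF assms(1,2)], of "1/2"] in_Lp_scaleR[OF in_Lp_diff[OF assms(1,2)], of "1/2"] assms
    by (auto simp: in_Lp_def)
  have "(LINT x|M. norm ((1/2) *\<^sub>R (f x + g x)) powr p + norm ((1/2) *\<^sub>R (f x - g x)) powr p)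
     \<le> (LINT x|M. 1/2 * norm (f x) powr p + 1/2 * norm (g x) powr p)"
    using assms i by (intro integral_mono clarkson_pointwise Bochner_Integration.integrable_add) (auto simp: in_Lp_def)
  then show ?thesis using assms i by (simp add: in_Lp_def del: norm_scaleR)
qed

lemma tendsto_powr_zero_cancel:
  fixes a :: "nat \<Rightarrow> real"
  assumes "(\<lambda>n. \<bar>a n\<bar> powr p) \<longlonglongrightarrow> 0" "0 < p"
  shows "a \<longlonglongrightarrow> 0"
proof -
  have "(\<lambda>n. (\<bar>a n\<bar> powr p) powr (1/p)) \<longlonglongrightarrow> 0 powr (1/p)"
    using assms by (intro tendsto_powr') auto
  then show ?thesis
    using assms(2) by (simp add: powr_powr tendsto_rabs_zero_iff)
qed

lemma Lp_tendsto_AE_subseq: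
  assumes "\<And>n. in_Lp M p (f n)" "in_Lp M p g" "1 \<le> p"
    and "(\<lambda>n. LINT x|M. norm (f n x - g x) powr p) \<longlonglongrightarrow> 0"
  obtains r :: "nat \<Rightarrow> nat" where "strict_mono r" "AE x in M. (\<lambda>n. f (r n) x) \<longlonglongrightarrow> g x"
proof -
  have "\<exists>r::nat\<Rightarrow>nat. strict_mono r \<and> (AE x in M. (\<lambda>n. norm (f (r n) x - g x) powr p) \<longlonglongrightarrow> 0)"
    by (rule tendsto_L1_AE_subseq) (use in_LpD(2)[OF in_Lp_diff[OF assms(1,2,3)]] assms(4) in auto)
  then obtain r where r: "strict_mono r" "AE x in M. (\<lambda>n. norm (f (r n) x - g x) powr p) \<longlonglongrightarrow> 0" by blast
  have "AE x in M. (\<lambda>n. f (r n) x) \<longlonglongrightarrow> g x"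
    using r(2)
  proof eventually_elim
    case (elim x)
    then have "(\<lambda>n. norm (f (r n) x - g x)) \<longlonglongrightarrow> 0"
      using assms(3) tendsto_powr_zero_cancel[of "\<lambda>n. norm (f (r n) x - g x)" p] by simp
    then show ?case by (simp add: tendsto_norm_zero_iff LIM_zero_iff)
  qed
  with r(1) show ?thesis by (rule that)
qed

text \<open>Fatou's lemma is applied to nonnegative extended integrals, so the finite bound proves
  integrability of the limit as well. Positivity of p makes \<open>powr p\<close> continuous at
  0.\<close>

lemma Lp_fatou:
  assumes "\<And>n. in_Lp M p (f n)" "g \<in> borel_measurable M" "0 < p"
    and "AE x in M. (\<lambda>n. f n x) \<longlonglongrightarrow> g x"
    and bd: "\<And>n. (LINT x|M. norm (f n x) powr p) \<le> C"
  shows "in_Lp M p g" "(LINT x|M. norm (g x) powr p) \<le> C"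
proof -
  have [measurable]: "f n \<in> borel_measurable M" "g \<in> borel_measurable M" for n
    using assms by (auto simp: in_Lp_def)
  have C: "0 \<le> C" by (rule order.trans[OF _ bd[of 0]]) simp
  have "(\<integral>\<^sup>+x. ennreal (norm (g x) powr p) \<partial>M) = (\<integral>\<^sup>+x. liminf (\<lambda>n. ennreal (norm (f n x) powr p)) \<partial>M)"
    using assms(4)
  proof (intro nn_integral_cong_AE, eventually_elim)
    case (elim x)
    have "(\<lambda>n. ennreal (norm (f n x) powr p)) \<longlonglongrightarrow> ennreal (norm (g x) powr p)"
      using elim assms(3) by (intro tendsto_intros tendsto_powr') auto
    from lim_imp_Liminf[OF _ this] show ?case by simp
  qed
  also have "\<dots> \<le> liminf (\<lambda>n. \<integral>\<^sup>+x. ennreal (norm (f n x) powr p) \<partial>M)"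
    by (intro nn_integral_liminf) auto
  also have "\<dots> = liminf (\<lambda>n. ennreal (LINT x|M. norm (f n x) powr p))"
    using in_LpD(2)[OF assms(1)] by (simp add: nn_integral_eq_integral)
  also have "\<dots> \<le> liminf (\<lambda>n. ennreal C)"
    by (intro Liminf_mono always_eventually allI ennreal_leI bd)
  also have "\<dots> = ennreal C" by (intro Liminf_const) simp
  finally have *: "(\<integral>\<^sup>+x. ennreal (norm (g x) powr p) \<partial>M) \<le> ennreal C" .
  then show g: "in_Lp M p g"
    by (auto simp: in_Lp_def integrable_iff_bounded intro: order.strict_trans1)
  show "(LINT x|M. norm (g x) powr p) \<le> C"
    using * C unfolding nn_integral_eq_integral[OF in_LpD(2)[OF g] AE_I2[OF powr_ge_zero]] by simp
qed

text \<open>The Riesz-Fischer argument: a rapidly converging subsequence has an almost everywhere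
  limit, and Fatou's lemma identifies it as the limit of the whole sequence in norm.\<close>

lemma Lp_complete:
  assumes f: "\<And>n. in_Lp M p (f n)" and p: "1 \<le> p"
    and Cauchy: "\<And>e. 0 < e \<Longrightarrow> \<exists>N::nat. \<forall>i\<ge>N. \<forall>j\<ge>N. (LINT x|M. norm (f i x - f j x) powr p) < e"
  obtains g where "in_Lp M p g" "(\<lambda>n. LINT x|M. norm (f n x - g x) powr p) \<longlonglongrightarrow> 0"
proof -
  define c :: "nat \<Rightarrow> real" where "c n = (1/2) ^ n" for n
  have c: "0 < c n" for n by (simp add: c_def)
  \<comment> \<open>The threshold is made so that the p-th powers of the differences, divided by
    \<open>c n powr p\<close>, still have integrals at most \<open>c n\<close>. Their sum is then
    finite almost everywhere, and wherever it is finite the differences are dominated by a geometric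
    series.\<close>
  have "\<exists>r. \<forall>n. (\<forall>i\<ge>r n. \<forall>j\<ge>r n. (LINT x|M. norm (f i x - f j x) powr p) < c n * c n powr p) \<and> r (Suc n) > (r n :: nat)"
  proof (intro dependent_nat_choice)
    show "\<exists>N. \<forall>i\<ge>N. \<forall>j\<ge>N. (LINT x|M. norm (f i x - f j x) powr p) < c 0 * c 0 powr p"
      using Cauchy[of "c 0 * c 0 powr p"] c[of 0] by auto
    fix r n
    obtain N where "\<forall>i\<ge>N. \<forall>j\<ge>N. (LINT x|M. norm (f i x - f j x) powr p) < c (Suc n) * c (Suc n) powr p"
      using Cauchy[of "c (Suc n) * c (Suc n) powr p"] c[of "Suc n"] by auto
    then show "\<exists>s. (\<forall>i\<ge>s. \<forall>j\<ge>s. (LINT x|M. norm (f i x - f j x) powr p) < c (Suc n) * c (Suc n) powr p) \<and> s > r"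
      by (intro exI[of _ "max N (Suc r)"]) auto
  qed
  then obtain r where r: "\<And>n i j. r n \<le> i \<Longrightarrow> r n \<le> j \<Longrightarrow> (LINT x|M. norm (f i x - f j x) powr p) < c n * c n powr p"
      "\<And>n. r n < r (Suc n)" by blast
  have mono: "strict_mono r" using r(2) by (simp add: strict_mono_Suc_iff)
  have [measurable]: "f n \<in> borel_measurable M" for n using f by (auto simp: in_Lp_def)
  define h where "h n x = norm (f (r (Suc n)) x - f (r n) x) powr p / c n powr p" for n x
  have "(\<integral>\<^sup>+x. (\<Sum>n. ennreal (h n x)) \<partial>M) = (\<Sum>n. \<integral>\<^sup>+x. ennreal (h n x) \<partial>M)"
    unfolding h_def by (intro nn_integral_suminf) auto
  also have "\<dots> \<le> (\<Sum>n. ennreal (c n))"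
  proof (intro suminf_le allI)
    fix n
    have "(\<integral>\<^sup>+x. ennreal (h n x) \<partial>M) = ennreal (LINT x|M. h n x)"
      unfolding h_def using in_LpD(2)[OF in_Lp_diff[OF f f p]] by (intro nn_integral_eq_integral) auto
    also have "(LINT x|M. h n x) = (LINT x|M. norm (f (r (Suc n)) x - f (r n) x) powr p) / c n powr p"
      unfolding h_def by simp
    also have "\<dots> \<le> c n"
      using r(1)[of n "r (Suc n)" "r n"] r(2)[of n] c[of n] by (simp add: field_simps)
    finally show "(\<integral>\<^sup>+x. ennreal (h n x) \<partial>M) \<le> ennreal (c n)" by (simp add: ennreal_leI)
  qed auto
  also have "\<dots> = ennreal (\<Sum>n. c n)"
    unfolding c_def by (intro suminf_ennreal2) (auto intro: summable_geometric)
  also have "\<dots> < \<infinity>" by simp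
  finally have fin: "(\<integral>\<^sup>+x. (\<Sum>n. ennreal (h n x)) \<partial>M) \<noteq> \<infinity>" by simp
  have "AE x in M. (\<Sum>n. ennreal (h n x)) \<noteq> \<infinity>"
    by (rule nn_integral_PInf_AE[OF _ fin]) (auto simp: h_def)
  then have conv: "AE x in M. convergent (\<lambda>n. f (r n) x)"
  proof eventually_elim
    case (elim x)
    then obtain B where B: "B \<ge> 0" "(\<Sum>n. ennreal (h n x)) = ennreal B"
      by (cases "\<Sum>n. ennreal (h n x)") auto
    have hB: "h n x \<le> B" for n
    proof -
      have "ennreal (h n x) \<le> (\<Sum>n. ennreal (h n x))"
        using sum_le_suminf[of "\<lambda>n. ennreal (h n x)" "{n}"] by simp
      then show ?thesis using B by simp
    qed
    have bound: "norm (f (r (Suc n)) x - f (r n) x) \<le> B powr (1/p) * c n" for n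
    proof -
      have "norm (f (r (Suc n)) x - f (r n) x) powr p \<le> B * c n powr p"
        using hB[of n] c[of n] unfolding h_def by (simp add: field_simps)
      then have "(norm (f (r (Suc n)) x - f (r n) x) powr p) powr (1/p) \<le> (B * c n powr p) powr (1/p)"
        using p by (intro powr_mono2) auto
      then show ?thesis using p c[of n] by (simp add: powr_mult powr_powr)
    qed
    have "summable (\<lambda>n. B powr (1/p) * c n)"
      unfolding c_def by (intro summable_mult summable_geometric) simp
    then have "summable (\<lambda>n. f (r (Suc n)) x - f (r n) x)"
      by (rule summable_comparison_test'[where N=0]) (rule bound)
    then have "convergent (\<lambda>n. (\<Sum>i<n. f (r (Suc i)) x - f (r i) x))"
      by (simp add: summable_iff_convergent)
    then have "convergent (\<lambda>n. f (r n) x - f (r 0) x)"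
      by (simp only: sum_lessThan_telescope[of "\<lambda>i. f (r i) x"])
    from convergent_add[OF this convergent_const[of "f (r 0) x"]] show ?case by simp
  qed
  define g where "g x = lim (\<lambda>n. f (r n) x)" for x
  have [measurable]: "g \<in> borel_measurable M"
    unfolding g_def by (intro borel_measurable_lim_metric) auto
  have lim: "AE x in M. (\<lambda>n. f (r n) x) \<longlonglongrightarrow> g x"
    using conv unfolding g_def by eventually_elim (simp add: convergent_LIMSEQ_iff)
  \<comment> \<open>With \<open>i\<close> fixed, Fatou's lemma is applied in the second index along
    the subsequence \<open>r\<close>.\<close>
  have key: "in_Lp M p (\<lambda>x. f i x - g x) \<and> (LINT x|M. norm (f i x - g x) powr p) \<le> e"
    if N: "\<forall>i\<ge>N. \<forall>j\<ge>N. (LINT x|M. norm (f i x - f j x) powr p) < e" "N \<le> i" for N i e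
  proof -
    have "AE x in M. (\<lambda>n. f i x - f (r (n + N)) x) \<longlonglongrightarrow> f i x - g x"
      using lim
    proof eventually_elim
      case (elim x)
      show ?case by (intro tendsto_diff tendsto_const LIMSEQ_ignore_initial_segment elim)
    qed
    moreover have "(LINT x|M. norm (f i x - f (r (n + N)) x) powr p) \<le> e" for n
    proof -
      have "N \<le> r (n + N)" using seq_suble[OF mono, of "n + N"] by simp
      with N show ?thesis by (simp add: less_imp_le)
    qed
    ultimately show ?thesis
      using Lp_fatou[of M p "\<lambda>n x. f i x - f (r (n + N)) x" "\<lambda>x. f i x - g x" e] in_Lp_diff[OF f f p] p by auto
  qed
  obtain N where N: "\<forall>i\<ge>N. \<forall>j\<ge>N. (LINT x|M. norm (f i x - f j x) powr p) < 1"
    using Cauchy[of 1] by auto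
  have "in_Lp M p (\<lambda>x. f N x - (f N x - g x))"
    by (rule in_Lp_diff[OF f conjunct1[OF key[OF N order_refl]] p])
  then have g: "in_Lp M p g" by simp
  have "(\<lambda>n. LINT x|M. norm (f n x - g x) powr p) \<longlonglongrightarrow> 0"
  proof (rule LIMSEQ_I)
    fix e :: real assume "0 < e"
    then obtain N where N: "\<forall>i\<ge>N. \<forall>j\<ge>N. (LINT x|M. norm (f i x - f j x) powr p) < e / 2"
      using Cauchy[of "e/2"] by auto
    have "norm ((LINT x|M. norm (f n x - g x) powr p) - 0) < e" if "N \<le> n" for n
    proof -
      have "(LINT x|M. norm (f n x - g x) powr p) \<ge> 0" by simp
      then show ?thesis using key[OF N that] \<open>0 < e\<close> by (auto simp del: integral_nonneg_AE)
    qed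
    then show "\<exists>N. \<forall>n\<ge>N. norm ((LINT x|M. norm (f n x - g x) powr p) - 0) < e" by blast
  qed
  with g show ?thesis by (rule that)
qed

section \<open>Smooth functions\<close>

text \<open>Lets any derivative at hand replace the one selected by
  \<open>frechet_derivative\<close>, so that the closure properties follow by induction from
  explicit formulas.\<close>

lemma Ck_SucI:
  assumes "\<And>x. (f has_derivative F x) (at x)" "\<And>b. b \<in> Basis \<Longrightarrow> Ck k (\<lambda>x. F x b)"
  shows "Ck (Suc k) f"
proof -
  have "frechet_derivative f (at x) = F x" for x
    using frechet_derivative_at[OF assms(1)[of x]] by simp
  with assms show ?thesis by (auto simp: differentiable_def)
qed

lemma Ck_SucD: "Ck (Suc k) f \<Longrightarrow> Ck k f"
proof (induction k arbitrary: f)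
  case 0
  then show ?case
    by (auto intro!: continuous_at_imp_continuous_on differentiable_imp_continuous_within)
next
  case (Suc k)
  from Suc.prems show ?case
    by (subst Ck.simps(2)) (auto simp del: Ck.simps(1) intro!: Suc.IH[simplified] Suc.IH)
qed

lemma Ck_const: "Ck k (\<lambda>x. c)"
  by (induction k arbitrary: c) (auto intro!: continuous_on_const)

lemma Ck_add: "Ck k f \<Longrightarrow> Ck k g \<Longrightarrow> Ck k (\<lambda>x. f x + g x)"
proof (induction k arbitrary: f g)
  case (Suc k)
  then have d: "(f has_derivative frechet_derivative f (at x)) (at x)"
      "(g has_derivative frechet_derivative g (at x)) (at x)" for x
    by (auto simp: frechet_derivative_works)
  show ?case
  proof (rule Ck_SucI)
    show "((\<lambda>x. f x + g x) has_derivative (\<lambda>v. frechet_derivative f (at x) v + frechet_derivative g (at x) v)) (at x)" for x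
      by (intro has_derivative_add d)
  qed (use Suc in auto)
qed (auto intro: continuous_on_add)

lemma Ck_mult: "Ck k f \<Longrightarrow> Ck k g \<Longrightarrow> Ck k (\<lambda>x. f x * g x)"
proof (induction k arbitrary: f g)
  case (Suc k)
  then have d: "(f has_derivative frechet_derivative f (at x)) (at x)"
      "(g has_derivative frechet_derivative g (at x)) (at x)" for x
    by (auto simp: frechet_derivative_works)
  have fg: "Ck k f" "Ck k g" using Suc.prems by (auto intro: Ck_SucD)
  show ?case
  proof (rule Ck_SucI)
    show "((\<lambda>x. f x * g x) has_derivative
        (\<lambda>v. f x * frechet_derivative g (at x) v + frechet_derivative f (at x) v * g x)) (at x)" for x
      by (intro has_derivative_mult d)
    show "Ck k (\<lambda>x. f x * frechet_derivative g (at x) b + frechet_derivative f (at x) b * g x)" if "b \<in> Basis" for b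
      using Suc.prems that fg by (intro Ck_add Suc.IH) auto
  qed
qed (auto intro: continuous_on_mult)

lemma Ck_prod: "finite I \<Longrightarrow> (\<And>i. i \<in> I \<Longrightarrow> Ck k (f i)) \<Longrightarrow> Ck k (\<lambda>x. \<Prod>i\<in>I. f i x)"
  by (induction I rule: finite_induct) (auto intro: Ck_const Ck_mult)

text \<open>The derivative of the root contains the reciprocal of the root, and the derivative of
  the reciprocal contains three copies of the reciprocal; hence one simultaneous induction for both.
  The positive \<open>e\<close> keeps the radicand away from 0.\<close>

lemma Ck_sqrt:
  assumes "\<And>k. Ck k f" "0 < e"
  shows "Ck k (\<lambda>x. sqrt ((f x)\<^sup>2 + e\<^sup>2)) \<and> Ck k (\<lambda>x. inverse (sqrt ((f x)\<^sup>2 + e\<^sup>2)))"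
proof (induction k)
  case 0
  have "continuous_on UNIV f" using assms(1)[of 0] by simp
  moreover have "0 < (f x)\<^sup>2 + e\<^sup>2" for x using assms(2) by (simp add: add_nonneg_pos)
  then have "(f x)\<^sup>2 + e\<^sup>2 \<noteq> 0" for x by (metis less_irrefl)
  ultimately show ?case by (auto intro!: continuous_intros)
next
  case (Suc k)
  define s where "s x = sqrt ((f x)\<^sup>2 + e\<^sup>2)" for x
  have pos: "0 < (f x)\<^sup>2 + e\<^sup>2" for x using assms(2) by (simp add: add_nonneg_pos)
  then have s: "0 < s x" for x by (simp add: s_def)
  have d: "(f has_derivative frechet_derivative f (at x)) (at x)" for x
    using assms(1)[of 1] by (auto simp: frechet_derivative_works)
  have df: "Ck k (\<lambda>x. frechet_derivative f (at x) b)" if "b \<in> Basis" for b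
    using assms(1)[of "Suc k"] that by simp
  have ds: "(s has_derivative (\<lambda>v. f x * frechet_derivative f (at x) v * inverse (s x))) (at x)" for x
    unfolding s_def using pos[of x]
    by (auto intro!: derivative_eq_intros d simp: field_simps)
  have di: "((\<lambda>x. inverse (s x)) has_derivative
      (\<lambda>v. -1 * (f x * frechet_derivative f (at x) v * inverse (s x) * inverse (s x) * inverse (s x)))) (at x)" for x
    using s[of x] by (auto intro!: derivative_eq_intros ds simp: field_simps)
  have IH: "Ck k (\<lambda>x. inverse (s x))" using Suc by (simp add: s_def)
  have "Ck (Suc k) s"
    by (rule Ck_SucI[OF ds]) (intro Ck_mult df assms(1) IH)
  moreover have "Ck (Suc k) (\<lambda>x. inverse (s x))"
    by (rule Ck_SucI[OF di]) (intro Ck_mult Ck_const df assms(1) IH)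
  moreover have "s = (\<lambda>x. sqrt ((f x)\<^sup>2 + e\<^sup>2))" by (auto simp: s_def)
  ultimately show ?case by (simp del: Ck.simps)
qed

section \<open>Bump functions on boxes\<close>

definition smooth_step :: "nat \<Rightarrow> real \<Rightarrow> real" where
  "smooth_step m t = (if 0 < t then inverse t ^ m * exp (- inverse t) else 0)"

lemma power_le_fact_exp:
  fixes x :: real
  assumes "0 \<le> x"
  shows "x ^ n \<le> fact n * exp x"
proof -
  have "(\<Sum>i\<in>{n}. x ^ i /\<^sub>R fact i) \<le> (\<Sum>i. x ^ i /\<^sub>R fact i)"
    using assms by (intro sum_le_suminf summable_exp_generic) auto
  then have "x ^ n / fact n \<le> exp x" by (simp add: exp_def field_simps)
  then show ?thesis by (simp add: field_simps)
qed

text \<open>A single term of the exponential series, the one of order \<open>m + 2\<close>,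
  dominates \<open>inverse t ^ m\<close> and leaves two spare powers of t.\<close>

lemma smooth_step_bound: "\<bar>smooth_step m t\<bar> \<le> fact (m + 2) * t\<^sup>2"
proof (cases "0 < t")
  case True
  have "inverse t ^ (m + 2) \<le> fact (m + 2) * exp (inverse t)"
    using True by (intro power_le_fact_exp) auto
  then have "inverse t ^ (m + 2) * (t\<^sup>2 * exp (- inverse t)) \<le> (fact (m + 2) * exp (inverse t)) * (t\<^sup>2 * exp (- inverse t))"
    by (intro mult_right_mono) auto
  also have "\<dots> = fact (m + 2) * t\<^sup>2 * (exp (inverse t) * exp (- inverse t))" by (simp only: mult_ac)
  also have "exp (inverse t) * exp (- inverse t) = 1" by (simp add: exp_minus_inverse)
  also have "inverse t ^ (m + 2) * (t\<^sup>2 * exp (- inverse t)) = inverse t ^ m * exp (- inverse t)"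
    using True by (simp add: field_simps power2_eq_square power_add)
  finally show ?thesis using True by (simp add: smooth_step_def abs_mult)
qed (simp add: smooth_step_def)

text \<open>Differentiating t^-m exp(-1/t) raises m by 1 or 2, so the family over all m is closed
  under differentiation; this is the purpose of the factor t^-m. At 0 the quadratic bound forces the
  difference quotient to 0.\<close>

lemma smooth_step_deriv:
  "(smooth_step m has_real_derivative (smooth_step (m + 2) t - real m * smooth_step (m + 1) t)) (at t)"
proof -
  consider "t > 0" | "t < 0" | "t = 0" by linarith
  then show ?thesis
  proof cases
    case 1
    have "((\<lambda>t. inverse t ^ m * exp (- inverse t)) has_real_derivative
        (smooth_step (m + 2) t - real m * smooth_step (m + 1) t)) (at t)"
    proof (cases m)
      case 0
      then show ?thesis using 1
        by (auto intro!: derivative_eq_intros simp: smooth_step_def power2_eq_square)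
    next
      case (Suc k)
      have i: "(inverse has_real_derivative - (inverse t ^ 2)) (at t)"
        using 1 by (auto intro!: derivative_eq_intros simp: power2_eq_square)
      have e: "((\<lambda>t. exp (- inverse t)) has_real_derivative exp (- inverse t) * inverse t ^ 2) (at t)"
        using 1 by (auto intro!: derivative_eq_intros simp: power2_eq_square)
      show ?thesis
        by (rule DERIV_cong[OF DERIV_mult[OF DERIV_power_Suc[OF i, of k] e, folded Suc]])
           (use 1 Suc in \<open>simp add: smooth_step_def power2_eq_square algebra_simps\<close>)
    qed
    then show ?thesis
      by (rule has_field_derivative_transform_within_open[where S="{0<..}"]) (use 1 in \<open>auto simp: smooth_step_def\<close>)
  next
    case 2
    have "((\<lambda>t. 0) has_real_derivative (smooth_step (m + 2) t - real m * smooth_step (m + 1) t)) (at t)"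
      using 2 by (simp add: smooth_step_def)
    then show ?thesis
      by (rule has_field_derivative_transform_within_open[where S="{..<0}"]) (use 2 in \<open>auto simp: smooth_step_def\<close>)
  next
    case 3
    have "(\<lambda>h. (smooth_step m (0 + h) - smooth_step m 0) / h) \<midarrow>0\<rightarrow> 0"
    proof (rule Lim_null_comparison)
      show "\<forall>\<^sub>F h in at 0. norm ((smooth_step m (0 + h) - smooth_step m 0) / h) \<le> fact (m + 2) * \<bar>h\<bar>"
      proof (intro always_eventually allI)
        fix h :: real
        have "smooth_step m 0 = 0" by (simp add: smooth_step_def)
        moreover have "\<bar>smooth_step m h\<bar> / \<bar>h\<bar> \<le> fact (m + 2) * \<bar>h\<bar>"
          using smooth_step_bound[of m h]
          by (cases "h = 0") (auto simp: divide_le_eq power2_eq_square abs_mult_self_eq mult.assoc)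
        ultimately show "norm ((smooth_step m (0 + h) - smooth_step m 0) / h) \<le> fact (m + 2) * \<bar>h\<bar>"
          by simp
      qed
      show "((\<lambda>h. fact (m + 2) * \<bar>h\<bar>) \<longlongrightarrow> 0) (at (0::real))"
        by (auto intro!: tendsto_eq_intros)
    qed
    then show ?thesis using 3 by (simp add: DERIV_def smooth_step_def)
  qed
qed

lemma Ck_smooth_step_affine:
  fixes b :: "'a::euclidean_space"
  shows "Ck k (\<lambda>x. smooth_step m (x \<bullet> b + c))"
proof (induction k arbitrary: m)
  case 0
  have "continuous_on UNIV (smooth_step m)"
    using smooth_step_deriv by (intro DERIV_continuous_on) (auto intro: has_field_derivative_at_within)
  then show ?case
    unfolding Ck.simps by (rule continuous_on_compose2) (auto intro!: continuous_intros)
next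
  case (Suc k)
  show ?case
  proof (rule Ck_SucI)
    fix x :: 'a
    have "((\<lambda>x. x \<bullet> b + c) has_derivative (\<lambda>v. v \<bullet> b)) (at x)"
      by (auto intro!: derivative_eq_intros)
    from has_derivative_compose[OF this smooth_step_deriv[of m "x \<bullet> b + c", unfolded has_field_derivative_def]]
    show "((\<lambda>x. smooth_step m (x \<bullet> b + c)) has_derivative
        (\<lambda>v. (smooth_step (m + 2) (x \<bullet> b + c) + (- real m) * smooth_step (m + 1) (x \<bullet> b + c)) * (v \<bullet> b))) (at x)"
      by simp
  qed (intro Ck_mult Ck_add Ck_const Suc)
qed

text \<open>The set where it is positive is the same for all n; the scaling by \<open>Suc n\<close>,
  which is never 0, drives the values inside the box to 1.\<close>

definition box_bump :: "'a::euclidean_space \<Rightarrow> 'a \<Rightarrow> nat \<Rightarrow> 'a \<Rightarrow> real" where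
  "box_bump a c n x = (\<Prod>b\<in>Basis. smooth_step 0 (real (Suc n) * (x \<bullet> b - a \<bullet> b)) * smooth_step 0 (real (Suc n) * (c \<bullet> b - x \<bullet> b)))"

lemma Ck_box_bump: "Ck k (box_bump a c n)"
proof -
  have *: "real (Suc n) * (x \<bullet> b - a \<bullet> b) = x \<bullet> (real (Suc n) *\<^sub>R b) + (- real (Suc n) * (a \<bullet> b))"
    "real (Suc n) * (c \<bullet> b - x \<bullet> b) = x \<bullet> (- real (Suc n) *\<^sub>R b) + (real (Suc n) * (c \<bullet> b))" for x b :: 'a
    by (simp_all add: algebra_simps)
  show ?thesis unfolding box_bump_def * by (intro Ck_prod Ck_mult Ck_smooth_step_affine finite_Basis)
qed

lemma smooth_step_0_bounds: "0 \<le> smooth_step 0 t" "smooth_step 0 t \<le> 1" "smooth_step 0 t \<noteq> 0 \<longleftrightarrow> 0 < t"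
  by (auto simp: smooth_step_def)

lemma box_bump_bounds: "0 \<le> box_bump a c n x" "box_bump a c n x \<le> 1"
  unfolding box_bump_def
  by (auto intro!: prod_nonneg prod_le_1 mult_nonneg_nonneg mult_le_one simp: smooth_step_0_bounds)

lemma box_bump_neq_0: "box_bump a c n x \<noteq> 0 \<longleftrightarrow> x \<in> box a c"
proof -
  have "box_bump a c n x \<noteq> 0 \<longleftrightarrow> (\<forall>b\<in>Basis. 0 < real (Suc n) * (x \<bullet> b - a \<bullet> b) \<and> 0 < real (Suc n) * (c \<bullet> b - x \<bullet> b))"
    unfolding box_bump_def using smooth_step_0_bounds(3) by (simp add: prod_zero_iff)
  also have "\<dots> \<longleftrightarrow> x \<in> box a c"
    by (simp add: mem_box zero_less_mult_iff)
  finally show ?thesis .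
qed

lemma box_bump_tendsto: "(\<lambda>n. box_bump a c n x) \<longlonglongrightarrow> indicator (box a c) x"
proof (cases "x \<in> box a c")
  case True
  have s: "(\<lambda>n. smooth_step 0 (real (Suc n) * t)) \<longlonglongrightarrow> 1" if "0 < t" for t
  proof -
    have "(\<lambda>n. exp (- (inverse (real (Suc n)) * inverse t))) \<longlonglongrightarrow> exp (- (0 * inverse t))"
      by (intro tendsto_intros LIMSEQ_inverse_real_of_nat)
    then show ?thesis using that by (simp add: smooth_step_def)
  qed
  have "(\<lambda>n. box_bump a c n x) \<longlonglongrightarrow> (\<Prod>b\<in>(Basis::'a set). 1 * 1)"
    unfolding box_bump_def using True by (intro tendsto_prod tendsto_mult s) (auto simp: mem_box)
  then show ?thesis using True by simp
next
  case False
  then have "box_bump a c n x = 0" for n using box_bump_neq_0[of a c n x] by simp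
  then show ?thesis using False by simp
qed

lemma box_bump_test_function:
  assumes "cbox a c \<subseteq> \<Omega>"
  shows "box_bump a c n \<in> test_functions \<Omega>"
proof -
  have "closure {x. box_bump a c n x \<noteq> 0} \<subseteq> cbox a c"
    using box_subset_cbox by (intro closure_minimal) (auto simp: box_bump_neq_0 closed_cbox)
  then show ?thesis
    using assms Ck_box_bump
    by (auto simp: test_functions_def compact_closure intro: bounded_subset[OF bounded_cbox closure_subset[THEN subset_trans]])
qed

section \<open>Test functions\<close>

lemma nn_integral_lborel_translate:
  fixes f :: "'a::euclidean_space \<Rightarrow> ennreal"
  assumes "f \<in> borel_measurable borel"
  shows "(\<integral>\<^sup>+x. f (h + x) \<partial>lborel) = (\<integral>\<^sup>+x. f x \<partial>lborel)"
proof -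
  have [measurable]: "f \<in> borel_measurable borel" by fact
  have "(\<integral>\<^sup>+x. f x \<partial>lborel) = (\<integral>\<^sup>+x. f x \<partial>distr lborel borel ((+) h))"
    by (simp only: lborel_distr_plus)
  also have "\<dots> = (\<integral>\<^sup>+x. f (h + x) \<partial>lborel)" by (subst nn_integral_distr) auto
  finally show ?thesis ..
qed

lemma integral_lborel_translate:
  fixes f :: "'a::euclidean_space \<Rightarrow> 'b::euclidean_space"
  assumes "f \<in> borel_measurable borel"
  shows "(LINT x|lborel. f (h + x)) = (LINT x|lborel. f x)"
proof -
  have [measurable]: "f \<in> borel_measurable borel" by fact
  have "(LINT x|lborel. f x) = (LINT x|distr lborel borel ((+) h). f x)"
    by (simp only: lborel_distr_plus)
  also have "\<dots> = (LINT x|lborel. f (h + x))" by (subst integral_distr) auto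
  finally show ?thesis ..
qed

lemma integrable_lborel_translate:
  fixes f :: "'a::euclidean_space \<Rightarrow> 'b::euclidean_space"
  assumes "integrable lborel f"
  shows "integrable lborel (\<lambda>x. f (h + x))"
proof -
  have "integrable (distr lborel borel ((+) h)) f" using assms by (simp only: lborel_distr_plus)
  then show ?thesis by (rule integrable_distr[rotated]) simp
qed

lemma in_Lp_translate:
  fixes f :: "'a::euclidean_space \<Rightarrow> 'b::euclidean_space"
  assumes "in_Lp lborel p f"
  shows "in_Lp lborel p (\<lambda>x. f (h + x))"
proof -
  have [measurable]: "f \<in> borel_measurable borel" using assms by (simp add: in_Lp_def)
  have "(\<lambda>x. f (h + x)) \<in> borel_measurable lborel" by measurable
  then show ?thesis
    using assms integrable_lborel_translate[of "\<lambda>x. norm (f x) powr p" h] by (simp add: in_Lp_def)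
qed

lemma compact_support_bounded:
  fixes f :: "'a::euclidean_space \<Rightarrow> 'b::euclidean_space"
  assumes "continuous_on UNIV f" "compact K" "\<And>x. x \<notin> K \<Longrightarrow> f x = 0"
  obtains B where "0 \<le> B" "\<And>x. norm (f x) \<le> B"
proof -
  have "bounded (f ` K)"
    using assms by (intro compact_imp_bounded compact_continuous_image) (auto intro: continuous_on_subset)
  then obtain B where "\<And>x. x \<in> K \<Longrightarrow> norm (f x) \<le> B" by (auto simp: bounded_iff)
  then show ?thesis
    using assms(3) by (intro that[of "max 0 B"]) (force simp: le_max_iff_disj)+
qed

lemma compact_support_in_Lp:
  fixes f :: "'a::euclidean_space \<Rightarrow> 'b::euclidean_space"
  assumes "continuous_on UNIV f" "compact K" "\<And>x. x \<notin> K \<Longrightarrow> f x = 0" "0 \<le> p"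
  shows "in_Lp lborel p f"
proof -
  obtain B where B: "0 \<le> B" "\<And>x. norm (f x) \<le> B"
    using compact_support_bounded[OF assms(1-3)] by metis
  show ?thesis
  proof (rule in_Lp_bound)
    show "f \<in> borel_measurable lborel" using assms(1) by (simp add: borel_measurable_continuous_onI)
    show "integrable lborel (\<lambda>x. indicator K x * B powr p)"
      using emeasure_bounded_finite[OF compact_imp_bounded[OF assms(2)]] assms(2)
      by (intro integrable_mult_left integrable_real_indicator) (auto simp: borel_compact)
    have "norm (f x) powr p \<le> indicator K x * B powr p" for x
      using powr_mono2[OF assms(4) norm_ge_zero B(2)[of x]] assms(3)[of x] by (cases "x \<in> K") auto
    then show "AE x in lborel. norm (f x) powr p \<le> indicator K x * B powr p" by simp
  qed
qed

lemma compact_support_integrable: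
  fixes f :: "'a::euclidean_space \<Rightarrow> 'b::euclidean_space"
  assumes "continuous_on UNIV f" "compact K" "\<And>x. x \<notin> K \<Longrightarrow> f x = 0"
  shows "integrable lborel f"
proof (rule Bochner_Integration.integrable_bound)
  show "integrable lborel (\<lambda>x. norm (f x) powr 1)"
    using compact_support_in_Lp[OF assms, of 1] by (auto simp: in_Lp_def)
  show "f \<in> borel_measurable lborel" using assms(1) by (simp add: borel_measurable_continuous_onI)
qed auto

section \<open>Gradients of test functions\<close>

definition grad :: "('a::euclidean_space \<Rightarrow> real) \<Rightarrow> 'a \<Rightarrow> 'a" where
  "grad f x = (\<Sum>b\<in>Basis. frechet_derivative f (at x) b *\<^sub>R b)"

lemma grad_inner:
  assumes "f differentiable (at x)"
  shows "frechet_derivative f (at x) v = grad f x \<bullet> v"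
proof -
  have l: "linear (frechet_derivative f (at x))"
    using assms by (rule linear_frechet_derivative)
  have "frechet_derivative f (at x) v = frechet_derivative f (at x) (\<Sum>b\<in>Basis. (v \<bullet> b) *\<^sub>R b)"
    by (simp add: euclidean_representation)
  also have "\<dots> = (\<Sum>b\<in>Basis. (v \<bullet> b) * frechet_derivative f (at x) b)"
    using l by (simp add: linear_sum linear_scale)
  also have "\<dots> = grad f x \<bullet> v"
    unfolding grad_def inner_sum_left by (intro sum.cong) (auto simp: inner_commute)
  finally show ?thesis .
qed

lemma grad_eqI:
  assumes "(f has_derivative (\<lambda>v. g \<bullet> v)) (at x)"
  shows "grad f x = g"
proof -
  have "frechet_derivative f (at x) b = g \<bullet> b" for b
    using frechet_derivative_at[OF assms] by (metis (full_types))
  then show ?thesis by (simp add: grad_def euclidean_representation)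
qed

lemma test_function_has_derivative:
  assumes "\<phi> \<in> test_functions \<Omega>"
  shows "(\<phi> has_derivative (\<lambda>v. grad \<phi> x \<bullet> v)) (at x)"
proof -
  have "Ck 1 \<phi>" using assms by (simp add: test_functions_def)
  then have d: "\<phi> differentiable (at x)" by simp
  then have "(\<phi> has_derivative frechet_derivative \<phi> (at x)) (at x)"
    by (simp add: frechet_derivative_works)
  moreover have "frechet_derivative \<phi> (at x) = (\<lambda>v. grad \<phi> x \<bullet> v)"
    using grad_inner[OF d] by auto
  ultimately show ?thesis by simp
qed

lemma test_function_frechet:
  assumes "\<phi> \<in> test_functions \<Omega>"
  shows "frechet_derivative \<phi> (at x) v = grad \<phi> x \<bullet> v"
  by (rule grad_inner[OF differentiableI[OF test_function_has_derivative[OF assms]]])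

lemma test_function_continuous:
  assumes "\<phi> \<in> test_functions \<Omega>"
  shows "continuous_on UNIV \<phi>"
proof -
  have "Ck 0 \<phi>" using assms unfolding test_functions_def by blast
  then show ?thesis by simp
qed

lemma test_function_grad_continuous:
  assumes "\<phi> \<in> test_functions \<Omega>"
  shows "continuous_on UNIV (grad \<phi>)"
proof -
  have "Ck (Suc 0) \<phi>" using assms unfolding test_functions_def by blast
  then show ?thesis unfolding grad_def by (auto intro!: continuous_intros)
qed

lemma test_function_support:
  assumes "\<phi> \<in> test_functions \<Omega>"
  obtains K where "compact K" "K \<subseteq> \<Omega>" "\<And>x. x \<notin> K \<Longrightarrow> \<phi> x = 0" "\<And>x. x \<notin> K \<Longrightarrow> grad \<phi> x = 0"
proof
  let ?K = "closure {x. \<phi> x \<noteq> 0}"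
  show "compact ?K" "?K \<subseteq> \<Omega>" using assms by (auto simp: test_functions_def)
  show z: "\<phi> x = 0" if "x \<notin> ?K" for x
    using that closure_subset[of "{x. \<phi> x \<noteq> 0}"] by auto
  show "grad \<phi> x = 0" if "x \<notin> ?K" for x
  proof (rule grad_eqI)
    have "((\<lambda>x. 0::real) has_derivative (\<lambda>v. 0 \<bullet> v)) (at x)" by simp
    moreover have "open (- ?K)" "x \<in> - ?K" using that by auto
    moreover have "0 = \<phi> x" if "x \<in> - ?K" for x using z[of x] that by simp
    ultimately show "(\<phi> has_derivative (\<lambda>v. 0 \<bullet> v)) (at x)"
      by (rule has_derivative_transform_within_open)
  qed
qed

lemma test_function_zero_outside: "\<phi> \<in> test_functions \<Omega> \<Longrightarrow> x \<notin> \<Omega> \<Longrightarrow> \<phi> x = 0"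
  by (metis test_function_support subsetD)

lemma test_function_grad_zero_outside: "\<phi> \<in> test_functions \<Omega> \<Longrightarrow> x \<notin> \<Omega> \<Longrightarrow> grad \<phi> x = 0"
  by (metis test_function_support subsetD)

lemma test_function_in_Lp: "\<phi> \<in> test_functions \<Omega> \<Longrightarrow> 0 \<le> p \<Longrightarrow> in_Lp lborel p \<phi>"
  by (metis test_function_support compact_support_in_Lp test_function_continuous)

lemma test_function_grad_in_Lp: "\<phi> \<in> test_functions \<Omega> \<Longrightarrow> 0 \<le> p \<Longrightarrow> in_Lp lborel p (grad \<phi>)"
  by (metis test_function_support compact_support_in_Lp test_function_grad_continuous)

lemma test_functionI:
  assumes "\<And>k. Ck k \<phi>" "compact K" "K \<subseteq> \<Omega>" "\<And>x. x \<notin> K \<Longrightarrow> \<phi> x = 0"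
  shows "\<phi> \<in> test_functions \<Omega>"
proof -
  have "closure {x. \<phi> x \<noteq> 0} \<subseteq> K"
    using assms by (intro closure_minimal) (auto intro: compact_imp_closed)
  moreover from this have "compact (closure {x. \<phi> x \<noteq> 0})"
    using assms(2) by (meson bounded_subset closed_closure closure_subset compact_eq_bounded_closed)
  ultimately show ?thesis using assms by (auto simp: test_functions_def)
qed

lemma test_function_Ck: "\<phi> \<in> test_functions \<Omega> \<Longrightarrow> Ck k \<phi>"
  by (simp add: test_functions_def)

lemma test_function_add:
  assumes "\<phi> \<in> test_functions \<Omega>" "\<psi> \<in> test_functions \<Omega>"
  shows "(\<lambda>x. \<phi> x + \<psi> x) \<in> test_functions \<Omega>"
proof -
  obtain K1 K2 where "compact K1" "K1 \<subseteq> \<Omega>" "\<And>x. x \<notin> K1 \<Longrightarrow> \<phi> x = 0"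
     "compact K2" "K2 \<subseteq> \<Omega>" "\<And>x. x \<notin> K2 \<Longrightarrow> \<psi> x = 0"
    using assms by (metis test_function_support)
  then show ?thesis using assms
    by (intro test_functionI[where K="K1 \<union> K2"] Ck_add) (auto intro: test_function_Ck)
qed

lemma test_function_cmult:
  assumes "\<phi> \<in> test_functions \<Omega>"
  shows "(\<lambda>x. c * \<phi> x) \<in> test_functions \<Omega>"
proof -
  obtain K where "compact K" "K \<subseteq> \<Omega>" "\<And>x. x \<notin> K \<Longrightarrow> \<phi> x = 0"
    using assms by (metis test_function_support)
  then show ?thesis using assms
    by (intro test_functionI[where K=K] Ck_mult Ck_const) (auto intro: test_function_Ck)
qed

section \<open>A smooth substitute for the absolute value\<close>

definition smooth_abs :: "real \<Rightarrow> real \<Rightarrow> real" where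
  "smooth_abs e t = sqrt (t\<^sup>2 + e\<^sup>2) - e"

lemma smooth_abs_bounds:
  assumes "0 < e"
  shows "0 \<le> smooth_abs e t" "\<bar>smooth_abs e t - \<bar>t\<bar>\<bar> \<le> e" "smooth_abs e 0 = 0"
proof -
  have "sqrt (e\<^sup>2) \<le> sqrt (t\<^sup>2 + e\<^sup>2)" by (intro real_sqrt_le_mono) simp
  then show "0 \<le> smooth_abs e t" using assms by (simp add: smooth_abs_def)
  have "sqrt (t\<^sup>2) \<le> sqrt (t\<^sup>2 + e\<^sup>2)" by (intro real_sqrt_le_mono) simp
  moreover have "sqrt (t\<^sup>2 + e\<^sup>2) \<le> \<bar>t\<bar> + e"
    using assms by (intro real_le_lsqrt) (auto simp: power2_sum)
  ultimately show "\<bar>smooth_abs e t - \<bar>t\<bar>\<bar> \<le> e" using assms by (simp add: smooth_abs_def abs_le_iff)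
  show "smooth_abs e 0 = 0" using assms by (simp add: smooth_abs_def)
qed

text \<open>Up to an additive constant the function is the modulus of the complex number
  \<open>t + i e\<close>, so the reverse triangle inequality gives the Lipschitz constant 1.\<close>

lemma smooth_abs_lipschitz:
  assumes "0 < e"
  shows "\<bar>smooth_abs e s - smooth_abs e t\<bar> \<le> \<bar>s - t\<bar>"
proof -
  have "smooth_abs e x = norm (complex_of_real x + \<i> * complex_of_real e) - e" for x
    by (simp add: smooth_abs_def cmod_def)
  then have "\<bar>smooth_abs e s - smooth_abs e t\<bar> \<le> norm (complex_of_real s + \<i> * complex_of_real e - (complex_of_real t + \<i> * complex_of_real e))"
    using norm_triangle_ineq3[of "complex_of_real s + \<i> * complex_of_real e" "complex_of_real t + \<i> * complex_of_real e"] by simp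
  also have "\<dots> = \<bar>s - t\<bar>" by (simp flip: of_real_diff)
  finally show ?thesis .
qed

text \<open>The composition fixes the value 0, so the support does not grow, and the gradient is
  multiplied by \<open>\<phi> x / sqrt ((\<phi> x)\<^sup>2 + e\<^sup>2)\<close>, whose modulus is at
  most 1.\<close>

lemma test_function_smooth_abs:
  assumes "\<phi> \<in> test_functions \<Omega>" "0 < e"
  shows "(\<lambda>x. smooth_abs e (\<phi> x)) \<in> test_functions \<Omega>"
    and "norm (grad (\<lambda>x. smooth_abs e (\<phi> x)) x) \<le> norm (grad \<phi> x)"
proof -
  obtain K where K: "compact K" "K \<subseteq> \<Omega>" "\<And>x. x \<notin> K \<Longrightarrow> \<phi> x = 0"
    using assms by (metis test_function_support)
  show "(\<lambda>x. smooth_abs e (\<phi> x)) \<in> test_functions \<Omega>"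
  proof (rule test_functionI[OF _ K(1,2)])
    show "Ck k (\<lambda>x. smooth_abs e (\<phi> x))" for k
      using Ck_add[OF conjunct1[OF Ck_sqrt[OF test_function_Ck[OF assms(1)] assms(2)]] Ck_const[of k "-e"]]
      by (simp add: smooth_abs_def)
    show "smooth_abs e (\<phi> x) = 0" if "x \<notin> K" for x
      using smooth_abs_bounds(3)[OF assms(2)] K(3)[OF that] by simp
  qed
  define c where "c = \<phi> x / sqrt ((\<phi> x)\<^sup>2 + e\<^sup>2)"
  have pos: "0 < (\<phi> x)\<^sup>2 + e\<^sup>2" using assms(2) by (simp add: add_nonneg_pos)
  have "grad (\<lambda>x. smooth_abs e (\<phi> x)) x = c *\<^sub>R grad \<phi> x"
  proof (rule grad_eqI)
    show "((\<lambda>x. smooth_abs e (\<phi> x)) has_derivative (\<lambda>v. (c *\<^sub>R grad \<phi> x) \<bullet> v)) (at x)"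
      unfolding smooth_abs_def c_def using pos
      by (auto intro!: derivative_eq_intros test_function_has_derivative[OF assms(1)] simp: field_simps)
  qed
  moreover have "\<bar>c\<bar> \<le> 1"
  proof -
    have "\<bar>\<phi> x\<bar> \<le> sqrt ((\<phi> x)\<^sup>2 + e\<^sup>2)" by (intro real_le_rsqrt) simp
    then show ?thesis using pos by (simp add: c_def divide_le_eq)
  qed
  ultimately show "norm (grad (\<lambda>x. smooth_abs e (\<phi> x)) x) \<le> norm (grad \<phi> x)"
    by (simp add: mult_left_le_one_le)
qed

text \<open>A majorant independent of k for dominated convergence: the mean value theorem bounds the
  quotient, and shifts by \<open>h /\<^sub>R 2 ^ k\<close> are no longer than \<open>h\<close>, so
  the support stays in the ball enlarged by \<open>norm h\<close>.\<close>

lemma diff_quotient_bound: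
  fixes f :: "'a::euclidean_space \<Rightarrow> real"
  assumes d: "\<And>x. (f has_derivative (\<lambda>v. g x \<bullet> v)) (at x)"
    and g: "\<And>x. norm (g x) \<le> B" and K: "K \<subseteq> cball 0 R" "\<And>x. x \<notin> K \<Longrightarrow> f x = 0"
  shows "\<bar>2 ^ k * (f (h /\<^sub>R 2 ^ k + x) - f x)\<bar> \<le> indicator (cball 0 (R + norm h)) x * (B * norm h)"
proof (cases "x \<in> cball 0 (R + norm h)")
  case True
  have "norm (f (h /\<^sub>R 2 ^ k + x) - f x) \<le> B * norm (h /\<^sub>R 2 ^ k + x - x)"
  proof (rule differentiable_bound[where S=UNIV])
    show "onorm (\<lambda>v. g x \<bullet> v) \<le> B" for x
    proof (rule onorm_le)
      fix v have "norm (g x \<bullet> v) \<le> norm (g x) * norm v" by (simp add: Cauchy_Schwarz_ineq2)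
      also have "\<dots> \<le> B * norm v" by (intro mult_right_mono g) auto
      finally show "norm (g x \<bullet> v) \<le> B * norm v" .
    qed
  qed (use d in auto)
  then have "2 ^ k * \<bar>f (h /\<^sub>R 2 ^ k + x) - f x\<bar> \<le> B * norm h" by (simp add: field_simps)
  then show ?thesis using True by (simp add: abs_mult)
next
  case False
  have "norm (h /\<^sub>R 2 ^ k) \<le> norm h"
    using mult_left_mono[OF one_le_power[of "2::real" k] norm_ge_zero[of h]] by (simp add: divide_le_eq field_simps)
  moreover have "norm x \<le> norm (h /\<^sub>R 2 ^ k + x) + norm (h /\<^sub>R 2 ^ k)"
    using norm_triangle_ineq4[of "h /\<^sub>R 2 ^ k + x" "h /\<^sub>R 2 ^ k"] by simp
  ultimately have "h /\<^sub>R 2 ^ k + x \<notin> cball 0 R" "x \<notin> cball 0 R"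
    using False norm_ge_zero[of h] unfolding mem_cball_0 by linarith+
  then have "f (h /\<^sub>R 2 ^ k + x) = 0" "f x = 0" using K by blast+
  then show ?thesis using False by simp
qed

lemma diff_quotient_tendsto:
  fixes f :: "'a::euclidean_space \<Rightarrow> real"
  assumes "(f has_derivative (\<lambda>v. g \<bullet> v)) (at x)"
  shows "(\<lambda>k. 2 ^ k * (f (h /\<^sub>R 2 ^ k + x) - f x)) \<longlonglongrightarrow> g \<bullet> h"
proof -
  have l: "((\<lambda>t. t *\<^sub>R h + x) has_derivative (\<lambda>t. t *\<^sub>R h)) (at 0)"
    by (auto intro!: derivative_eq_intros)
  have "((\<lambda>t. f (t *\<^sub>R h + x)) has_derivative (\<lambda>t. g \<bullet> (t *\<^sub>R h))) (at 0)"
    by (rule has_derivative_compose[OF l]) (use assms in simp)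
  then have "((\<lambda>t. f (t *\<^sub>R h + x)) has_real_derivative (g \<bullet> h)) (at 0)"
    by (simp add: has_field_derivative_def mult_commute_abs)
  then have "(\<lambda>t. (f (t *\<^sub>R h + x) - f x) / t) \<midarrow>0\<rightarrow> g \<bullet> h"
    by (simp add: DERIV_def)
  moreover have "filterlim (\<lambda>k. (1/2::real) ^ k) (at 0) sequentially"
    by (intro filterlim_atI) (auto intro: LIMSEQ_power_zero)
  ultimately have "(\<lambda>k. (f ((1/2) ^ k *\<^sub>R h + x) - f x) / (1/2) ^ k) \<longlonglongrightarrow> g \<bullet> h"
    by (rule filterlim_compose)
  then show ?thesis by (simp add: power_one_over field_simps)
qed

text \<open>The integral of \<open>f (h + x)\<close> does not depend on \<open>h\<close>; no Fubini argument is needed.\<close>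

lemma integral_directional_derivative_eq_0:
  fixes f :: "'a::euclidean_space \<Rightarrow> real"
  assumes d: "\<And>x. (f has_derivative (\<lambda>v. g x \<bullet> v)) (at x)"
    and g: "continuous_on UNIV g"
    and K: "compact K" "\<And>x. x \<notin> K \<Longrightarrow> f x = 0" "\<And>x. x \<notin> K \<Longrightarrow> g x = 0"
  shows "(LINT x|lborel. g x \<bullet> h) = 0"
proof -
  have f: "continuous_on UNIV f"
    using d by (auto intro!: continuous_at_imp_continuous_on has_derivative_continuous)
  have [measurable]: "f \<in> borel_measurable borel" "g \<in> borel_measurable borel"
    using f g by (auto intro: borel_measurable_continuous_onI)
  obtain B where B: "\<And>x. norm (g x) \<le> B" using compact_support_bounded[OF g K(1,3)] by metis
  obtain R where R: "K \<subseteq> cball 0 R"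
    using bounded_subset_ballD[OF compact_imp_bounded[OF K(1)], of 0] ball_subset_cball[of 0] by (meson subset_trans)
  have if': "integrable lborel f" by (rule compact_support_integrable[OF f K(1,2)])
  have "(\<lambda>k. LINT x|lborel. 2 ^ k * (f (h /\<^sub>R 2 ^ k + x) - f x)) \<longlonglongrightarrow> (LINT x|lborel. g x \<bullet> h)"
  proof (rule integral_dominated_convergence)
    show "integrable lborel (\<lambda>x::'a. indicator (cball 0 (R + norm h)) x * (B * norm h))"
      using emeasure_bounded_finite[OF bounded_cball, of "0::'a" "R + norm h"]
      by (intro integrable_mult_left integrable_real_indicator) auto
  qed (use diff_quotient_tendsto[OF d] diff_quotient_bound[OF d B R K(2)] in auto)
  moreover have "(LINT x|lborel. 2 ^ k * (f (h /\<^sub>R 2 ^ k + x) - f x)) = 0" for k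
    using if' integrable_lborel_translate[OF if', of "h /\<^sub>R 2 ^ k"]
    by (simp add: integral_lborel_translate)
  ultimately show ?thesis by (simp add: LIMSEQ_const_iff)
qed

text \<open>Integration by parts: the product \<open>\<phi> x * \<psi> x\<close> has compact
  support, so its directional derivative integrates to 0.\<close>

lemma test_function_weak_gradient:
  assumes "\<phi> \<in> test_functions \<Omega>"
  shows "has_weak_gradient \<Omega> \<phi> (grad \<phi>)"
  unfolding has_weak_gradient_def
proof (intro conjI ballI)
  have *: "loc_integrable \<Omega> f" if "continuous_on UNIV f" for f :: "'a \<Rightarrow> 'b::euclidean_space"
    unfolding loc_integrable_def using that
    by (auto intro!: borel_integrable_compact simp: set_integrable_def intro: continuous_on_subset)
  show "loc_integrable \<Omega> \<phi>" "loc_integrable \<Omega> (grad \<phi>)"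
    using assms by (auto intro!: * test_function_continuous test_function_grad_continuous)
  fix \<psi> b assume \<psi>: "\<psi> \<in> test_functions \<Omega>" and b: "b \<in> (Basis :: 'a set)"
  obtain K where K: "compact K" "K \<subseteq> \<Omega>" "\<And>x. x \<notin> K \<Longrightarrow> \<phi> x = 0" "\<And>x. x \<notin> K \<Longrightarrow> grad \<phi> x = 0"
    using assms by (metis test_function_support)
  have c: "continuous_on UNIV \<phi>" "continuous_on UNIV \<psi>" "continuous_on UNIV (grad \<phi>)" "continuous_on UNIV (grad \<psi>)"
    using assms \<psi> by (auto intro!: test_function_continuous test_function_grad_continuous)
  have "(LINT x|lborel. (\<phi> x *\<^sub>R grad \<psi> x + \<psi> x *\<^sub>R grad \<phi> x) \<bullet> b) = 0"
  proof (rule integral_directional_derivative_eq_0[OF _ _ K(1)])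
    show "((\<lambda>x. \<phi> x * \<psi> x) has_derivative (\<lambda>v. (\<phi> x *\<^sub>R grad \<psi> x + \<psi> x *\<^sub>R grad \<phi> x) \<bullet> v)) (at x)" for x
      by (auto intro!: derivative_eq_intros assms[THEN test_function_has_derivative] \<psi>[THEN test_function_has_derivative]
          simp: inner_add_left)
  qed (use c K in \<open>auto intro!: continuous_intros\<close>)
  moreover have "integrable lborel (\<lambda>x. \<phi> x * (grad \<psi> x \<bullet> b))" "integrable lborel (\<lambda>x. \<psi> x * (grad \<phi> x \<bullet> b))"
    using c K by (auto intro!: compact_support_integrable[OF _ K(1)] continuous_intros)
  ultimately have "(LINT x|lborel. \<phi> x * (grad \<psi> x \<bullet> b)) = - (LINT x|lborel. (grad \<phi> x \<bullet> b) * \<psi> x)"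
    by (simp add: inner_add_left mult.commute)
  moreover have "(LINT x:\<Omega>|lborel. \<phi> x * frechet_derivative \<psi> (at x) b) = (LINT x|lborel. \<phi> x * (grad \<psi> x \<bullet> b))"
    unfolding set_lebesgue_integral_def test_function_frechet[OF \<psi>]
    by (intro Bochner_Integration.integral_cong) (auto simp: indicator_def test_function_zero_outside[OF assms])
  moreover have "(LINT x:\<Omega>|lborel. (grad \<phi> x \<bullet> b) * \<psi> x) = (LINT x|lborel. (grad \<phi> x \<bullet> b) * \<psi> x)"
    unfolding set_lebesgue_integral_def
    by (intro Bochner_Integration.integral_cong) (auto simp: indicator_def test_function_zero_outside[OF \<psi>])
  ultimately show "(LINT x:\<Omega>|lborel. \<phi> x * frechet_derivative \<psi> (at x) b) = - (LINT x:\<Omega>|lborel. (grad \<phi> x \<bullet> b) * \<psi> x)"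
    by simp
qed

text \<open>By convexity, replacing \<open>h\<close> by \<open>h / 2\<close> costs a factor \<open>2\<^sup>p\<close>; after infinitely many halvings the
  left-hand side has become the integral of a directional derivative.\<close>

lemma test_function_translation_estimate:
  fixes \<phi> :: "'a::euclidean_space \<Rightarrow> real"
  assumes \<phi>: "\<phi> \<in> test_functions \<Omega>" and p: "1 \<le> p"
  shows "(LINT x|lborel. \<bar>\<phi> (h + x) - \<phi> x\<bar> powr p) \<le> norm h powr p * (LINT x|lborel. norm (grad \<phi> x) powr p)"
proof -
  define D where "D h = (LINT x|lborel. norm (\<phi> (h + x) - \<phi> x) powr p)" for h
  have L: "in_Lp lborel p \<phi>" using test_function_in_Lp[OF \<phi>] p by simp
  have Ld: "in_Lp lborel p (\<lambda>x. \<phi> (h + x) - \<phi> x)" for h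
    by (intro in_Lp_diff in_Lp_translate L p)
  have [measurable]: "\<phi> \<in> borel_measurable borel" "grad \<phi> \<in> borel_measurable borel"
    using \<phi> by (auto intro!: borel_measurable_continuous_onI test_function_continuous test_function_grad_continuous)
  have half: "D h \<le> 2 powr p * D (h /\<^sub>R 2)" for h
  proof -
    have "D h = (LINT x|lborel. norm ((\<phi> (h /\<^sub>R 2 + (h /\<^sub>R 2 + x)) - \<phi> (h /\<^sub>R 2 + x)) + (\<phi> (h /\<^sub>R 2 + x) - \<phi> x)) powr p)"
      unfolding D_def by (simp flip: add.assoc scaleR_left.add)
    also have "\<dots> \<le> 2 powr (p - 1) * ((LINT x|lborel. norm (\<phi> (h /\<^sub>R 2 + (h /\<^sub>R 2 + x)) - \<phi> (h /\<^sub>R 2 + x)) powr p) + D (h /\<^sub>R 2))"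
      unfolding D_def using p in_Lp_translate[OF Ld[of "h /\<^sub>R 2"], of "h /\<^sub>R 2"]
      by (intro Lp_integral_add_le Ld) (auto simp: add_ac)
    also have "(LINT x|lborel. norm (\<phi> (h /\<^sub>R 2 + (h /\<^sub>R 2 + x)) - \<phi> (h /\<^sub>R 2 + x)) powr p) = D (h /\<^sub>R 2)"
      unfolding D_def by (rule integral_lborel_translate[of "\<lambda>x. norm (\<phi> (h /\<^sub>R 2 + x) - \<phi> x) powr p"]) measurable
    also have "2 powr (p - 1) * (D (h /\<^sub>R 2) + D (h /\<^sub>R 2)) = 2 powr p * D (h /\<^sub>R 2)"
      by (simp add: powr_diff)
    finally show ?thesis .
  qed
  have iter: "D h \<le> (2 ^ k) powr p * D (h /\<^sub>R 2 ^ k)" for k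
  proof (induction k)
    case (Suc k)
    note Suc
    also have "(2 ^ k) powr p * D (h /\<^sub>R 2 ^ k) \<le> (2 ^ k) powr p * (2 powr p * D (h /\<^sub>R 2 ^ k /\<^sub>R 2))"
      by (intro mult_left_mono half) auto
    also have "\<dots> = (2 ^ Suc k) powr p * D (h /\<^sub>R 2 ^ Suc k)"
      by (simp add: powr_mult mult_ac)
    finally show ?case .
  qed simp
  obtain K where K: "compact K" "K \<subseteq> \<Omega>" "\<And>x. x \<notin> K \<Longrightarrow> \<phi> x = 0" "\<And>x. x \<notin> K \<Longrightarrow> grad \<phi> x = 0"
    using \<phi> by (metis test_function_support)
  obtain B where B: "\<And>x. norm (grad \<phi> x) \<le> B"
    using compact_support_bounded[OF test_function_grad_continuous[OF \<phi>] K(1,4)] by metis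
  have "0 \<le> B" using B[of undefined] norm_ge_zero order_trans by blast
  obtain R where R: "K \<subseteq> cball 0 R"
    using bounded_subset_ballD[OF compact_imp_bounded[OF K(1)], of 0] ball_subset_cball[of 0] by (meson subset_trans)
  note d = test_function_has_derivative[OF \<phi>]
  have "(\<lambda>k. LINT x|lborel. \<bar>2 ^ k * (\<phi> (h /\<^sub>R 2 ^ k + x) - \<phi> x)\<bar> powr p) \<longlonglongrightarrow> (LINT x|lborel. \<bar>grad \<phi> x \<bullet> h\<bar> powr p)"
  proof (rule integral_dominated_convergence)
    show "integrable lborel (\<lambda>x::'a. indicator (cball 0 (R + norm h)) x * (B * norm h) powr p)"
      using emeasure_bounded_finite[OF bounded_cball, of "0::'a" "R + norm h"]
      by (intro integrable_mult_left integrable_real_indicator) auto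
    show "AE x in lborel. (\<lambda>k. \<bar>2 ^ k * (\<phi> (h /\<^sub>R 2 ^ k + x) - \<phi> x)\<bar> powr p) \<longlonglongrightarrow> \<bar>grad \<phi> x \<bullet> h\<bar> powr p"
      using p by (intro AE_I2 tendsto_powr' tendsto_rabs diff_quotient_tendsto d tendsto_const) auto
    show "AE x in lborel. norm (\<bar>2 ^ k * (\<phi> (h /\<^sub>R 2 ^ k + x) - \<phi> x)\<bar> powr p) \<le> indicator (cball 0 (R + norm h)) x * (B * norm h) powr p" for k
    proof (intro AE_I2)
      fix x
      have "\<bar>2 ^ k * (\<phi> (h /\<^sub>R 2 ^ k + x) - \<phi> x)\<bar> powr p \<le> (indicator (cball 0 (R + norm h)) x * (B * norm h)) powr p"
        using p by (intro powr_mono2 diff_quotient_bound[OF d B R K(3)]) auto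
      also have "\<dots> = indicator (cball 0 (R + norm h)) x * (B * norm h) powr p"
        by (simp add: indicator_def)
      finally show "norm (\<bar>2 ^ k * (\<phi> (h /\<^sub>R 2 ^ k + x) - \<phi> x)\<bar> powr p) \<le> indicator (cball 0 (R + norm h)) x * (B * norm h) powr p"
        by simp
    qed
  qed measurable
  moreover have "D h \<le> (LINT x|lborel. \<bar>2 ^ k * (\<phi> (h /\<^sub>R 2 ^ k + x) - \<phi> x)\<bar> powr p)" for k
    using iter[of k] by (simp add: D_def abs_mult powr_mult)
  ultimately have "D h \<le> (LINT x|lborel. \<bar>grad \<phi> x \<bullet> h\<bar> powr p)"
    by (intro LIMSEQ_le_const) auto
  also have "\<dots> \<le> (LINT x|lborel. norm h powr p * norm (grad \<phi> x) powr p)"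
  proof (rule integral_mono')
    show "integrable lborel (\<lambda>x. norm h powr p * norm (grad \<phi> x) powr p)"
      using in_LpD(2)[OF test_function_grad_in_Lp[OF \<phi>, of p]] p by simp
    show "\<bar>grad \<phi> x \<bullet> h\<bar> powr p \<le> norm h powr p * norm (grad \<phi> x) powr p" for x
      using p Cauchy_Schwarz_ineq2[of "grad \<phi> x" h]
      by (subst powr_mult[symmetric]) (auto intro!: powr_mono2 simp: mult.commute)
  qed simp
  finally show ?thesis by (simp add: D_def)
qed

section \<open>The Gagliardo seminorm\<close>

lemma ex_power_2_bracket:
  fixes x :: real
  assumes "1 \<le> x"
  obtains n :: nat where "2 ^ n \<le> x" "x < 2 ^ Suc n"
proof
  define n where "n = nat \<lfloor>log 2 x\<rfloor>"
  have n: "real n = of_int \<lfloor>log 2 x\<rfloor>" using assms by (simp add: n_def)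
  have "2 powr real n \<le> x" "x < 2 powr (real n + 1)"
    using assms n floor_log_eq_powr_iff[of x 2 "\<lfloor>log 2 x\<rfloor>"] by auto
  then show "2 ^ n \<le> x" "x < 2 ^ Suc n" by (simp_all add: powr_realpow powr_add mult.commute)
qed

text \<open>Takes the place of polar coordinates: a radial kernel is compared on dyadic shells with
  multiples of indicators of balls, and the integral becomes a series of constants times volumes.
  One suitable k for each h is enough, since the full series dominates each of its terms.\<close>

lemma nn_integral_le_suminf_balls:
  fixes F :: "'a::euclidean_space \<Rightarrow> real" and c :: "nat \<Rightarrow> real" and \<rho> :: "nat \<Rightarrow> real"
  assumes "\<And>h. \<exists>k. F h \<le> c k * indicator (ball 0 (\<rho> k)) h"
    and "\<And>k. 0 \<le> c k" "\<And>k. 0 \<le> \<rho> k" "summable (\<lambda>k. c k * \<rho> k ^ DIM('a))"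
  shows "(\<integral>\<^sup>+h. ennreal (F h) \<partial>(lborel :: 'a measure)) < \<infinity>"
proof -
  have [measurable]: "ball (0::'a) r \<in> sets borel" for r by simp
  have "(\<integral>\<^sup>+h. ennreal (F h) \<partial>(lborel :: 'a measure))
      \<le> (\<integral>\<^sup>+h. (\<Sum>k. ennreal (c k) * indicator (ball 0 (\<rho> k)) h) \<partial>(lborel :: 'a measure))"
  proof (intro nn_integral_mono)
    fix h :: 'a
    obtain k where "F h \<le> c k * indicator (ball 0 (\<rho> k)) h" using assms(1) by blast
    then have "ennreal (F h) \<le> ennreal (c k) * indicator (ball 0 (\<rho> k)) h"
      by (auto simp: indicator_def ennreal_leI ennreal_neg split: if_splits)
    also have "T k \<le> (\<Sum>k. T k)" for T :: "nat \<Rightarrow> ennreal"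
      using sum_le_suminf[of T "{k}"] by simp
    finally show "ennreal (F h) \<le> (\<Sum>k. ennreal (c k) * indicator (ball 0 (\<rho> k)) h)" .
  qed
  also have "\<dots> = (\<Sum>k. \<integral>\<^sup>+h. ennreal (c k) * indicator (ball 0 (\<rho> k)) h \<partial>(lborel :: 'a measure))"
    by (intro nn_integral_suminf) measurable
  also have "\<dots> = (\<Sum>k. ennreal (c k) * emeasure lborel (ball (0::'a) (\<rho> k)))"
    by (simp add: nn_integral_cmult_indicator)
  also have "\<dots> = (\<Sum>k. ennreal (unit_ball_vol (real DIM('a)) * (c k * \<rho> k ^ DIM('a))))"
    using assms(2,3) by (intro suminf_cong) (simp add: emeasure_ball ennreal_mult'[symmetric] mult_ac)
  also have "\<dots> = ennreal (\<Sum>k. unit_ball_vol (real DIM('a)) * (c k * \<rho> k ^ DIM('a)))"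
    using assms(2-4) by (intro suminf_ennreal2 summable_mult) (simp_all add: unit_ball_vol_nonneg)
  also have "\<dots> < \<infinity>" by simp
  finally show ?thesis .
qed

text \<open>The sign of \<open>d - DIM('a)\<close> is unknown, so on each dyadic shell the powers
  \<open>d\<close> and \<open>- DIM('a)\<close> are estimated separately, by the outer and the inner
  radius. The ball volume cancels the second factor, which leaves a geometric series of ratio
  (1/2)^d. The radius is doubled because the balls are open.\<close>

lemma nn_integral_kernel_near:
  assumes "0 < d"
  shows "(\<integral>\<^sup>+h. ennreal (indicator (cball 0 1) h * norm h powr (d - real DIM('a))) \<partial>(lborel :: 'a::euclidean_space measure)) < \<infinity>"
proof (rule nn_integral_le_suminf_balls)
  let ?N = "real DIM('a)"
  define \<rho> :: "nat \<Rightarrow> real" where "\<rho> k = 2 * (1/2) ^ k" for k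
  define c where "c k = ((1/2) ^ k) powr d * ((1/2) ^ Suc k) powr (- ?N)" for k :: nat
  show "0 \<le> c k" "0 \<le> \<rho> k" for k by (auto simp: c_def \<rho>_def)
  show "\<exists>k. indicator (cball 0 1) h * norm h powr (d - ?N) \<le> c k * indicator (ball 0 (\<rho> k)) h" for h :: 'a
  proof (cases "h = 0 \<or> h \<notin> cball 0 1")
    case False
    then obtain n where n: "2 ^ n \<le> 1 / norm h" "1 / norm h < 2 ^ Suc n"
      using ex_power_2_bracket[of "1 / norm h"] by (auto simp: field_simps)
    have h: "norm h \<le> (1/2) ^ n" "(1/2) ^ Suc n < norm h" "0 < norm h"
      using n False by (auto simp: field_simps power_one_over)
    have "norm h powr (d - ?N) = norm h powr d * norm h powr (- ?N)"
      by (simp add: powr_add[symmetric])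
    also have "\<dots> \<le> c n" unfolding c_def
      using h assms by (intro mult_mono powr_mono2 powr_mono2') auto
    moreover have "norm h < \<rho> n"
    proof -
      have "(0::real) < (1/2) ^ n" by simp
      then show ?thesis using h(1) unfolding \<rho>_def by linarith
    qed
    ultimately show ?thesis using False by (intro exI[of _ n]) auto
  qed (auto simp: c_def \<rho>_def)
  have "c k * \<rho> k ^ DIM('a) = 4 ^ DIM('a) * ((1/2) powr d) ^ k" for k
  proof -
    have "((1/2::real) ^ k) powr d = ((1/2) powr d) ^ k"
      by (simp add: powr_powr mult.commute flip: powr_realpow)
    moreover have "((1/2::real) ^ Suc k) powr (- ?N) = (2 ^ Suc k) ^ DIM('a)"
      by (simp add: powr_minus powr_realpow power_one_over field_simps)
    moreover have "((2::real) ^ Suc k) ^ DIM('a) * \<rho> k ^ DIM('a) = 4 ^ DIM('a)"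
    proof -
      have "(2::real) ^ Suc k * \<rho> k = 4" by (simp add: \<rho>_def power_one_over)
      then show ?thesis by (simp only: power_mult_distrib[symmetric])
    qed
    ultimately show ?thesis by (simp add: c_def)
  qed
  moreover have "(1/2::real) powr d < 1" using powr_less_mono2[of d "1/2" 1] assms by simp
  ultimately show "summable (\<lambda>k. c k * \<rho> k ^ DIM('a))"
    by (simp add: summable_mult summable_geometric)
qed

text \<open>The exponent is negative here, so the inner radius of the dyadic shell bounds the whole
  kernel, and the volumes again leave a geometric series of ratio (1/2)^d.\<close>

lemma nn_integral_kernel_far:
  assumes "0 < d"
  shows "(\<integral>\<^sup>+h. ennreal (indicator (- cball 0 1) h * norm h powr (- d - real DIM('a))) \<partial>(lborel :: 'a::euclidean_space measure)) < \<infinity>"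
proof (rule nn_integral_le_suminf_balls)
  let ?N = "real DIM('a)"
  define \<rho> :: "nat \<Rightarrow> real" where "\<rho> k = 2 ^ Suc k" for k
  define c where "c k = (2 ^ k) powr (- d - ?N)" for k :: nat
  show "0 \<le> c k" "0 \<le> \<rho> k" for k by (auto simp: c_def \<rho>_def)
  show "\<exists>k. indicator (- cball 0 1) h * norm h powr (- d - ?N) \<le> c k * indicator (ball 0 (\<rho> k)) h" for h :: 'a
  proof (cases "h \<in> cball 0 1")
    case False
    then obtain n where n: "2 ^ n \<le> norm h" "norm h < 2 ^ Suc n"
      using ex_power_2_bracket[of "norm h"] by auto
    have "norm h powr (- d - ?N) \<le> c n"
      unfolding c_def using n assms by (intro powr_mono2') auto
    then show ?thesis using False n by (intro exI[of _ n]) (auto simp: \<rho>_def)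
  qed (auto simp: c_def \<rho>_def)
  have "c k * \<rho> k ^ DIM('a) = 2 ^ DIM('a) * ((1/2) powr d) ^ k" for k
  proof -
    have "c k = ((1/2) powr d) ^ k * inverse ((2 ^ k) ^ DIM('a))"
      unfolding c_def by (simp add: powr_diff powr_minus powr_realpow powr_divide power_one_over
          powr_powr mult.commute field_simps flip: powr_realpow)
    then show ?thesis by (simp add: \<rho>_def power_mult_distrib)
  qed
  moreover have "(1/2::real) powr d < 1" using powr_less_mono2[of d "1/2" 1] assms by simp
  ultimately show "summable (\<lambda>k. c k * \<rho> k ^ DIM('a))"
    by (simp add: summable_mult summable_geometric)
qed

text \<open>The Gagliardo seminorm is the \<open>L\<^sup>p\<close> norm of this quotient over the product space.\<close>

definition gag_quot :: "real \<Rightarrow> real \<Rightarrow> ('a::euclidean_space \<Rightarrow> real) \<Rightarrow> 'a \<times> 'a \<Rightarrow> real" where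
  "gag_quot p t w = (\<lambda>(x, y). (w x - w y) / norm (x - y) powr ((real DIM('a) + t * p) / p))"

lemma gag_quot_powr:
  fixes w :: "'a::euclidean_space \<Rightarrow> real"
  assumes "0 < p"
  shows "\<bar>gag_quot p t w (x, y)\<bar> powr p = \<bar>w x - w y\<bar> powr p / norm (x - y) powr (real DIM('a) + t * p)"
  using assms by (simp add: gag_quot_def powr_divide powr_powr)

lemma gagliardo_pow_eq:
  assumes "0 < p"
  shows "gagliardo_pow p t w = (LINT z|(lborel \<Otimes>\<^sub>M lborel). norm (gag_quot p t w z) powr p)"
  unfolding gagliardo_pow_def by (intro Bochner_Integration.integral_cong refl) (auto simp: gag_quot_powr[OF assms])

lemma gag_quot_measurable [measurable]:
  assumes [measurable]: "w \<in> borel_measurable borel"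
  shows "gag_quot p t w \<in> borel_measurable (lborel \<Otimes>\<^sub>M lborel)"
  unfolding gag_quot_def by measurable

lemma gag_quot_add: "gag_quot p t (\<lambda>x. u x + v x) z = gag_quot p t u z + gag_quot p t v z"
  by (cases z) (simp add: gag_quot_def flip: add_divide_distrib)

lemma gag_quot_diff: "gag_quot p t (\<lambda>x. u x - v x) z = gag_quot p t u z - gag_quot p t v z"
  by (cases z) (simp add: gag_quot_def flip: diff_divide_distrib)

lemma gag_quot_cmult: "gag_quot p t (\<lambda>x. c * u x) z = c *\<^sub>R gag_quot p t u z"
  by (cases z) (simp add: gag_quot_def flip: right_diff_distrib)

text \<open>Substituting y = x + h and exchanging the integrations expresses the seminorm through
  the L^p norms of translation differences, to which the translation estimate applies.\<close>

lemma nn_integral_gag_quot: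
  fixes w :: "'a::euclidean_space \<Rightarrow> real"
  assumes [measurable]: "w \<in> borel_measurable borel" and "0 < p"
  shows "(\<integral>\<^sup>+z. ennreal (norm (gag_quot p t w z) powr p) \<partial>(lborel \<Otimes>\<^sub>M lborel))
    = (\<integral>\<^sup>+h. ennreal (norm h powr (- (real DIM('a) + t * p))) * (\<integral>\<^sup>+x. ennreal (\<bar>w (h + x) - w x\<bar> powr p) \<partial>lborel) \<partial>lborel)"
proof -
  let ?a = "real DIM('a) + t * p"
  have "(\<integral>\<^sup>+z. ennreal (norm (gag_quot p t w z) powr p) \<partial>(lborel \<Otimes>\<^sub>M lborel))
     = (\<integral>\<^sup>+x. \<integral>\<^sup>+y. ennreal (norm (gag_quot p t w (x, y)) powr p) \<partial>lborel \<partial>lborel)"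
    by (rule lborel.nn_integral_fst[symmetric]) measurable
  also have "\<dots> = (\<integral>\<^sup>+x. \<integral>\<^sup>+h. ennreal (norm (gag_quot p t w (x, x + h)) powr p) \<partial>lborel \<partial>lborel)"
    by (intro nn_integral_cong nn_integral_lborel_translate[symmetric]) measurable
  also have "\<dots> = (\<integral>\<^sup>+h. \<integral>\<^sup>+x. ennreal (norm (gag_quot p t w (x, x + h)) powr p) \<partial>lborel \<partial>lborel)"
    by (rule lborel_pair.Fubini'[symmetric]) measurable
  also have "\<dots> = (\<integral>\<^sup>+h. \<integral>\<^sup>+x. ennreal (norm h powr (- ?a)) * ennreal (\<bar>w (h + x) - w x\<bar> powr p) \<partial>lborel \<partial>lborel)"
    unfolding powr_minus using assms(2)
    by (intro nn_integral_cong)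
       (simp add: gag_quot_powr divide_inverse mult.commute abs_minus_commute add.commute flip: ennreal_mult')
  also have "\<dots> = (\<integral>\<^sup>+h. ennreal (norm h powr (- ?a)) * (\<integral>\<^sup>+x. ennreal (\<bar>w (h + x) - w x\<bar> powr p) \<partial>lborel) \<partial>lborel)"
    by (intro nn_integral_cong nn_integral_cmult) measurable
  finally show ?thesis .
qed

text \<open>For |h| \<le> 1 the translation estimate gains the factor |h|^p, which makes the kernel
  integrable at the origin because t < 1; for larger h the crude bound by the L^p norm suffices
  because t > 0. The constant does not depend on the domain.\<close>

lemma gagliardo_test_function_bound:
  fixes p t :: real
  assumes p: "1 \<le> p" and t: "0 < t" "t < 1"
  obtains C where "0 \<le> C" "\<And>\<Omega> (\<phi> :: 'a::euclidean_space \<Rightarrow> real). \<phi> \<in> test_functions \<Omega> \<Longrightarrow>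
      in_Lp (lborel \<Otimes>\<^sub>M lborel) p (gag_quot p t \<phi>) \<and>
      gagliardo_pow p t \<phi> \<le> C * ((LINT x|lborel. \<bar>\<phi> x\<bar> powr p) + (LINT x|lborel. norm (grad \<phi> x) powr p))"
proof -
  let ?N = "real DIM('a)"
  let ?a = "?N + t * p"
  define n where "n h = indicator (cball 0 1) h * norm h powr (p * (1 - t) - ?N)" for h :: 'a
  define f where "f h = indicator (- cball 0 1) h * norm h powr (- (t * p) - ?N)" for h :: 'a
  have "(\<integral>\<^sup>+h. ennreal (n h) \<partial>lborel) < \<infinity>" unfolding n_def
    using p t by (intro nn_integral_kernel_near) simp
  then obtain I1 where I1: "0 \<le> I1" "(\<integral>\<^sup>+h. ennreal (n h) \<partial>lborel) = ennreal I1"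
    by (cases "\<integral>\<^sup>+h. ennreal (n h) \<partial>lborel") auto
  have "(\<integral>\<^sup>+h. ennreal (f h) \<partial>lborel) < \<infinity>" unfolding f_def
    using p t by (intro nn_integral_kernel_far) simp
  then obtain I2 where I2: "0 \<le> I2" "(\<integral>\<^sup>+h. ennreal (f h) \<partial>lborel) = ennreal I2"
    by (cases "\<integral>\<^sup>+h. ennreal (f h) \<partial>lborel") auto
  have [measurable]: "cball (0::'a) 1 \<in> sets borel" by simp
  have [measurable]: "n \<in> borel_measurable borel" "f \<in> borel_measurable borel"
    unfolding n_def f_def by measurable
  show ?thesis
  proof (rule that)
    show "0 \<le> I1 + I2 * 2 powr p" using I1 I2 by simp
    fix \<Omega> and \<phi> :: "'a \<Rightarrow> real" assume \<phi>: "\<phi> \<in> test_functions \<Omega>"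
    define A where "A = (LINT x|lborel. \<bar>\<phi> x\<bar> powr p)"
    define B where "B = (LINT x|lborel. norm (grad \<phi> x) powr p)"
    have AB: "0 \<le> A" "0 \<le> B" by (auto simp: A_def B_def)
    have L: "in_Lp lborel p \<phi>" using test_function_in_Lp[OF \<phi>] p by simp
    have [measurable]: "\<phi> \<in> borel_measurable borel" using L by (simp add: in_Lp_def)
    have Ld: "in_Lp lborel p (\<lambda>x. \<phi> (h + x) - \<phi> x)" for h
      by (intro in_Lp_diff in_Lp_translate L p)
    have "(LINT x|lborel. \<bar>\<phi> (h + x) - \<phi> x\<bar> powr p) \<le> 2 powr p * A" for h
    proof -
      have "(LINT x|lborel. norm (\<phi> (h + x) - \<phi> x) powr p)
         \<le> 2 powr (p - 1) * ((LINT x|lborel. norm (\<phi> (h + x)) powr p) + (LINT x|lborel. norm (\<phi> x) powr p))"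
        by (intro Lp_integral_diff_le in_Lp_translate L p)
      also have "(LINT x|lborel. norm (\<phi> (h + x)) powr p) = (LINT x|lborel. norm (\<phi> x) powr p)"
        by (rule integral_lborel_translate[of "\<lambda>x. norm (\<phi> x) powr p"]) measurable
      finally show ?thesis by (simp add: A_def powr_diff)
    qed
    then have D: "(LINT x|lborel. \<bar>\<phi> (h + x) - \<phi> x\<bar> powr p) \<le> (if h \<in> cball 0 1 then norm h powr p * B else 2 powr p * A)" for h
      using test_function_translation_estimate[OF \<phi> p, of h] by (auto simp: B_def)
    have "(\<integral>\<^sup>+z. ennreal (norm (gag_quot p t \<phi> z) powr p) \<partial>(lborel \<Otimes>\<^sub>M lborel))
      = (\<integral>\<^sup>+h. ennreal (norm h powr (- ?a)) * (\<integral>\<^sup>+x. ennreal (\<bar>\<phi> (h + x) - \<phi> x\<bar> powr p) \<partial>lborel) \<partial>lborel)"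
      using p by (intro nn_integral_gag_quot) auto
    also have "\<dots> \<le> (\<integral>\<^sup>+h. ennreal B * ennreal (n h) + ennreal (2 powr p * A) * ennreal (f h) \<partial>lborel)"
    proof (intro nn_integral_mono)
      fix h :: 'a
      have "(\<integral>\<^sup>+x. ennreal (\<bar>\<phi> (h + x) - \<phi> x\<bar> powr p) \<partial>lborel) = ennreal (LINT x|lborel. \<bar>\<phi> (h + x) - \<phi> x\<bar> powr p)"
        using in_LpD(2)[OF Ld[of h]] by (intro nn_integral_eq_integral) auto
      also have "\<dots> \<le> ennreal (if h \<in> cball 0 1 then norm h powr p * B else 2 powr p * A)"
        by (intro ennreal_leI D)
      finally have "ennreal (norm h powr (- ?a)) * (\<integral>\<^sup>+x. ennreal (\<bar>\<phi> (h + x) - \<phi> x\<bar> powr p) \<partial>lborel)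
         \<le> ennreal (norm h powr (- ?a)) * ennreal (if h \<in> cball 0 1 then norm h powr p * B else 2 powr p * A)"
        by (intro mult_left_mono) auto
      also have "\<dots> = ennreal (norm h powr (- ?a) * (if h \<in> cball 0 1 then norm h powr p * B else 2 powr p * A))"
        using AB by (intro ennreal_mult'[symmetric]) auto
      also have "norm h powr (- ?a) * (if h \<in> cball 0 1 then norm h powr p * B else 2 powr p * A) = B * n h + (2 powr p * A) * f h"
      proof -
        have e: "- ?a + p = p * (1 - t) - ?N" "- ?a = - (t * p) - ?N" by (auto simp: algebra_simps)
        have "norm h powr (- ?a) * norm h powr p = norm h powr (p * (1 - t) - ?N)"
          by (simp only: powr_add[symmetric] e(1))
        then show ?thesis unfolding n_def f_def e(2)[symmetric] by (simp add: mult_ac)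
      qed
      also have "ennreal (B * n h + (2 powr p * A) * f h) = ennreal B * ennreal (n h) + ennreal (2 powr p * A) * ennreal (f h)"
        using AB by (simp add: ennreal_plus ennreal_mult' n_def f_def)
      finally show "ennreal (norm h powr (- ?a)) * (\<integral>\<^sup>+x. ennreal (\<bar>\<phi> (h + x) - \<phi> x\<bar> powr p) \<partial>lborel)
          \<le> ennreal B * ennreal (n h) + ennreal (2 powr p * A) * ennreal (f h)" .
    qed
    also have "\<dots> = ennreal B * ennreal I1 + ennreal (2 powr p * A) * ennreal I2"
      by (simp add: nn_integral_add nn_integral_cmult I1 I2)
    also have "\<dots> = ennreal (B * I1 + 2 powr p * A * I2)"
      using AB I1 I2 by (simp add: ennreal_plus ennreal_mult')
    finally have *: "(\<integral>\<^sup>+z. ennreal (norm (gag_quot p t \<phi> z) powr p) \<partial>(lborel \<Otimes>\<^sub>M lborel)) \<le> ennreal (B * I1 + 2 powr p * A * I2)" .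
    then have g: "in_Lp (lborel \<Otimes>\<^sub>M lborel) p (gag_quot p t \<phi>)"
      by (auto simp: in_Lp_def integrable_iff_bounded intro: order.strict_trans1)
    have "0 \<le> B * I1 + 2 powr p * A * I2" using AB I1 I2 by simp
    then have "gagliardo_pow p t \<phi> \<le> B * I1 + 2 powr p * A * I2"
      using * p unfolding nn_integral_eq_integral[OF in_LpD(2)[OF g] AE_I2[OF powr_ge_zero]]
      by (simp add: gagliardo_pow_eq)
    also have "\<dots> \<le> (I1 + I2 * 2 powr p) * (A + B)"
      using AB I1 I2 by (simp add: algebra_simps add_increasing add_increasing2)
    finally show "in_Lp (lborel \<Otimes>\<^sub>M lborel) p (gag_quot p t \<phi>) \<and>
        gagliardo_pow p t \<phi> \<le> (I1 + I2 * 2 powr p) * ((LINT x|lborel. \<bar>\<phi> x\<bar> powr p) + (LINT x|lborel. norm (grad \<phi> x) powr p))"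
      using g by (simp add: A_def B_def)
  qed
qed

text \<open>A null set pulled back along either projection is null in the product; this carries
  almost everywhere convergence over to difference quotients.\<close>

lemma AE_pair_lborel:
  assumes "AE x in lborel. P x"
  shows "AE z in lborel \<Otimes>\<^sub>M lborel. P (fst z) \<and> P (snd z)"
proof -
  from assms obtain S where S: "{x \<in> space lborel. \<not> P x} \<subseteq> S" "emeasure lborel S = 0" "S \<in> sets lborel"
    by (rule AE_E)
  have [measurable]: "S \<in> sets borel" using S(3) by simp
  have AS: "AE x in lborel. x \<notin> S" using S(2,3) by (intro AE_not_in) (simp add: null_sets_def)
  have "AE z in lborel \<Otimes>\<^sub>M lborel. fst z \<notin> S \<and> snd z \<notin> S"
  proof (rule lborel_pair.AE_pair_measure)
    show "AE x in lborel. AE y in lborel. fst (x, y) \<notin> S \<and> snd (x, y) \<notin> S"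
      using AS by eventually_elim (use AS in auto)
  qed measurable
  then show ?thesis by eventually_elim (use S(1) in auto)
qed

text \<open>Lower semicontinuity of the seminorm. The diagonal is no exception to the pointwise
  convergence, since all quotients are 0 there.\<close>

lemma gagliardo_fatou:
  fixes w :: "'a::euclidean_space \<Rightarrow> real"
  assumes "\<And>n. in_Lp (lborel \<Otimes>\<^sub>M lborel) p (gag_quot p t (f n))" "w \<in> borel_measurable borel" "0 < p"
    and "AE x in lborel. (\<lambda>n. f n x) \<longlonglongrightarrow> w x"
    and "\<And>n. gagliardo_pow p t (f n) \<le> C"
  shows "in_Lp (lborel \<Otimes>\<^sub>M lborel) p (gag_quot p t w)" "gagliardo_pow p t w \<le> C"
proof -
  have "AE z in lborel \<Otimes>\<^sub>M lborel. (\<lambda>n. gag_quot p t (f n) z) \<longlonglongrightarrow> gag_quot p t w z"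
    using AE_pair_lborel[OF assms(4)]
  proof eventually_elim
    case (elim z)
    then show ?case by (cases z) (auto simp: gag_quot_def divide_inverse intro!: tendsto_intros)
  qed
  from Lp_fatou[OF assms(1) gag_quot_measurable[OF assms(2)] assms(3) this, of C]
  show "in_Lp (lborel \<Otimes>\<^sub>M lborel) p (gag_quot p t w)" "gagliardo_pow p t w \<le> C"
    using assms(3,5) by (auto simp: gagliardo_pow_eq)
qed

text \<open>It suffices to let \<open>y\<close> range over a ball disjoint from \<open>\<Omega>\<close>, where \<open>w\<close> vanishes.\<close>

lemma gagliardo_poincare:
  fixes \<Omega> :: "'a::euclidean_space set"
  assumes "bounded \<Omega>" "1 \<le> p" "0 < t"
  obtains C where "0 \<le> C" "\<And>w. in_Lp lborel p w \<Longrightarrow> (\<And>x. x \<notin> \<Omega> \<Longrightarrow> w x = 0) \<Longrightarrow>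
     in_Lp (lborel \<Otimes>\<^sub>M lborel) p (gag_quot p t w) \<Longrightarrow>
     (LINT x|lborel. \<bar>w x\<bar> powr p) \<le> C * gagliardo_pow p t w"
proof -
  let ?a = "real DIM('a) + t * p"
  obtain R where R: "0 < R" "\<Omega> \<subseteq> ball 0 R" using bounded_subset_ballD[OF assms(1), of 0] by blast
  obtain b :: 'a where b: "b \<in> Basis" using nonempty_Basis by blast
  \<comment> \<open>Centre and radius keep \<open>Q\<close> away from \<open>ball 0 R\<close>, which
    contains \<Omega>, while points of \<open>Q\<close> and \<Omega> stay within distance
    \<open>2 * R + 2\<close> of each other.\<close>
  define Q where "Q = ball ((R + 1) *\<^sub>R b) 1"
  have Q: "R < norm y \<and> norm y < R + 2" if "y \<in> Q" for y
    using that b R norm_triangle_ineq2[of "(R + 1) *\<^sub>R b" y] norm_triangle_ineq2[of y "(R + 1) *\<^sub>R b"]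
    by (auto simp: Q_def dist_norm norm_minus_commute)
  define D where "D = (2 * R + 2) powr ?a"
  have a: "0 < ?a" using assms by (simp add: add_pos_pos)
  have D: "0 < D" using R by (simp add: D_def)
  define m where "m = measure lborel Q"
  have m: "0 < m" "emeasure lborel Q = ennreal m"
    unfolding m_def Q_def using emeasure_bounded_finite[OF bounded_ball, of "(R + 1) *\<^sub>R b" 1]
    by (auto simp: content_ball_gt_0_iff emeasure_eq_ennreal_measure)
  show ?thesis
  proof (rule that)
    show "0 \<le> D / m" using D m by simp
    fix w :: "'a \<Rightarrow> real" assume w: "in_Lp lborel p w" "\<And>x. x \<notin> \<Omega> \<Longrightarrow> w x = 0"
      "in_Lp (lborel \<Otimes>\<^sub>M lborel) p (gag_quot p t w)"
    have [measurable]: "w \<in> borel_measurable borel" "Q \<in> sets borel" using w by (auto simp: in_Lp_def Q_def)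
    have le: "ennreal (\<bar>w x\<bar> powr p / D) * indicator Q y \<le> ennreal (norm (gag_quot p t w (x, y)) powr p)" for x y
    proof (cases "y \<in> Q \<and> x \<in> \<Omega>")
      case True
      then have "y \<notin> \<Omega>" using Q[of y] R by force
      then have "w y = 0" by (rule w(2))
      have xy: "norm (x - y) \<le> 2 * R + 2"
        using norm_triangle_ineq4[of x y] Q[of y] R True by auto
      have "x \<noteq> y" using Q[of y] R True by auto
      have "norm (x - y) powr ?a \<le> D"
        unfolding D_def using xy a by (intro powr_mono2) auto
      then have "\<bar>w x\<bar> powr p / D \<le> \<bar>w x\<bar> powr p / norm (x - y) powr ?a"
        using D \<open>x \<noteq> y\<close> by (intro divide_left_mono) auto
      then show ?thesis using True assms \<open>w y = 0\<close> by (simp add: gag_quot_powr ennreal_leI)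
    qed (use w(2) in auto)
    have "ennreal ((LINT x|lborel. \<bar>w x\<bar> powr p) / D * m) = ennreal (LINT x|lborel. \<bar>w x\<bar> powr p / D) * ennreal m"
      using D m by (subst ennreal_mult') auto
    also have "ennreal (LINT x|lborel. \<bar>w x\<bar> powr p / D) = (\<integral>\<^sup>+x. ennreal (\<bar>w x\<bar> powr p / D) \<partial>lborel)"
      using w(1) D by (intro nn_integral_eq_integral[symmetric]) (auto simp: in_Lp_def)
    also have "\<dots> * ennreal m = (\<integral>\<^sup>+x. \<integral>\<^sup>+y. ennreal (\<bar>w x\<bar> powr p / D) * indicator Q y \<partial>lborel \<partial>lborel)"
      by (simp add: nn_integral_cmult_indicator nn_integral_multc m)
    also have "\<dots> \<le> (\<integral>\<^sup>+x. \<integral>\<^sup>+y. ennreal (norm (gag_quot p t w (x, y)) powr p) \<partial>lborel \<partial>lborel)"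
      by (intro nn_integral_mono le)
    also have "\<dots> = (\<integral>\<^sup>+z. ennreal (norm (gag_quot p t w z) powr p) \<partial>(lborel \<Otimes>\<^sub>M lborel))"
      by (rule lborel.nn_integral_fst) measurable
    also have "\<dots> = ennreal (gagliardo_pow p t w)"
      using w(3) assms by (subst nn_integral_eq_integral) (auto simp: in_Lp_def gagliardo_pow_eq)
    finally have "(LINT x|lborel. \<bar>w x\<bar> powr p) / D * m \<le> gagliardo_pow p t w"
      using assms by (subst (asm) ennreal_le_iff) (auto simp: gagliardo_pow_eq)
    then show "(LINT x|lborel. \<bar>w x\<bar> powr p) \<le> D / m * gagliardo_pow p t w"
      using D m by (simp add: field_simps)
  qed
qed

section \<open>Compactness\<close>

definition dyadic_cell :: "nat \<Rightarrow> 'a::euclidean_space \<Rightarrow> 'a set" where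
  "dyadic_cell j x = {y. \<forall>b\<in>Basis. \<lfloor>2 ^ j * (y \<bullet> b)\<rfloor> = \<lfloor>2 ^ j * (x \<bullet> b)\<rfloor>}"

lemma dyadic_cell_pair_measurable:
  "Measurable.pred (borel \<Otimes>\<^sub>M borel) (\<lambda>(x, y). y \<in> dyadic_cell j (x :: 'a::euclidean_space))"
proof -
  have "Measurable.pred (borel \<Otimes>\<^sub>M borel) (\<lambda>z::'a\<times>'a. \<lfloor>2 ^ j * (snd z \<bullet> b)\<rfloor> = \<lfloor>2 ^ j * (fst z \<bullet> b)\<rfloor>)" for b
    by measurable
  then show ?thesis
    unfolding dyadic_cell_def split_beta mem_Collect_eq by (intro pred_intros_finite) auto
qed

lemma dyadic_cell_sets: "dyadic_cell j (x :: 'a::euclidean_space) \<in> sets borel"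
proof -
  have "Measurable.pred borel (\<lambda>y::'a. \<lfloor>2 ^ j * (y \<bullet> b)\<rfloor> = \<lfloor>2 ^ j * (x \<bullet> b)\<rfloor>)" for b
    by measurable
  then have "Measurable.pred borel (\<lambda>y. \<forall>b\<in>Basis. \<lfloor>2 ^ j * (y \<bullet> b)\<rfloor> = \<lfloor>2 ^ j * (x \<bullet> b)\<rfloor>)"
    by (intro pred_intros_finite) auto
  then show ?thesis unfolding dyadic_cell_def by simp
qed

lemma dyadic_cell_diam:
  fixes x y :: "'a::euclidean_space"
  assumes "y \<in> dyadic_cell j x"
  shows "norm (x - y) \<le> real DIM('a) / 2 ^ j"
proof -
  have "\<bar>(x - y) \<bullet> b\<bar> \<le> 1 / 2 ^ j" if "b \<in> Basis" for b
  proof -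
    have "\<lfloor>2 ^ j * (y \<bullet> b)\<rfloor> = \<lfloor>2 ^ j * (x \<bullet> b)\<rfloor>" using assms that by (simp add: dyadic_cell_def)
    then have "\<bar>2 ^ j * (x \<bullet> b) - 2 ^ j * (y \<bullet> b)\<bar> \<le> 1" by linarith
    then have "2 ^ j * \<bar>(x - y) \<bullet> b\<bar> \<le> 1"
      by (simp add: inner_diff_left abs_mult flip: right_diff_distrib)
    then show ?thesis by (simp add: field_simps)
  qed
  then have "(\<Sum>b\<in>Basis. \<bar>(x - y) \<bullet> b\<bar>) \<le> (\<Sum>b\<in>(Basis::'a set). 1 / 2 ^ j)"
    by (intro sum_mono) auto
  then show ?thesis using norm_le_l1[of "x - y"] by simp
qed

text \<open>The half-open cube is squeezed between the open and the closed box with the same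
  corners, which have equal measure.\<close>

lemma emeasure_dyadic_cell:
  "emeasure lborel (dyadic_cell j (x :: 'a::euclidean_space)) = ennreal (1 / (2 ^ j) ^ DIM('a))"
proof -
  define l where "l = (\<Sum>b\<in>Basis. (of_int \<lfloor>2 ^ j * (x \<bullet> b)\<rfloor> / 2 ^ j) *\<^sub>R b)"
  define u where "u = (\<Sum>b\<in>Basis. ((of_int \<lfloor>2 ^ j * (x \<bullet> b)\<rfloor> + 1) / 2 ^ j) *\<^sub>R b)"
  have l: "l \<bullet> b = of_int \<lfloor>2 ^ j * (x \<bullet> b)\<rfloor> / 2 ^ j" if "b \<in> Basis" for b
    using that by (simp add: l_def)
  have u: "u \<bullet> b = (of_int \<lfloor>2 ^ j * (x \<bullet> b)\<rfloor> + 1) / 2 ^ j" if "b \<in> Basis" for b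
    using that by (simp add: u_def)
  have lu: "l \<bullet> b \<le> u \<bullet> b" "(u - l) \<bullet> b = 1 / 2 ^ j" if "b \<in> Basis" for b
    using that by (simp_all add: l u inner_diff_left divide_right_mono flip: diff_divide_distrib)
  have "(\<Prod>b\<in>(Basis::'a set). (u - l) \<bullet> b) = (\<Prod>b\<in>(Basis::'a set). 1 / 2 ^ j)"
    by (intro prod.cong) (auto simp: lu)
  then have v: "(\<Prod>b\<in>(Basis::'a set). (u - l) \<bullet> b) = 1 / (2 ^ j) ^ DIM('a)"
    by (simp add: power_one_over)
  have "box l u \<subseteq> dyadic_cell j x"
  proof
    fix y assume y: "y \<in> box l u"
    have "\<lfloor>2 ^ j * (y \<bullet> b)\<rfloor> = \<lfloor>2 ^ j * (x \<bullet> b)\<rfloor>" if "b \<in> Basis" for b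
      using y that by (intro floor_unique) (auto simp: mem_box l u field_simps dest!: bspec[of _ _ b])
    then show "y \<in> dyadic_cell j x" by (simp add: dyadic_cell_def)
  qed
  then have "emeasure lborel (box l u) \<le> emeasure lborel (dyadic_cell j x)"
    by (intro emeasure_mono) (auto simp: dyadic_cell_sets)
  moreover have "dyadic_cell j x \<subseteq> cbox l u"
  proof
    fix y assume "y \<in> dyadic_cell j x"
    then have "l \<bullet> b \<le> y \<bullet> b \<and> y \<bullet> b \<le> u \<bullet> b" if "b \<in> Basis" for b
      using that floor_correct[of "2 ^ j * (y \<bullet> b)"] by (auto simp: dyadic_cell_def l u field_simps)
    then show "y \<in> cbox l u" by (simp add: mem_box)
  qed
  then have "emeasure lborel (dyadic_cell j x) \<le> emeasure lborel (cbox l u)"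
    by (intro emeasure_mono) auto
  ultimately show ?thesis using lu(1) v by (simp add: emeasure_lborel_box emeasure_lborel_cbox)
qed

text \<open>Makes it possible to choose one subsequence for which the integrals converge over every
  cell of every scale.\<close>

lemma countable_dyadic_cells: "countable {A. \<exists>j x. A = dyadic_cell j (x :: 'a::euclidean_space)}"
proof (rule countable_subset)
  let ?F = "\<lambda>(j, m). {y. \<forall>b\<in>Basis. \<lfloor>2 ^ j * (y \<bullet> b)\<rfloor> = m b} :: 'a set"
  let ?I = "UNIV \<times> (Basis \<rightarrow>\<^sub>E (UNIV :: int set)) :: (nat \<times> ('a \<Rightarrow> int)) set"
  show "countable (?F ` ?I)"
    by (intro countable_image countable_SIGMA countable_PiE) auto
  show "{A. \<exists>j x. A = dyadic_cell j (x :: 'a)} \<subseteq> ?F ` ?I"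
  proof safe
    fix j and x :: 'a
    show "dyadic_cell j x \<in> ?F ` ?I"
      by (rule image_eqI[of _ _ "(j, restrict (\<lambda>b. \<lfloor>2 ^ j * (x \<bullet> b)\<rfloor>) Basis)"]) (auto simp: dyadic_cell_def)
  qed
qed

text \<open>Jensen's inequality, obtained by integrating the tangent inequality at the mean
  \<open>m\<close>, where the linear term integrates to 0. Integrability of \<open>f\<close> comes
  from |f| \<le> 1 + |f|^p on a set of finite measure.\<close>

lemma jensen_powr_set:
  fixes f :: "'a \<Rightarrow> real"
  assumes [measurable]: "A \<in> sets M" "f \<in> borel_measurable M"
    and V: "emeasure M A = ennreal V" "0 < V" and p: "1 \<le> p"
    and int: "integrable M (\<lambda>x. indicator A x * \<bar>f x\<bar> powr p)"
  shows "integrable M (\<lambda>x. indicator A x * f x)"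
    and "V * \<bar>(LINT x|M. indicator A x * f x) / V\<bar> powr p \<le> (LINT x|M. indicator A x * \<bar>f x\<bar> powr p)"
proof -
  have iA: "integrable M (indicator A :: 'a \<Rightarrow> real)" using V by (intro integrable_real_indicator) auto
  have mA: "(LINT x|M. indicator A x) = V" using V by (simp add: measure_def)
  have le: "\<bar>f x\<bar> \<le> 1 + \<bar>f x\<bar> powr p" for x
  proof (cases "\<bar>f x\<bar> \<le> 1")
    case False
    then have "\<bar>f x\<bar> powr 1 \<le> \<bar>f x\<bar> powr p" using p by (intro powr_mono) auto
    then show ?thesis by simp
  qed (simp add: add_increasing2)
  show i: "integrable M (\<lambda>x. indicator A x * f x)"
    by (rule Bochner_Integration.integrable_bound[OF Bochner_Integration.integrable_add[OF iA int]])
       (auto simp: indicator_def le intro: order.trans[OF le])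
  define m where "m = (LINT x|M. indicator A x * f x) / V"
  have "(LINT x|M. \<bar>m\<bar> powr p * indicator A x + p * \<bar>m\<bar> powr (p - 2) * m * (indicator A x * f x - m * indicator A x))
     \<le> (LINT x|M. indicator A x * \<bar>f x\<bar> powr p)"
  proof (rule integral_mono)
    show "integrable M (\<lambda>x. \<bar>m\<bar> powr p * indicator A x + p * \<bar>m\<bar> powr (p - 2) * m * (indicator A x * f x - m * indicator A x))"
      by (intro Bochner_Integration.integrable_add Bochner_Integration.integrable_diff integrable_mult_right i iA)
    fix x
    have "\<bar>m\<bar> powr p + p * \<bar>m\<bar> powr (p - 2) * (m * (f x - m)) \<le> \<bar>f x\<bar> powr p"
      using norm_powr_above_tangent[OF p, of m "f x"] by simp
    then show "\<bar>m\<bar> powr p * indicator A x + p * \<bar>m\<bar> powr (p - 2) * m * (indicator A x * f x - m * indicator A x)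
        \<le> indicator A x * \<bar>f x\<bar> powr p"
      by (cases "x \<in> A") (auto simp: mult.assoc)
  qed fact
  also have "(LINT x|M. \<bar>m\<bar> powr p * indicator A x + p * \<bar>m\<bar> powr (p - 2) * m * (indicator A x * f x - m * indicator A x))
     = \<bar>m\<bar> powr p * V + p * \<bar>m\<bar> powr (p - 2) * m * ((LINT x|M. indicator A x * f x) - m * V)"
    using i iA mA by simp
  also have "(LINT x|M. indicator A x * f x) - m * V = 0" using V by (simp add: m_def)
  finally show "V * \<bar>(LINT x|M. indicator A x * f x) / V\<bar> powr p \<le> (LINT x|M. indicator A x * \<bar>f x\<bar> powr p)"
    by (simp add: m_def mult.commute)
qed

text \<open>The factor is the reciprocal of the cell volume: this is the conditional expectation
  with respect to the cubes of side 2^-j.\<close>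

definition dyadic_avg :: "nat \<Rightarrow> ('a::euclidean_space \<Rightarrow> real) \<Rightarrow> 'a \<Rightarrow> real" where
  "dyadic_avg j z x = (2 ^ j) ^ DIM('a) * (LINT y|lborel. indicator (dyadic_cell j x) y * z y)"

lemma dyadic_avg_measurable:
  fixes z :: "'a::euclidean_space \<Rightarrow> real"
  assumes [measurable]: "z \<in> borel_measurable borel"
  shows "dyadic_avg j z \<in> borel_measurable borel"
proof -
  have "(\<lambda>(x, y). indicator (dyadic_cell j x) y * z y :: real)
      = (\<lambda>w. if (case w of (x, y) \<Rightarrow> y \<in> dyadic_cell j x) then z (snd w) else 0)"
    by (simp add: fun_eq_iff indicator_def)
  also have "\<dots> \<in> borel_measurable (borel \<Otimes>\<^sub>M borel)"
    using dyadic_cell_pair_measurable[of j] by (intro measurable_If) (simp_all add: split_beta pred_def)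
  finally have "(\<lambda>(x, y). indicator (dyadic_cell j x) y * z y :: real) \<in> borel_measurable (borel \<Otimes>\<^sub>M lborel)"
    by simp
  then have "(\<lambda>x. LINT y|lborel. indicator (dyadic_cell j x) y * z y :: real) \<in> borel_measurable borel"
    by (rule lborel.borel_measurable_lebesgue_integral)
  then show ?thesis unfolding dyadic_avg_def by measurable
qed

lemma integrable_cell_in_Lp:
  fixes z :: "'a::euclidean_space \<Rightarrow> real"
  assumes "in_Lp lborel p z" "1 \<le> p"
  shows "integrable lborel (\<lambda>y. indicator (dyadic_cell j x) y * \<bar>c - z y\<bar> powr p)"
    and "integrable lborel (\<lambda>y. indicator (dyadic_cell j x) y * z y)"
proof -
  have [measurable]: "z \<in> borel_measurable borel" "dyadic_cell j x \<in> sets borel"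
    using assms by (auto simp: in_Lp_def dyadic_cell_sets)
  have iA: "integrable lborel (indicator (dyadic_cell j x) :: 'a \<Rightarrow> real)"
    by (intro integrable_real_indicator) (auto simp: emeasure_dyadic_cell)
  show *: "integrable lborel (\<lambda>y. indicator (dyadic_cell j x) y * \<bar>c - z y\<bar> powr p)" for c
  proof (rule Bochner_Integration.integrable_bound)
    show "integrable lborel (\<lambda>y. 2 powr (p - 1) * (\<bar>c\<bar> powr p * indicator (dyadic_cell j x) y + \<bar>z y\<bar> powr p))"
      using iA assms(1) by (auto simp: in_Lp_def)
    show "AE y in lborel. norm (indicator (dyadic_cell j x) y * \<bar>c - z y\<bar> powr p)
       \<le> norm (2 powr (p - 1) * (\<bar>c\<bar> powr p * indicator (dyadic_cell j x) y + \<bar>z y\<bar> powr p))"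
      using norm_diff_powr_le[OF assms(2), of c] by (intro AE_I2) (auto simp: indicator_def)
  qed measurable
  show "integrable lborel (\<lambda>y. indicator (dyadic_cell j x) y * z y)"
    by (rule jensen_powr_set(1)[OF _ _ emeasure_dyadic_cell _ assms(2)]) (use *[of 0] in simp_all)
qed

lemma dyadic_avg_diff:
  assumes "in_Lp lborel p u" "in_Lp lborel p v" "1 \<le> p"
  shows "dyadic_avg j (\<lambda>x. u x - v x) x = dyadic_avg j u x - dyadic_avg j v x"
  using integrable_cell_in_Lp(2)[OF assms(1,3)] integrable_cell_in_Lp(2)[OF assms(2,3)]
  by (simp add: dyadic_avg_def right_diff_distrib)

text \<open>By Jensen's inequality the deviation from the cell average is at most the mean over the
  cell of |z x - z y|^p. Within a cell the distance is at most \<open>DIM('a) / 2 ^ j\<close>, so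
  the kernel can be inserted at the cost of \<open>D\<close>. Volume factor and \<open>D\<close>
  together are of order 2^(-j t p), which tends to 0.\<close>

lemma dyadic_avg_approx:
  fixes z :: "'a::euclidean_space \<Rightarrow> real" and j :: nat
  assumes z: "in_Lp lborel p z" and p: "1 \<le> p" and t: "0 < t"
    and g: "in_Lp (lborel \<Otimes>\<^sub>M lborel) p (gag_quot p t z)"
  defines "C \<equiv> (2 ^ j) ^ DIM('a) * (real DIM('a) / 2 ^ j) powr (real DIM('a) + t * p)"
  shows "in_Lp lborel p (\<lambda>x. z x - dyadic_avg j z x)"
    and "(LINT x|lborel. \<bar>z x - dyadic_avg j z x\<bar> powr p) \<le> C * gagliardo_pow p t z"
proof -
  let ?a = "real DIM('a) + t * p"
  define K :: real where "K = (2 ^ j) ^ DIM('a)"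
  define D where "D = (real DIM('a) / 2 ^ j) powr ?a"
  have K: "0 < K" and D: "0 \<le> D" and a: "0 < ?a" using p t by (auto simp: K_def D_def add_pos_pos)
  have [measurable]: "z \<in> borel_measurable borel" "dyadic_avg j z \<in> borel_measurable borel"
    "dyadic_cell j x \<in> sets borel" for x :: 'a
    using z by (auto simp: in_Lp_def dyadic_cell_sets dyadic_avg_measurable)
  have mz: "(\<lambda>x. z x - dyadic_avg j z x) \<in> borel_measurable lborel" by measurable
  have pt: "ennreal (\<bar>z x - dyadic_avg j z x\<bar> powr p)
      \<le> (\<integral>\<^sup>+y. ennreal (K * D) * ennreal (norm (gag_quot p t z (x, y)) powr p) \<partial>lborel)" for x
  proof -
    have iA: "integrable lborel (indicator (dyadic_cell j x) :: 'a \<Rightarrow> real)"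
      by (intro integrable_real_indicator) (auto simp: emeasure_dyadic_cell)
    have V: "measure lborel (dyadic_cell j x) = 1 / K"
      using K by (simp add: measure_def emeasure_dyadic_cell K_def)
    have "(LINT y|lborel. indicator (dyadic_cell j x) y * (z x - z y)) = z x / K - dyadic_avg j z x / K"
      using iA integrable_cell_in_Lp(2)[OF z p, of j x] V K by (simp add: right_diff_distrib dyadic_avg_def K_def)
    then have e: "(LINT y|lborel. indicator (dyadic_cell j x) y * (z x - z y)) / (1 / K) = z x - dyadic_avg j z x"
      using K by (simp add: diff_divide_distrib[symmetric])
    have "1 / K * \<bar>z x - dyadic_avg j z x\<bar> powr p \<le> (LINT y|lborel. indicator (dyadic_cell j x) y * \<bar>z x - z y\<bar> powr p)"
      unfolding e[symmetric] using K integrable_cell_in_Lp(1)[OF z p, of j x "z x"] p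
      by (intro jensen_powr_set(2)) (auto simp: emeasure_dyadic_cell K_def)
    then have "\<bar>z x - dyadic_avg j z x\<bar> powr p \<le> (LINT y|lborel. K * (indicator (dyadic_cell j x) y * \<bar>z x - z y\<bar> powr p))"
      using K by (simp add: field_simps)
    then have "ennreal (\<bar>z x - dyadic_avg j z x\<bar> powr p) \<le> ennreal (LINT y|lborel. K * (indicator (dyadic_cell j x) y * \<bar>z x - z y\<bar> powr p))"
      by (rule ennreal_leI)
    also have "\<dots> = (\<integral>\<^sup>+y. ennreal (K * (indicator (dyadic_cell j x) y * \<bar>z x - z y\<bar> powr p)) \<partial>lborel)"
      using K integrable_cell_in_Lp(1)[OF z p, of j x "z x"] by (intro nn_integral_eq_integral[symmetric]) auto
    also have "\<dots> \<le> (\<integral>\<^sup>+y. ennreal (K * D) * ennreal (norm (gag_quot p t z (x, y)) powr p) \<partial>lborel)"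
    proof (intro nn_integral_mono)
      fix y
      have "indicator (dyadic_cell j x) y * \<bar>z x - z y\<bar> powr p \<le> D * \<bar>gag_quot p t z (x, y)\<bar> powr p"
      proof (cases "y \<in> dyadic_cell j x \<and> x \<noteq> y")
        case True
        have "norm (x - y) powr ?a \<le> D"
          unfolding D_def using a True dyadic_cell_diam[of y j x] by (intro powr_mono2) auto
        then have "1 \<le> D / norm (x - y) powr ?a" using True by simp
        then have "\<bar>z x - z y\<bar> powr p * 1 \<le> \<bar>z x - z y\<bar> powr p * (D / norm (x - y) powr ?a)"
          by (intro mult_left_mono) auto
        then show ?thesis using True p by (simp add: gag_quot_powr mult.commute)
      qed (use D in auto)
      then have "K * (indicator (dyadic_cell j x) y * \<bar>z x - z y\<bar> powr p) \<le> K * D * \<bar>gag_quot p t z (x, y)\<bar> powr p"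
        using K by (simp add: mult.assoc)
      then show "ennreal (K * (indicator (dyadic_cell j x) y * \<bar>z x - z y\<bar> powr p)) \<le> ennreal (K * D) * ennreal (norm (gag_quot p t z (x, y)) powr p)"
        using K D by (simp add: ennreal_leI flip: ennreal_mult')
    qed
    finally show ?thesis .
  qed
  have "(\<integral>\<^sup>+x. ennreal (\<bar>z x - dyadic_avg j z x\<bar> powr p) \<partial>lborel)
     \<le> (\<integral>\<^sup>+x. \<integral>\<^sup>+y. ennreal (K * D) * ennreal (norm (gag_quot p t z (x, y)) powr p) \<partial>lborel \<partial>lborel)"
    by (intro nn_integral_mono pt)
  also have "\<dots> = (\<integral>\<^sup>+w. ennreal (K * D) * ennreal (norm (gag_quot p t z w) powr p) \<partial>(lborel \<Otimes>\<^sub>M lborel))"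
    by (rule lborel.nn_integral_fst) measurable
  also have "\<dots> = ennreal (K * D) * (\<integral>\<^sup>+w. ennreal (norm (gag_quot p t z w) powr p) \<partial>(lborel \<Otimes>\<^sub>M lborel))"
    by (intro nn_integral_cmult) measurable
  also have "(\<integral>\<^sup>+w. ennreal (norm (gag_quot p t z w) powr p) \<partial>(lborel \<Otimes>\<^sub>M lborel)) = ennreal (gagliardo_pow p t z)"
    using g p by (subst nn_integral_eq_integral) (auto simp: in_Lp_def gagliardo_pow_eq)
  also have "ennreal (K * D) * ennreal (gagliardo_pow p t z) = ennreal (C * gagliardo_pow p t z)"
    using K D by (simp add: C_def K_def D_def ennreal_mult' flip: ennreal_mult')
  finally have *: "(\<integral>\<^sup>+x. ennreal (norm (z x - dyadic_avg j z x) powr p) \<partial>lborel) \<le> ennreal (C * gagliardo_pow p t z)"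
    by simp
  have gp: "0 \<le> gagliardo_pow p t z" using p by (simp add: gagliardo_pow_eq)
  show L: "in_Lp lborel p (\<lambda>x. z x - dyadic_avg j z x)"
    unfolding in_Lp_def integrable_iff_bounded using * mz
    by (auto intro: order.strict_trans1)
  show "(LINT x|lborel. \<bar>z x - dyadic_avg j z x\<bar> powr p) \<le> C * gagliardo_pow p t z"
    using * gp K D unfolding nn_integral_eq_integral[OF in_LpD(2)[OF L] AE_I2[OF powr_ge_zero]]
    by (subst (asm) ennreal_le_iff) (auto simp: C_def K_def D_def)
qed

text \<open>On a bounded set the averages over dyadic cells of side \<open>2\<^sup>-\<^sup>j\<close> approximate in \<open>L\<^sup>p\<close> uniformly in terms
  of the seminorm, and a diagonal sequence makes the countably many averages converge.\<close>

lemma gagliardo_compact: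
  fixes w :: "nat \<Rightarrow> 'a::euclidean_space \<Rightarrow> real"
  assumes \<Omega>: "bounded \<Omega>" "\<Omega> \<in> sets borel" and p: "1 \<le> p" and t: "0 < t"
    and w: "\<And>n. in_Lp lborel p (w n)" "\<And>n x. x \<notin> \<Omega> \<Longrightarrow> w n x = 0"
      "\<And>n. in_Lp (lborel \<Otimes>\<^sub>M lborel) p (gag_quot p t (w n))" "\<And>n. gagliardo_pow p t (w n) \<le> C"
  obtains k :: "nat \<Rightarrow> nat" where "strict_mono k"
    "\<And>e. 0 < e \<Longrightarrow> \<exists>N. \<forall>m\<ge>N. \<forall>n\<ge>N. (LINT x|lborel. \<bar>w (k m) x - w (k n) x\<bar> powr p) < e"
proof -
  let ?N = "real DIM('a)"
  let ?a = "?N + t * p"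
  have [measurable]: "\<Omega> \<in> sets borel" "w n \<in> borel_measurable borel" for n using \<Omega> w by (auto simp: in_Lp_def)
  have fin: "emeasure lborel \<Omega> < \<infinity>" by (rule emeasure_bounded_finite[OF \<Omega>(1)])
  have C: "0 \<le> C" using w(4)[of 0] p by (simp add: gagliardo_pow_eq order.trans[rotated])
  obtain CP where CP: "0 \<le> CP" "\<And>w. in_Lp lborel p w \<Longrightarrow> (\<And>x. x \<notin> \<Omega> \<Longrightarrow> w x = 0) \<Longrightarrow>
     in_Lp (lborel \<Otimes>\<^sub>M lborel) p (gag_quot p t w) \<Longrightarrow> (LINT x|lborel. \<bar>w x\<bar> powr p) \<le> CP * gagliardo_pow p t w"
    using gagliardo_poincare[OF \<Omega>(1) p t] by blast
  \<comment> \<open>Since |w| \<le> 1 + |w|^p on \<Omega>, this bounds the integrals over all sets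
    and for all n at once, as the extraction of a convergent subsequence requires.\<close>
  define M where "M = measure lborel \<Omega> + CP * C"
  have M: "norm (LINT y|lborel. indicator A y * w n y) \<le> M" for A n
  proof -
    have wb: "\<bar>indicator A y * w n y\<bar> \<le> indicator \<Omega> y + \<bar>w n y\<bar> powr p" for y
    proof (cases "y \<in> \<Omega> \<and> 1 \<le> \<bar>w n y\<bar>")
      case True
      then have "\<bar>w n y\<bar> powr 1 \<le> \<bar>w n y\<bar> powr p" using p by (intro powr_mono) auto
      then show ?thesis by (auto simp: indicator_def)
    next
      case False
      then show ?thesis using w(2)[of y n] by (auto simp: indicator_def add_increasing2)
    qed
    have i: "integrable lborel (\<lambda>y. indicator \<Omega> y + \<bar>w n y\<bar> powr p)"
      using w(1)[of n] fin by (intro Bochner_Integration.integrable_add integrable_real_indicator) (auto simp: in_Lp_def)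
    have "norm (LINT y|lborel. indicator A y * w n y) \<le> (LINT y|lborel. indicator \<Omega> y + \<bar>w n y\<bar> powr p)"
      by (rule order.trans[OF integral_norm_bound integral_mono'[OF i]]) (use wb in simp_all)
    also have "\<dots> = measure lborel \<Omega> + (LINT y|lborel. \<bar>w n y\<bar> powr p)"
      using w(1)[of n] fin by (subst Bochner_Integration.integral_add) (auto simp: in_Lp_def)
    also have "\<dots> \<le> measure lborel \<Omega> + CP * gagliardo_pow p t (w n)"
      using CP(2)[of "w n"] w by simp
    also have "\<dots> \<le> M" unfolding M_def using CP w(4)[of n] by (simp add: mult_left_mono)
    finally show ?thesis .
  qed
  obtain k :: "nat \<Rightarrow> nat" where k: "strict_mono k"
    "\<And>A. A \<in> {A. \<exists>j x. A = dyadic_cell j (x :: 'a)} \<Longrightarrow> \<exists>l. (\<lambda>n. LINT y|lborel. indicator A y * w (k n) y) \<longlonglongrightarrow> l"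
    using function_convergent_subsequence[OF countable_dyadic_cells, of "\<lambda>n A. LINT y|lborel. indicator A y * w n y" M] M by blast
  define L where "L j x = lim (\<lambda>n. dyadic_avg j (w (k n)) x)" for j x
  have lim: "(\<lambda>n. dyadic_avg j (w (k n)) x) \<longlonglongrightarrow> L j x" for j x
  proof -
    obtain l where "(\<lambda>n. LINT y|lborel. indicator (dyadic_cell j x) y * w (k n) y) \<longlonglongrightarrow> l"
      using k(2)[of "dyadic_cell j x"] by blast
    then have "(\<lambda>n. dyadic_avg j (w (k n)) x) \<longlonglongrightarrow> (2 ^ j) ^ DIM('a) * l"
      unfolding dyadic_avg_def by (intro tendsto_intros)
    then show ?thesis unfolding L_def by (metis limI)
  qed
  have [measurable]: "dyadic_avg j (w n) \<in> borel_measurable borel" for j n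
    by (intro dyadic_avg_measurable) measurable
  have [measurable]: "L j \<in> borel_measurable borel" for j
    unfolding L_def by (intro borel_measurable_lim_metric) measurable
  have bd: "\<bar>dyadic_avg j (w n) x\<bar> \<le> (2 ^ j) ^ DIM('a) * M" for j n x
    using M[where n=n and A="dyadic_cell j x"] by (simp add: dyadic_avg_def abs_mult)
  have bdL: "\<bar>L j x\<bar> \<le> (2 ^ j) ^ DIM('a) * M" for j x
    by (rule LIMSEQ_le_const2[OF tendsto_rabs[OF lim]]) (use bd in auto)
  \<comment> \<open>Cell averages may be nonzero outside \<Omega>. Cutting them off there gives an
    integrable majorant and costs nothing, because the functions themselves vanish off
    \<Omega>.\<close>
  define d where "d j n x = indicator \<Omega> x * (dyadic_avg j (w (k n)) x - L j x)" for j n x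
  have [measurable]: "d j n \<in> borel_measurable borel" for j n
    unfolding d_def[abs_def] by measurable
  have int_d: "integrable lborel (\<lambda>x. (2 * ((2 ^ j) ^ DIM('a) * M)) powr p * indicator \<Omega> x)" for j
    using fin by (intro integrable_mult_right integrable_real_indicator) auto
  have le_d: "norm (d j n x) powr p \<le> (2 * ((2 ^ j) ^ DIM('a) * M)) powr p * indicator \<Omega> x" for j n x
  proof (cases "x \<in> \<Omega>")
    case True
    have "\<bar>dyadic_avg j (w (k n)) x - L j x\<bar> \<le> 2 * ((2 ^ j) ^ DIM('a) * M)"
      using bd[of j "k n" x] bdL[of j x] by linarith
    then show ?thesis using True p by (auto simp: d_def intro!: powr_mono2)
  qed (simp add: d_def)
  have dLp: "in_Lp lborel p (d j n)" for j n
    by (rule in_Lp_bound[OF _ int_d AE_I2[OF le_d]]) measurable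
  have d0: "(\<lambda>n. LINT x|lborel. \<bar>d j n x\<bar> powr p) \<longlonglongrightarrow> 0" for j
  proof -
    have "(\<lambda>n. LINT x|lborel. \<bar>d j n x\<bar> powr p) \<longlonglongrightarrow> (LINT x|(lborel :: 'a measure). 0)"
    proof (rule integral_dominated_convergence[OF _ _ int_d[of j]])
      show "AE x in lborel. norm (\<bar>d j n x\<bar> powr p) \<le> (2 * ((2 ^ j) ^ DIM('a) * M)) powr p * indicator \<Omega> x" for n
        using le_d by simp
      have "(\<lambda>n. \<bar>d j n x\<bar> powr p) \<longlonglongrightarrow> \<bar>indicator \<Omega> x * (L j x - L j x)\<bar> powr p" for x
        unfolding d_def using p by (intro tendsto_powr' tendsto_rabs tendsto_mult tendsto_diff tendsto_const lim) auto
      then show "AE x in lborel. (\<lambda>n. \<bar>d j n x\<bar> powr p) \<longlonglongrightarrow> 0" by simp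
    qed measurable
    then show ?thesis by simp
  qed
  define c where "c = (2::real) powr (p - 1)"
  have c: "0 < c" by (simp add: c_def)
  have "\<exists>N. \<forall>m\<ge>N. \<forall>n\<ge>N. (LINT x|lborel. \<bar>w (k m) x - w (k n) x\<bar> powr p) < e" if e: "0 < e" for e
  proof -
    define K where "K j = (2 ^ j) ^ DIM('a) * (?N / 2 ^ j) powr ?a" for j :: nat
    have K: "K j = ?N powr ?a * ((1/2) powr (t * p)) ^ j" for j
    proof -
      have "(?N / 2 ^ j) powr ?a = ?N powr ?a * inverse ((2 ^ j) powr ?N) * inverse ((2 ^ j) powr (t * p))"
        by (simp add: powr_divide powr_add field_simps)
      also have "(2 ^ j) powr ?N = (2 ^ j) ^ DIM('a)" by (simp add: powr_realpow)
      also have "inverse ((2 ^ j) powr (t * p)) = ((1/2) powr (t * p)) ^ j"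
        by (simp add: powr_divide power_one_over powr_powr mult.commute inverse_eq_divide flip: powr_realpow)
      finally show ?thesis by (simp add: K_def)
    qed
    have "(1/2::real) powr (t * p) < 1" using powr_less_mono2[of "t * p" "1/2" 1] t p by simp
    then have "(\<lambda>j. c * (K j * (c * (C + C)))) \<longlonglongrightarrow> c * ((?N powr ?a * 0) * (c * (C + C)))"
      unfolding K by (intro tendsto_intros LIMSEQ_power_zero) auto
    then have "\<forall>\<^sub>F j in sequentially. c * (K j * (c * (C + C))) < e / 2"
      using e by (intro order_tendstoD(2)) auto
    \<comment> \<open>The scale is fixed by the seminorm bound alone, before any index is chosen; at
      that scale only the convergent averages remain to be compared.\<close>
    then obtain j where j: "c * (K j * (c * (C + C))) < e / 2"
      by (auto simp: eventually_sequentially)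
    have "\<forall>\<^sub>F n in sequentially. (LINT x|lborel. \<bar>d j n x\<bar> powr p) < e / (4 * c * c)"
      using e c by (intro order_tendstoD(2)[OF d0]) auto
    then obtain N where N: "\<And>n. N \<le> n \<Longrightarrow> (LINT x|lborel. \<bar>d j n x\<bar> powr p) < e / (4 * c * c)"
      by (auto simp: eventually_sequentially)
    have "(LINT x|lborel. \<bar>w (k m) x - w (k n) x\<bar> powr p) < e" if mn: "N \<le> m" "N \<le> n" for m n
    proof -
      define z where "z x = w (k m) x - w (k n) x" for x
      have z: "in_Lp lborel p z" unfolding z_def by (intro in_Lp_diff w p)
      have gz: "in_Lp (lborel \<Otimes>\<^sub>M lborel) p (gag_quot p t z)"
        using in_Lp_diff[OF w(3)[of "k m"] w(3)[of "k n"] p] by (simp add: z_def[abs_def] gag_quot_diff[abs_def])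
      have "gagliardo_pow p t z \<le> c * (gagliardo_pow p t (w (k m)) + gagliardo_pow p t (w (k n)))"
        using Lp_integral_diff_le[OF w(3)[of "k m"] w(3)[of "k n"] p] p
        by (simp add: z_def[abs_def] gagliardo_pow_eq gag_quot_diff c_def)
      also have "\<dots> \<le> c * (C + C)" using c by (intro mult_left_mono add_mono w(4)) auto
      finally have gb: "gagliardo_pow p t z \<le> c * (C + C)" .
      note ap = dyadic_avg_approx[OF z p t gz, of j]
      \<comment> \<open>The limits \<open>L\<close> cancel in the difference, so on \<Omega> the
        second bracket is the average of \<open>z\<close>.\<close>
      have ze: "z x = indicator \<Omega> x * (z x - dyadic_avg j z x) + (d j m x - d j n x)" for x
        using w(2)[of x] dyadic_avg_diff[OF w(1)[of "k m"] w(1)[of "k n"] p, of j x]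
        by (cases "x \<in> \<Omega>") (auto simp: d_def z_def[abs_def])
      have i1: "in_Lp lborel p (\<lambda>x. indicator \<Omega> x * (z x - dyadic_avg j z x))"
        using ap(1) by (intro in_Lp_bound[where g="\<lambda>x. \<bar>z x - dyadic_avg j z x\<bar> powr p"])
          (auto simp: in_Lp_def indicator_def)
      have i2: "in_Lp lborel p (\<lambda>x. d j m x - d j n x)" by (intro in_Lp_diff dLp p)
      have "(LINT x|lborel. \<bar>z x\<bar> powr p) = (LINT x|lborel. norm (indicator \<Omega> x * (z x - dyadic_avg j z x) + (d j m x - d j n x)) powr p)"
        by (intro Bochner_Integration.integral_cong) (auto simp: ze[symmetric])
      also have "\<dots> \<le> c * ((LINT x|lborel. norm (indicator \<Omega> x * (z x - dyadic_avg j z x)) powr p) + (LINT x|lborel. norm (d j m x - d j n x) powr p))"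
        unfolding c_def by (intro Lp_integral_add_le i1 i2 p)
      also have "\<dots> \<le> c * (K j * (c * (C + C)) + c * ((LINT x|lborel. norm (d j m x) powr p) + (LINT x|lborel. norm (d j n x) powr p)))"
      proof (intro mult_left_mono add_mono)
        have "(LINT x|lborel. norm (indicator \<Omega> x * (z x - dyadic_avg j z x)) powr p) \<le> (LINT x|lborel. \<bar>z x - dyadic_avg j z x\<bar> powr p)"
          using in_LpD(2)[OF i1] in_LpD(2)[OF ap(1)] by (intro integral_mono) (auto simp: indicator_def)
        also have "\<dots> \<le> K j * gagliardo_pow p t z" using ap(2) by (simp add: K_def)
        also have "\<dots> \<le> K j * (c * (C + C))" by (intro mult_left_mono gb) (simp add: K_def)
        finally show "(LINT x|lborel. norm (indicator \<Omega> x * (z x - dyadic_avg j z x)) powr p) \<le> K j * (c * (C + C))" .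
        show "(LINT x|lborel. norm (d j m x - d j n x) powr p) \<le> c * ((LINT x|lborel. norm (d j m x) powr p) + (LINT x|lborel. norm (d j n x) powr p))"
          unfolding c_def by (intro Lp_integral_diff_le dLp p)
      qed (use c in auto)
      also have "\<dots> < e"
      proof -
        have "c * c * ((LINT x|lborel. \<bar>d j m x\<bar> powr p) + (LINT x|lborel. \<bar>d j n x\<bar> powr p)) < c * c * (e / (4 * c * c) + e / (4 * c * c))"
          using c N[OF mn(1)] N[OF mn(2)] by (intro mult_strict_left_mono add_strict_mono) auto
        also have "\<dots> = e / 2" using c by (simp add: field_simps)
        finally show ?thesis using j by (simp add: algebra_simps)
      qed
      finally show ?thesis by (simp add: z_def)
    qed
    then show ?thesis by blast
  qed
  with k(1) show ?thesis by (rule that)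
qed

section \<open>Weak gradients\<close>

text \<open>Local integrability speaks only of compact subsets; exhausting the open set by compact
  ones recovers measurability on all of it as a pointwise limit.\<close>

lemma loc_integrable_measurable:
  fixes f :: "'a::euclidean_space \<Rightarrow> 'b::euclidean_space"
  assumes "open \<Omega>" "loc_integrable \<Omega> f"
  shows "(\<lambda>x. indicator \<Omega> x *\<^sub>R f x) \<in> borel_measurable borel"
proof -
  obtain C :: "nat \<Rightarrow> 'a set" where C: "\<And>n. compact (C n)" "\<And>n. C n \<subseteq> \<Omega>" "\<And>n. C n \<subseteq> interior (C (Suc n))" "\<Union>(range C) = \<Omega>"
    using open_Union_compact_subsets[OF assms(1)] by metis
  have inc: "incseq C" using C(3) interior_subset by (intro incseq_SucI) blast
  show ?thesis
  proof (rule borel_measurable_LIMSEQ_metric)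
    show "(\<lambda>x. indicator (C n) x *\<^sub>R f x) \<in> borel_measurable borel" for n
      using assms(2) C(1,2)[of n] by (auto simp: loc_integrable_def set_integrable_def)
    show "(\<lambda>n. indicator (C n) x *\<^sub>R f x) \<longlonglongrightarrow> indicator \<Omega> x *\<^sub>R f x" for x
      using LIMSEQ_indicator_incseq[OF inc, of x] C(4) by (intro tendsto_scaleR) auto
  qed
qed

text \<open>Dynkin's argument: boxes form an intersection-stable generator, and the sets on which
  the integral vanishes are closed under disjoint unions and, by the hypothesis on the total
  integral, under complements.\<close>

lemma AE_zero_if_box_integrals_zero:
  fixes h :: "'a::euclidean_space \<Rightarrow> real"
  assumes h: "integrable lborel h" and 0: "(LINT x|lborel. h x) = 0"
    and box: "\<And>a c. (LINT x:box a c|lborel. h x) = 0"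
  shows "AE x in lborel. h x = 0"
proof -
  let ?G = "range (\<lambda>(a, b). box a b :: 'a set)"
  have int: "set_integrable lborel A h" if "A \<in> sets borel" for A
    using h that unfolding set_integrable_def by (intro integrable_mult_indicator) auto
  have sets: "sigma_sets UNIV ?G = sets borel" by (simp add: borel_eq_box)
  have "(LINT x:A|lborel. h x) = 0" if "A \<in> sets borel" for A
  proof -
    have st: "Int_stable ?G" by (auto simp: Int_stable_def box_Int_box)
    have "A \<in> sigma_sets UNIV ?G" using that sets by simp
    have cl: "?G \<subseteq> Pow UNIV" by auto
    from st cl \<open>A \<in> sigma_sets UNIV ?G\<close> show ?thesis
    proof (induction rule: sigma_sets_induct_disjoint)
      case (basic A)
      then show ?case using box by auto
    next
      case empty
      then show ?case by (simp add: set_lebesgue_integral_def)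
    next
      case (compl A)
      then have "A \<in> sets borel" using sets by simp
      then have "(LINT x:UNIV|lborel. h x) = (LINT x:A|lborel. h x) + (LINT x:UNIV - A|lborel. h x)"
        using set_integral_Un[of A "UNIV - A" lborel h] int[of A] int[of "UNIV - A"] by (simp add: sup_absorb2 Un_Diff_cancel)
      moreover have "(LINT x:UNIV|lborel. h x) = 0" using 0 by (simp add: set_lebesgue_integral_def)
      ultimately show ?case using compl by simp
    next
      case (union A)
      then have A: "\<And>i. A i \<in> sets borel" using sets by auto
      have "(LINT x:(\<Union>i. A i)|lborel. h x) = (\<Sum>i. (LINT x:(A i)|lborel. h x))"
        using A union(1) int[of "\<Union>i. A i"]
        by (intro lebesgue_integral_countable_add) (auto simp: disjoint_family_on_def)
      then show ?case using union by simp
    qed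
  qed
  then have "AE x in lborel. h x = (\<lambda>x. 0) x"
    using h by (intro density_unique_real) (auto simp: set_lebesgue_integral_def)
  then show ?thesis by simp
qed

text \<open>The fundamental lemma of the calculus of variations. Bumps converging to indicators show
  that integrals over boxes with closure in \<Omega> vanish, hence \<open>g\<close> vanishes almost
  everywhere in each such box; by Lindelof countably many of them cover \<Omega>.\<close>

lemma AE_zero_if_test_integrals_zero:
  fixes g :: "'a::euclidean_space \<Rightarrow> real"
  assumes "open \<Omega>" and g: "loc_integrable \<Omega> g"
    and test: "\<And>\<phi>. \<phi> \<in> test_functions \<Omega> \<Longrightarrow> (LINT x:\<Omega>|lborel. g x * \<phi> x) = 0"
  shows "AE x in lborel. x \<in> \<Omega> \<longrightarrow> g x = 0"
proof -
  have box0: "(LINT x:box a c|lborel. g x) = 0" if ac: "cbox a c \<subseteq> \<Omega>" for a c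
  proof -
    have i: "integrable lborel (\<lambda>x. indicator (cbox a c) x * g x)"
      using g ac by (auto simp: loc_integrable_def set_integrable_def)
    have bump: "indicator \<Omega> x * (g x * box_bump a c n x) = (indicator (cbox a c) x * g x) * box_bump a c n x" for n x
      using box_bump_neq_0[of a c n x] ac box_subset_cbox[of a c] by (auto simp: indicator_def)
    have [measurable]: "box_bump a c n \<in> borel_measurable borel" for n
      using box_bump_test_function[OF ac] by (intro borel_measurable_continuous_onI test_function_continuous)
    have [measurable]: "(\<lambda>x. indicator (cbox a c) x * g x) \<in> borel_measurable borel" using i by auto
    have "(\<lambda>n. LINT x|lborel. (indicator (cbox a c) x * g x) * box_bump a c n x)
        \<longlonglongrightarrow> (LINT x|lborel. (indicator (cbox a c) x * g x) * indicator (box a c) x)"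
    proof (rule integral_dominated_convergence)
      show "integrable lborel (\<lambda>x. norm (indicator (cbox a c) x * g x))" using i by (rule integrable_norm)
      show "AE x in lborel. (\<lambda>n. (indicator (cbox a c) x * g x) * box_bump a c n x) \<longlonglongrightarrow> (indicator (cbox a c) x * g x) * indicator (box a c) x"
        by (intro AE_I2 tendsto_mult tendsto_const box_bump_tendsto)
      show "AE x in lborel. norm ((indicator (cbox a c) x * g x) * box_bump a c n x) \<le> norm (indicator (cbox a c) x * g x)" for n
        using box_bump_bounds[of a c n] by (intro AE_I2) (auto simp: abs_mult mult_left_le)
    qed measurable
    moreover have "(LINT x|lborel. (indicator (cbox a c) x * g x) * box_bump a c n x) = 0" for n
      using test[OF box_bump_test_function[OF ac, of n]] by (simp add: set_lebesgue_integral_def bump)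
    ultimately have "(LINT x|lborel. (indicator (cbox a c) x * g x) * indicator (box a c) x) = 0"
      by (simp add: LIMSEQ_const_iff)
    also have "(\<lambda>x. (indicator (cbox a c) x * g x) * indicator (box a c) x) = (\<lambda>x. indicator (box a c) x * g x)"
      using box_subset_cbox[of a c] by (auto simp: indicator_def fun_eq_iff)
    finally show ?thesis by (simp add: set_lebesgue_integral_def)
  qed
  have AE_box: "AE x in lborel. x \<in> box a c \<longrightarrow> g x = 0" if ac: "cbox a c \<subseteq> \<Omega>" for a c
  proof -
    define h where "h x = indicator (box a c) x * g x" for x
    have i: "integrable lborel (\<lambda>x. indicator (cbox a c) x * g x)"
      using g ac by (auto simp: loc_integrable_def set_integrable_def)
    have he: "h x = indicator (box a c) x *\<^sub>R (indicator (cbox a c) x * g x)" for x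
      using box_subset_cbox[of a c] by (auto simp: indicator_def h_def)
    have "integrable lborel h"
      unfolding he using i by (intro integrable_mult_indicator) auto
    moreover have "(LINT x|lborel. h x) = 0"
      using box0[OF ac] by (simp add: h_def set_lebesgue_integral_def)
    \<comment> \<open>An arbitrary box meets \<open>box a c\<close> in a box whose closure still
      lies in \<Omega>, so the vanishing already shown applies to it.\<close>
    moreover have "(LINT x:box u v|lborel. h x) = 0" for u v
    proof -
      define U where "U = (\<Sum>i\<in>Basis. max (u\<bullet>i) (a\<bullet>i) *\<^sub>R i)"
      define V where "V = (\<Sum>i\<in>Basis. min (v\<bullet>i) (c\<bullet>i) *\<^sub>R i)"
      have b: "box u v \<inter> box a c = box U V" by (simp add: box_Int_box U_def V_def)
      have "(LINT x:box u v|lborel. h x) = (LINT x:box U V|lborel. g x)"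
        unfolding set_lebesgue_integral_def h_def b[symmetric]
        by (intro Bochner_Integration.integral_cong) (auto simp: indicator_def)
      also have "\<dots> = 0"
      proof (cases "box U V = {}")
        case False
        have "cbox U V \<subseteq> cbox a c" by (auto simp: mem_box U_def V_def)
        then show ?thesis using ac by (intro box0) auto
      qed (simp add: set_lebesgue_integral_def)
      finally show ?thesis .
    qed
    ultimately have "AE x in lborel. h x = 0" by (rule AE_zero_if_box_integrals_zero)
    then show ?thesis by eventually_elim (auto simp: h_def)
  qed
  define F where "F = {B. \<exists>a c. B = box a c \<and> cbox a c \<subseteq> \<Omega>}"
  have "\<Union>F = \<Omega>"
  proof
    show "\<Union>F \<subseteq> \<Omega>" using box_subset_cbox by (fastforce simp: F_def)
    show "\<Omega> \<subseteq> \<Union>F"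
    proof
      fix x assume "x \<in> \<Omega>"
      then obtain a c where "x \<in> box a c" "cbox a c \<subseteq> \<Omega>"
        using assms(1) open_contains_cbox[of \<Omega> x] by metis
      then show "x \<in> \<Union>F" by (auto simp: F_def)
    qed
  qed
  moreover obtain F' where F': "F' \<subseteq> F" "countable F'" "\<Union>F' = \<Union>F"
    using Lindelof[of F] by (auto simp: F_def open_box)
  ultimately have un: "\<Union>F' = \<Omega>" by simp
  have "AE x in lborel. \<forall>B\<in>F'. x \<in> B \<longrightarrow> g x = 0"
    using F' AE_box by (subst AE_ball_countable) (auto simp: F_def)
  then show ?thesis by eventually_elim (use un in auto)
qed

lemma set_integrable_loc_mult:
  fixes f :: "'a::euclidean_space \<Rightarrow> real"
  assumes "loc_integrable \<Omega> f" "compact K" "K \<subseteq> \<Omega>" "continuous_on UNIV h" "\<And>x. x \<notin> K \<Longrightarrow> h x = 0"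
  shows "set_integrable lborel \<Omega> (\<lambda>x. f x * h x)"
proof -
  obtain B where B: "\<And>x. norm (h x) \<le> B" using compact_support_bounded[OF assms(4,2,5)] by metis
  have i: "integrable lborel (\<lambda>x. indicator K x * f x)"
    using assms(1-3) by (auto simp: loc_integrable_def set_integrable_def)
  have [measurable]: "h \<in> borel_measurable borel" using assms(4) by (rule borel_measurable_continuous_onI)
  have "integrable lborel (\<lambda>x. (indicator K x * f x) * h x)"
  proof (rule Bochner_Integration.integrable_bound)
    show "integrable lborel (\<lambda>x. B * (indicator K x * f x))" using i by simp
    show "(\<lambda>x. (indicator K x * f x) * h x) \<in> borel_measurable lborel" using i by auto
    show "AE x in lborel. norm ((indicator K x * f x) * h x) \<le> norm (B * (indicator K x * f x))"
    proof (intro AE_I2)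
      fix x
      have "\<bar>h x\<bar> \<le> \<bar>B\<bar>" using B[of x] by simp
      then have "\<bar>indicator K x * f x\<bar> * \<bar>h x\<bar> \<le> \<bar>indicator K x * f x\<bar> * \<bar>B\<bar>" by (intro mult_left_mono) auto
      then show "norm ((indicator K x * f x) * h x) \<le> norm (B * (indicator K x * f x))"
        by (simp add: abs_mult mult.commute)
    qed
  qed
  also have "(\<lambda>x. (indicator K x * f x) * h x) = (\<lambda>x. indicator \<Omega> x * (f x * h x))"
    using assms(3,5) by (auto simp: fun_eq_iff indicator_def)
  finally show ?thesis by (simp add: set_integrable_def)
qed

lemma loc_integrable_inner:
  fixes g :: "'a::euclidean_space \<Rightarrow> 'b::euclidean_space"
  assumes "loc_integrable \<Omega> g"
  shows "loc_integrable \<Omega> (\<lambda>x. g x \<bullet> b)"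
  unfolding loc_integrable_def
proof (intro allI impI)
  fix K assume "compact K \<and> K \<subseteq> \<Omega>"
  then have "integrable lborel (\<lambda>x. (indicator K x *\<^sub>R g x) \<bullet> b)"
    using assms by (intro integrable_inner_left) (auto simp: loc_integrable_def set_integrable_def)
  then show "set_integrable lborel K (\<lambda>x. g x \<bullet> b)" by (simp add: set_integrable_def)
qed

lemma loc_integrable_diff:
  fixes f g :: "'a::euclidean_space \<Rightarrow> 'b::euclidean_space"
  shows "loc_integrable \<Omega> f \<Longrightarrow> loc_integrable \<Omega> g \<Longrightarrow> loc_integrable \<Omega> (\<lambda>x. f x - g x)"
  unfolding loc_integrable_def by (intro allI impI set_integral_diff(1)) auto

lemma has_weak_gradient_integrable:
  assumes "has_weak_gradient \<Omega> u g" "\<phi> \<in> test_functions \<Omega>"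
  shows "set_integrable lborel \<Omega> (\<lambda>x. u x * (grad \<phi> x \<bullet> b))"
    and "set_integrable lborel \<Omega> (\<lambda>x. (g x \<bullet> b) * \<phi> x)"
proof -
  obtain K where K: "compact K" "K \<subseteq> \<Omega>" "\<And>x. x \<notin> K \<Longrightarrow> \<phi> x = 0" "\<And>x. x \<notin> K \<Longrightarrow> grad \<phi> x = 0"
    using assms(2) by (metis test_function_support)
  show "set_integrable lborel \<Omega> (\<lambda>x. u x * (grad \<phi> x \<bullet> b))"
    using assms K by (intro set_integrable_loc_mult[of \<Omega> u K])
      (auto simp: has_weak_gradient_def intro!: continuous_intros test_function_grad_continuous)
  show "set_integrable lborel \<Omega> (\<lambda>x. (g x \<bullet> b) * \<phi> x)"
    using assms K by (intro set_integrable_loc_mult[of \<Omega> _ K])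
      (auto simp: has_weak_gradient_def intro!: loc_integrable_inner test_function_continuous)
qed

lemma has_weak_gradient_eq:
  assumes "has_weak_gradient \<Omega> u g" "\<phi> \<in> test_functions \<Omega>" "b \<in> Basis"
  shows "(LINT x:\<Omega>|lborel. u x * (grad \<phi> x \<bullet> b)) = - (LINT x:\<Omega>|lborel. (g x \<bullet> b) * \<phi> x)"
proof -
  have "(LINT x:\<Omega>|lborel. u x * frechet_derivative \<phi> (at x) b) = - (LINT x:\<Omega>|lborel. (g x \<bullet> b) * \<phi> x)"
    using assms by (auto simp: has_weak_gradient_def)
  then show ?thesis unfolding test_function_frechet[OF assms(2)] .
qed

lemma has_weak_gradientI:
  assumes "loc_integrable \<Omega> u" "loc_integrable \<Omega> g"
    and "\<And>\<phi> b. \<phi> \<in> test_functions \<Omega> \<Longrightarrow> b \<in> Basis \<Longrightarrow>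
      (LINT x:\<Omega>|lborel. u x * (grad \<phi> x \<bullet> b)) = - (LINT x:\<Omega>|lborel. (g x \<bullet> b) * \<phi> x)"
  shows "has_weak_gradient \<Omega> u g"
  unfolding has_weak_gradient_def
proof (intro conjI assms(1,2) ballI)
  fix \<phi> b assume \<phi>: "\<phi> \<in> test_functions \<Omega>" and b: "b \<in> (Basis :: 'a set)"
  show "(LINT x:\<Omega>|lborel. u x * frechet_derivative \<phi> (at x) b) = - (LINT x:\<Omega>|lborel. (g x \<bullet> b) * \<phi> x)"
    unfolding test_function_frechet[OF \<phi>] by (rule assms(3)[OF \<phi> b])
qed

lemma has_weak_gradient_diff:
  assumes "has_weak_gradient \<Omega> u g" "has_weak_gradient \<Omega> v h"
  shows "has_weak_gradient \<Omega> (\<lambda>x. u x - v x) (\<lambda>x. g x - h x)"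
proof (rule has_weak_gradientI)
  show "loc_integrable \<Omega> (\<lambda>x. u x - v x)" "loc_integrable \<Omega> (\<lambda>x. g x - h x)"
    using assms by (auto simp: has_weak_gradient_def intro!: loc_integrable_diff)
  fix \<phi> b assume \<phi>: "\<phi> \<in> test_functions \<Omega>" and b: "b \<in> (Basis :: 'a set)"
  show "(LINT x:\<Omega>|lborel. (u x - v x) * (grad \<phi> x \<bullet> b)) = - (LINT x:\<Omega>|lborel. ((g x - h x) \<bullet> b) * \<phi> x)"
    using has_weak_gradient_integrable[OF assms(1) \<phi>] has_weak_gradient_integrable[OF assms(2) \<phi>]
      has_weak_gradient_eq[OF assms(1) \<phi> b] has_weak_gradient_eq[OF assms(2) \<phi> b]
    by (simp add: left_diff_distrib inner_diff_left set_integral_diff(2))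
qed

text \<open>By subtraction \<open>g - h\<close> is a weak gradient of the zero function, and the
  fundamental lemma applies to each coordinate.\<close>

lemma has_weak_gradient_unique:
  assumes "open \<Omega>" "has_weak_gradient \<Omega> u g" "has_weak_gradient \<Omega> u h"
  shows "AE x in lborel. x \<in> \<Omega> \<longrightarrow> g x = h x"
proof -
  have "AE x in lborel. x \<in> \<Omega> \<longrightarrow> (g x - h x) \<bullet> b = 0" if b: "b \<in> Basis" for b
  proof (rule AE_zero_if_test_integrals_zero[OF assms(1)])
    show "loc_integrable \<Omega> (\<lambda>x. (g x - h x) \<bullet> b)"
      using assms by (auto simp: has_weak_gradient_def intro!: loc_integrable_inner loc_integrable_diff)
    fix \<phi> assume \<phi>: "\<phi> \<in> test_functions \<Omega>"
    show "(LINT x:\<Omega>|lborel. ((g x - h x) \<bullet> b) * \<phi> x) = 0"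
      using has_weak_gradient_eq[OF has_weak_gradient_diff[OF assms(2,3)] \<phi> b]
      by (simp add: set_lebesgue_integral_def)
  qed
  then have "AE x in lborel. \<forall>b\<in>Basis. x \<in> \<Omega> \<longrightarrow> (g x - h x) \<bullet> b = 0"
    by (intro AE_finite_allI) auto
  then show ?thesis
    by eventually_elim (auto simp: inner_diff_left intro: euclidean_eqI)
qed

text \<open>The choice behind \<open>weak_gradient\<close> is uncontrolled outside \<Omega>.
  Extension by 0 yields a Borel function and turns integrals over \<Omega> into integrals over the
  whole space.\<close>

definition wgrad :: "'a::euclidean_space set \<Rightarrow> ('a \<Rightarrow> real) \<Rightarrow> 'a \<Rightarrow> 'a" where
  "wgrad \<Omega> u x = indicator \<Omega> x *\<^sub>R weak_gradient \<Omega> u x"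

lemma wgrad_powr:
  assumes "0 < p"
  shows "(LINT x:\<Omega>|lborel. norm (weak_gradient \<Omega> u x) powr p) = (LINT x|lborel. norm (wgrad \<Omega> u x) powr p)"
  unfolding set_lebesgue_integral_def wgrad_def
  by (intro Bochner_Integration.integral_cong) (auto simp: indicator_def)

lemma wgrad_AE_eq:
  assumes "open \<Omega>" "has_weak_gradient \<Omega> u g"
  shows "has_weak_gradient \<Omega> u (weak_gradient \<Omega> u)"
    and "wgrad \<Omega> u \<in> borel_measurable borel"
    and "AE x in lborel. wgrad \<Omega> u x = indicator \<Omega> x *\<^sub>R g x"
proof -
  show w: "has_weak_gradient \<Omega> u (weak_gradient \<Omega> u)"
    unfolding weak_gradient_def using assms(2) by (rule someI[of "has_weak_gradient \<Omega> u"])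
  show "wgrad \<Omega> u \<in> borel_measurable borel"
    using loc_integrable_measurable[OF assms(1), of "weak_gradient \<Omega> u"] w
    by (simp add: has_weak_gradient_def wgrad_def[abs_def])
  show "AE x in lborel. wgrad \<Omega> u x = indicator \<Omega> x *\<^sub>R g x"
    using has_weak_gradient_unique[OF assms(1) w assms(2)]
    by eventually_elim (auto simp: wgrad_def indicator_def)
qed

text \<open>The graph of the gradient on \<open>W\<^sub>0\<^sup>1\<^sup>,\<^sup>p\<close>: both components are Borel representatives extended by \<open>0\<close>.
  This avoids the choice made in \<^const>\<open>weak_gradient\<close>.\<close>

definition sobolev_pair :: "'a::euclidean_space set \<Rightarrow> real \<Rightarrow> ('a \<Rightarrow> real) \<Rightarrow> ('a \<Rightarrow> 'a) \<Rightarrow> bool" where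
  "sobolev_pair \<Omega> p u g \<longleftrightarrow> in_Lp lborel p u \<and> in_Lp lborel p g \<and> (\<forall>x. x \<notin> \<Omega> \<longrightarrow> u x = 0 \<and> g x = 0) \<and>
     (\<forall>e>0. \<exists>\<phi>\<in>test_functions \<Omega>. (LINT x|lborel. \<bar>u x - \<phi> x\<bar> powr p) + (LINT x|lborel. norm (g x - grad \<phi> x) powr p) < e)"

lemma sobolev_pair_test_function:
  assumes "\<phi> \<in> test_functions \<Omega>" "0 < p"
  shows "sobolev_pair \<Omega> p \<phi> (grad \<phi>)"
  unfolding sobolev_pair_def
  using assms test_function_in_Lp[OF assms(1)] test_function_grad_in_Lp[OF assms(1)]
    test_function_zero_outside[OF assms(1)] test_function_grad_zero_outside[OF assms(1)]
  by (auto intro!: bexI[of _ \<phi>])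

text \<open>In place of Hoelder's inequality, the parametrized Young inequality with
  \<open>M = 1\<close> gives |f| \<le> d + d^(1-p) |f|^p on \<Omega>. The choice of \<open>d\<close>
  lets the first term contribute at most \<eta>/2; dividing by \<open>m + 1\<close> also covers
  measure 0.\<close>

lemma Lp_small_imp_L1_small:
  fixes \<Omega> :: "'a::euclidean_space set"
  assumes "bounded \<Omega>" "\<Omega> \<in> sets borel" "1 \<le> p" "0 < \<eta>"
  obtains e where "0 < e" "\<And>f :: 'a \<Rightarrow> 'b::euclidean_space. in_Lp lborel p f \<Longrightarrow> (\<And>x. x \<notin> \<Omega> \<Longrightarrow> f x = 0) \<Longrightarrow>
     (LINT x|lborel. norm (f x) powr p) < e \<Longrightarrow> (LINT x|lborel. norm (f x)) < \<eta>"
proof -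
  define m where "m = measure lborel \<Omega>"
  have m: "0 \<le> m" by (simp add: m_def)
  define d where "d = \<eta> / 2 / (m + 1)"
  have d: "0 < d" using assms(4) m by (simp add: d_def)
  have iO: "integrable lborel (indicator \<Omega> :: 'a \<Rightarrow> real)"
    using emeasure_bounded_finite[OF assms(1)] assms(2) by (intro integrable_real_indicator) auto
  show ?thesis
  proof (rule that)
    show "0 < \<eta> / (2 * d powr (1 - p))" using d assms(4) by simp
    fix f :: "'a \<Rightarrow> 'b" assume f: "in_Lp lborel p f" "\<And>x. x \<notin> \<Omega> \<Longrightarrow> f x = 0"
      and small: "(LINT x|lborel. norm (f x) powr p) < \<eta> / (2 * d powr (1 - p))"
    have "(LINT x|lborel. norm (f x)) \<le> (LINT x|lborel. d * indicator \<Omega> x + d powr (1 - p) * norm (f x) powr p)"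
    proof (rule integral_mono')
      show "integrable lborel (\<lambda>x. d * indicator \<Omega> x + d powr (1 - p) * norm (f x) powr p)"
        using iO f(1) by (auto simp: in_Lp_def)
      show "norm (f x) \<le> d * indicator \<Omega> x + d powr (1 - p) * norm (f x) powr p" for x
        using powr_mult_le_eps[of 1 "norm (f x)" p d] assms(3) d f(2)[of x] by (cases "x \<in> \<Omega>") auto
    qed (use d in simp)
    also have "\<dots> = d * m + d powr (1 - p) * (LINT x|lborel. norm (f x) powr p)"
      using iO f(1) by (simp add: in_Lp_def m_def)
    also have "\<dots> < d * m + d powr (1 - p) * (\<eta> / (2 * d powr (1 - p)))"
      using small d by (intro add_strict_left_mono mult_strict_left_mono) auto
    also have "d powr (1 - p) * (\<eta> / (2 * d powr (1 - p))) = \<eta> / 2" using d by simp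
    also have "d * m + \<eta> / 2 \<le> \<eta>"
    proof -
      have "d * m \<le> d * (m + 1)" using d by simp
      also have "\<dots> = \<eta> / 2" using m by (intro nonzero_eq_divide_eq[THEN iffD1, OF _ d_def]) simp
      finally show ?thesis by simp
    qed
    finally show "(LINT x|lborel. norm (f x)) < \<eta>" .
  qed
qed

lemma in_Lp_loc_integrable:
  fixes f :: "'a::euclidean_space \<Rightarrow> 'b::euclidean_space"
  assumes "in_Lp lborel p f" "1 \<le> p"
  shows "loc_integrable \<Omega> f"
  unfolding loc_integrable_def set_integrable_def
proof (intro allI impI)
  fix K assume K: "compact K \<and> K \<subseteq> \<Omega>"
  show "integrable lborel (\<lambda>x. indicator K x *\<^sub>R f x)"
  proof (rule Bochner_Integration.integrable_bound)
    show "integrable lborel (\<lambda>x. indicator K x + norm (f x) powr p)"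
      using assms emeasure_bounded_finite[OF compact_imp_bounded, of K] K
      by (intro Bochner_Integration.integrable_add integrable_real_indicator) (auto simp: in_Lp_def borel_compact)
    show "(\<lambda>x. indicator K x *\<^sub>R f x) \<in> borel_measurable lborel"
      using assms K by (auto simp: in_Lp_def borel_compact intro!: borel_measurable_scaleR borel_measurable_indicator)
    show "AE x in lborel. norm (indicator K x *\<^sub>R f x) \<le> norm (indicator K x + norm (f x) powr p)"
      using powr_mult_le_eps[of 1 "norm (f x)" p 1 for x] assms(2) by (intro AE_I2) (auto simp: indicator_def)
  qed
qed

lemma abs_set_integral_le:
  fixes f F :: "'a \<Rightarrow> real"
  assumes "integrable M F" "\<And>x. \<bar>f x\<bar> \<le> F x"
  shows "\<bar>LINT x:A|M. f x\<bar> \<le> (LINT x|M. F x)"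
proof -
  have nonneg: "0 \<le> F x" for x by (rule order.trans[OF abs_ge_zero assms(2)])
  have "\<bar>LINT x:A|M. f x\<bar> \<le> (LINT x|M. \<bar>indicator A x *\<^sub>R f x\<bar>)"
    unfolding set_lebesgue_integral_def by (rule integral_abs_bound)
  also have "\<dots> \<le> (LINT x|M. F x)"
    by (rule integral_mono'[OF assms(1)]) (use assms(2) nonneg in \<open>simp_all add: indicator_def\<close>)
  finally show ?thesis .
qed

text \<open>The defect \<open>X\<close> in the integration by parts formula is linear in the pair
  and vanishes for a test function and its gradient. It therefore equals the defect of the
  approximation error, which is controlled by L^1 norms and so is arbitrarily small.\<close>

lemma sobolev_pair_weak_gradient:
  assumes \<Omega>: "open \<Omega>" "bounded \<Omega>" and p: "1 \<le> p" and ug: "sobolev_pair \<Omega> p u g"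
  shows "has_weak_gradient \<Omega> u g"
proof (rule has_weak_gradientI)
  have L: "in_Lp lborel p u" "in_Lp lborel p g" and z: "\<And>x. x \<notin> \<Omega> \<Longrightarrow> u x = 0" "\<And>x. x \<notin> \<Omega> \<Longrightarrow> g x = 0"
    using ug by (auto simp: sobolev_pair_def)
  show li: "loc_integrable \<Omega> u" "loc_integrable \<Omega> g" using L p by (auto intro: in_Lp_loc_integrable)
  fix \<psi> b assume \<psi>: "\<psi> \<in> test_functions \<Omega>" and b: "b \<in> (Basis :: 'a set)"
  obtain K where K: "compact K" "K \<subseteq> \<Omega>" "\<And>x. x \<notin> K \<Longrightarrow> \<psi> x = 0" "\<And>x. x \<notin> K \<Longrightarrow> grad \<psi> x = 0"
    using \<psi> by (metis test_function_support)
  have c\<psi>: "continuous_on UNIV \<psi>" "continuous_on UNIV (\<lambda>x. grad \<psi> x \<bullet> b)"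
    using test_function_continuous[OF \<psi>] test_function_grad_continuous[OF \<psi>] by (auto intro!: continuous_intros)
  obtain B1 where B1: "\<And>x. norm (\<psi> x) \<le> B1" using compact_support_bounded[OF c\<psi>(1) K(1,3)] by metis
  obtain B2 where B2: "\<And>x. norm (grad \<psi> x \<bullet> b) \<le> B2"
    using compact_support_bounded[OF c\<psi>(2) K(1)] K(4) by (metis inner_zero_left)
  define B where "B = \<bar>B1\<bar> + \<bar>B2\<bar> + 1"
  have B: "0 < B" "\<bar>\<psi> x\<bar> \<le> B" "\<bar>grad \<psi> x \<bullet> b\<bar> \<le> B" for x
    using B1[of x] B2[of x] by (auto simp: B_def)
  have \<Omega>s: "\<Omega> \<in> sets borel" using \<Omega> by simp
  define X where "X = (LINT x:\<Omega>|lborel. u x * (grad \<psi> x \<bullet> b)) + (LINT x:\<Omega>|lborel. (g x \<bullet> b) * \<psi> x)"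
  have "\<bar>X\<bar> \<le> 0"
  proof (rule field_le_epsilon)
    fix e :: real assume e: "0 < e"
    define \<eta> where "\<eta> = e / (2 * B)"
    have \<eta>: "0 < \<eta>" using e B by (simp add: \<eta>_def)
    obtain e1 where e1: "0 < e1" "\<And>f :: 'a \<Rightarrow> real. in_Lp lborel p f \<Longrightarrow> (\<And>x. x \<notin> \<Omega> \<Longrightarrow> f x = 0) \<Longrightarrow>
       (LINT x|lborel. norm (f x) powr p) < e1 \<Longrightarrow> (LINT x|lborel. norm (f x)) < \<eta>"
      using Lp_small_imp_L1_small[OF \<Omega>(2) \<Omega>s p \<eta>] by blast
    obtain e2 where e2: "0 < e2" "\<And>f :: 'a \<Rightarrow> 'a. in_Lp lborel p f \<Longrightarrow> (\<And>x. x \<notin> \<Omega> \<Longrightarrow> f x = 0) \<Longrightarrow>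
       (LINT x|lborel. norm (f x) powr p) < e2 \<Longrightarrow> (LINT x|lborel. norm (f x)) < \<eta>"
      using Lp_small_imp_L1_small[OF \<Omega>(2) \<Omega>s p \<eta>] by blast
    obtain \<phi> where \<phi>: "\<phi> \<in> test_functions \<Omega>"
      "(LINT x|lborel. \<bar>u x - \<phi> x\<bar> powr p) + (LINT x|lborel. norm (g x - grad \<phi> x) powr p) < min e1 e2"
    proof -
      have "0 < min e1 e2" using e1(1) e2(1) by simp
      then show ?thesis using ug that unfolding sobolev_pair_def by blast
    qed
    have L\<phi>: "in_Lp lborel p (\<lambda>x. u x - \<phi> x)" "in_Lp lborel p (\<lambda>x. g x - grad \<phi> x)"
      using in_Lp_diff[OF L(1) test_function_in_Lp[OF \<phi>(1)] p] in_Lp_diff[OF L(2) test_function_grad_in_Lp[OF \<phi>(1)] p] p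
      by simp_all
    have z\<phi>: "u x - \<phi> x = 0" "g x - grad \<phi> x = 0" if "x \<notin> \<Omega>" for x
      using that z test_function_zero_outside[OF \<phi>(1)] test_function_grad_zero_outside[OF \<phi>(1)] by auto
    have pos: "0 \<le> (LINT x|lborel. \<bar>u x - \<phi> x\<bar> powr p)" "0 \<le> (LINT x|lborel. norm (g x - grad \<phi> x) powr p)"
      by auto
    have s1: "(LINT x|lborel. norm (u x - \<phi> x)) < \<eta>"
    proof (rule e1(2)[OF L\<phi>(1) z\<phi>(1)])
      show "(LINT x|lborel. norm (u x - \<phi> x) powr p) < e1"
        using \<phi>(2) pos unfolding real_norm_def by linarith
    qed
    have s2: "(LINT x|lborel. norm (g x - grad \<phi> x)) < \<eta>"
    proof (rule e2(2)[OF L\<phi>(2) z\<phi>(2)])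
      show "(LINT x|lborel. norm (g x - grad \<phi> x) powr p) < e2"
        using \<phi>(2) pos by linarith
    qed
    have iu: "integrable lborel (\<lambda>x. u x - \<phi> x)" "integrable lborel (\<lambda>x. g x - grad \<phi> x)"
    proof -
      obtain R where R: "\<Omega> \<subseteq> cball 0 R" using bounded_subset_ballD[OF \<Omega>(2), of 0] ball_subset_cball[of 0] by (meson subset_trans)
      have *: "integrable lborel f" if "in_Lp lborel p f" "\<And>x. x \<notin> \<Omega> \<Longrightarrow> f x = 0" for f :: "'a \<Rightarrow> 'c::euclidean_space"
      proof -
        have "integrable lborel (\<lambda>x. indicator (cball 0 R) x *\<^sub>R f x)"
          using in_Lp_loc_integrable[OF that(1) p, of UNIV] by (auto simp: loc_integrable_def set_integrable_def)
        also have "(\<lambda>x. indicator (cball 0 R) x *\<^sub>R f x) = f"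
        proof
          show "indicator (cball 0 R) x *\<^sub>R f x = f x" for x
            using that(2)[of x] R by (cases "x \<in> \<Omega>") (auto simp: indicator_def)
        qed
        finally show ?thesis .
      qed
      show "integrable lborel (\<lambda>x. u x - \<phi> x)" "integrable lborel (\<lambda>x. g x - grad \<phi> x)"
        using * L\<phi> z\<phi> by blast+
    qed
    note w\<phi> = test_function_weak_gradient[OF \<phi>(1)]
    have wu: "set_integrable lborel \<Omega> (\<lambda>x. u x * (grad \<psi> x \<bullet> b))" "set_integrable lborel \<Omega> (\<lambda>x. (g x \<bullet> b) * \<psi> x)"
      using K c\<psi> li by (auto intro!: set_integrable_loc_mult[of _ _ K] loc_integrable_inner)
    have X: "X = (LINT x:\<Omega>|lborel. (u x - \<phi> x) * (grad \<psi> x \<bullet> b)) + (LINT x:\<Omega>|lborel. ((g x - grad \<phi> x) \<bullet> b) * \<psi> x)"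
      using wu has_weak_gradient_integrable[OF w\<phi> \<psi>, of b] has_weak_gradient_eq[OF w\<phi> \<psi> b]
      by (simp add: X_def left_diff_distrib inner_diff_left set_integral_diff(2))
    have I1: "\<bar>LINT x:\<Omega>|lborel. (u x - \<phi> x) * (grad \<psi> x \<bullet> b)\<bar> \<le> (LINT x|lborel. B * norm (u x - \<phi> x))"
    proof (rule abs_set_integral_le)
      show "integrable lborel (\<lambda>x. B * norm (u x - \<phi> x))"
        using iu(1) by (intro integrable_mult_right integrable_norm)
      show "\<bar>(u x - \<phi> x) * (grad \<psi> x \<bullet> b)\<bar> \<le> B * norm (u x - \<phi> x)" for x
        using mult_left_mono[OF B(3)[of x] abs_ge_zero[of "u x - \<phi> x"]] by (simp add: abs_mult mult.commute[of B])
    qed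
    have I2: "\<bar>LINT x:\<Omega>|lborel. ((g x - grad \<phi> x) \<bullet> b) * \<psi> x\<bar> \<le> (LINT x|lborel. B * norm (g x - grad \<phi> x))"
    proof (rule abs_set_integral_le)
      show "integrable lborel (\<lambda>x. B * norm (g x - grad \<phi> x))"
        using iu(2) by (intro integrable_mult_right integrable_norm)
      show "\<bar>((g x - grad \<phi> x) \<bullet> b) * \<psi> x\<bar> \<le> B * norm (g x - grad \<phi> x)" for x
        using mult_mono[OF Basis_le_norm[OF b, of "g x - grad \<phi> x"] B(2)[of x] norm_ge_zero abs_ge_zero]
        by (simp add: abs_mult mult.commute[of B])
    qed
    have "\<bar>X\<bar> \<le> (LINT x|lborel. B * norm (u x - \<phi> x)) + (LINT x|lborel. B * norm (g x - grad \<phi> x))"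
      unfolding X by (rule order.trans[OF abs_triangle_ineq add_mono[OF I1 I2]])
    also have "(LINT x|lborel. B * norm (u x - \<phi> x)) + (LINT x|lborel. B * norm (g x - grad \<phi> x)) \<le> B * \<eta> + B * \<eta>"
      unfolding integral_mult_right_zero using s1 s2 B(1) by (intro add_mono mult_left_mono) simp_all
    also have "\<dots> = 0 + e" using B(1) by (simp add: \<eta>_def)
    finally show "\<bar>X\<bar> \<le> 0 + e" by simp
  qed
  then show "(LINT x:\<Omega>|lborel. u x * (grad \<psi> x \<bullet> b)) = - (LINT x:\<Omega>|lborel. (g x \<bullet> b) * \<psi> x)"
    by (simp add: X_def)
qed

section \<open>The Sobolev space and the energy\<close>

text \<open>Uniqueness of weak gradients replaces the gradient selected for the difference by the
  difference of given gradients; this makes the norm in the definition of \<open>W1p0\<close>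
  computable.\<close>

lemma W1p_norm_diff_test_function:
  assumes "open \<Omega>" "0 < p" "has_weak_gradient \<Omega> u g" "\<phi> \<in> test_functions \<Omega>" "\<And>x. x \<notin> \<Omega> \<Longrightarrow> u x = 0"
  shows "W1p_norm \<Omega> p (\<lambda>x. u x - \<phi> x) =
    ((LINT x|lborel. \<bar>u x - \<phi> x\<bar> powr p) + (LINT x|lborel. norm (indicator \<Omega> x *\<^sub>R g x - grad \<phi> x) powr p)) powr (1 / p)"
proof -
  have w: "has_weak_gradient \<Omega> (\<lambda>x. u x - \<phi> x) (\<lambda>x. g x - grad \<phi> x)"
    by (rule has_weak_gradient_diff[OF assms(3) test_function_weak_gradient[OF assms(4)]])
  have e: "indicator \<Omega> x *\<^sub>R (g x - grad \<phi> x) = indicator \<Omega> x *\<^sub>R g x - grad \<phi> x" for x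
    using test_function_grad_zero_outside[OF assms(4)] by (auto simp: indicator_def)
  have [measurable]: "wgrad \<Omega> (\<lambda>x. u x - \<phi> x) \<in> borel_measurable borel"
    "(\<lambda>x. indicator \<Omega> x *\<^sub>R g x - grad \<phi> x) \<in> borel_measurable borel"
    using wgrad_AE_eq(2)[OF assms(1) w] loc_integrable_measurable[OF assms(1), of "\<lambda>x. g x - grad \<phi> x"] w
    by (auto simp: has_weak_gradient_def e)
  have "(LINT x|lborel. norm (wgrad \<Omega> (\<lambda>x. u x - \<phi> x) x) powr p) = (LINT x|lborel. norm (indicator \<Omega> x *\<^sub>R g x - grad \<phi> x) powr p)"
    using wgrad_AE_eq(3)[OF assms(1) w] by (intro integral_cong_AE) (auto simp: e)
  moreover have "(LINT x:\<Omega>|lborel. \<bar>u x - \<phi> x\<bar> powr p) = (LINT x|lborel. \<bar>u x - \<phi> x\<bar> powr p)"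
    unfolding set_lebesgue_integral_def
    using assms(5) test_function_zero_outside[OF assms(4)]
    by (intro Bochner_Integration.integral_cong) (auto simp: indicator_def)
  ultimately show ?thesis by (simp add: W1p_norm_def wgrad_powr[OF assms(2)])
qed

lemma Lp_space_iff:
  fixes f :: "'a::euclidean_space \<Rightarrow> 'b::euclidean_space"
  shows "f \<in> Lp_space \<Omega> p \<longleftrightarrow> in_Lp lborel p (\<lambda>x. indicator \<Omega> x *\<^sub>R f x)"
proof -
  have "(\<lambda>x. indicator \<Omega> x *\<^sub>R norm (f x) powr p) = (\<lambda>x. norm (indicator \<Omega> x *\<^sub>R f x) powr p)"
    by (auto simp: indicator_def fun_eq_iff)
  then show ?thesis
    unfolding Lp_space_def in_Lp_def set_borel_measurable_def set_integrable_def by simp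
qed

lemma W1p0_imp_sobolev_pair:
  assumes "open \<Omega>" "0 < p" "u \<in> W1p0 \<Omega> p"
  shows "sobolev_pair \<Omega> p u (wgrad \<Omega> u)"
proof -
  obtain g where u: "u \<in> Lp_space \<Omega> p" and z: "\<And>x. x \<notin> \<Omega> \<Longrightarrow> u x = 0"
    and g: "g \<in> Lp_space \<Omega> p" "has_weak_gradient \<Omega> u g"
    and a: "\<And>e. 0 < e \<Longrightarrow> \<exists>\<phi>\<in>test_functions \<Omega>. W1p_norm \<Omega> p (\<lambda>x. u x - \<phi> x) < e"
    using assms(3) unfolding W1p0_def W1p_def by blast
  have ue: "(\<lambda>x. indicator \<Omega> x *\<^sub>R u x) = u" using z by (auto simp: indicator_def fun_eq_iff)
  note w = wgrad_AE_eq[OF assms(1) g(2)]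
  have "in_Lp lborel p (wgrad \<Omega> u)"
  proof (rule in_Lp_cong_AE)
    show "in_Lp lborel p (\<lambda>x. indicator \<Omega> x *\<^sub>R g x)" using g(1) by (simp only: Lp_space_iff)
    show "wgrad \<Omega> u \<in> borel_measurable lborel" using w(2) by simp
    show "AE x in lborel. indicator \<Omega> x *\<^sub>R g x = wgrad \<Omega> u x" using w(3) by eventually_elim simp
  qed
  moreover have "\<exists>\<phi>\<in>test_functions \<Omega>. (LINT x|lborel. \<bar>u x - \<phi> x\<bar> powr p) + (LINT x|lborel. norm (wgrad \<Omega> u x - grad \<phi> x) powr p) < e"
    if e: "0 < e" for e
  proof -
    obtain \<phi> where \<phi>: "\<phi> \<in> test_functions \<Omega>" "W1p_norm \<Omega> p (\<lambda>x. u x - \<phi> x) < e powr (1 / p)"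
      using a[of "e powr (1 / p)"] e by auto
    let ?N = "(LINT x|lborel. \<bar>u x - \<phi> x\<bar> powr p) + (LINT x|lborel. norm (wgrad \<Omega> u x - grad \<phi> x) powr p)"
    have "?N powr (1 / p) < e powr (1 / p)"
      using \<phi>(2) W1p_norm_diff_test_function[OF assms(1,2) w(1) \<phi>(1) z] by (simp add: wgrad_def)
    then have "\<not> e \<le> ?N" using powr_mono2[of "1 / p" e ?N] e assms(2) by auto
    then show ?thesis using \<phi>(1) by (auto simp: not_le)
  qed
  ultimately show ?thesis
    using u z unfolding Lp_space_iff ue by (auto simp: sobolev_pair_def wgrad_def)
qed

lemma sobolev_pair_imp_W1p0:
  assumes "open \<Omega>" "bounded \<Omega>" "1 \<le> p" "sobolev_pair \<Omega> p u g"
  shows "u \<in> W1p0 \<Omega> p" "AE x in lborel. wgrad \<Omega> u x = g x"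
proof -
  have L: "in_Lp lborel p u" "in_Lp lborel p g" and z: "\<And>x. x \<notin> \<Omega> \<Longrightarrow> u x = 0" "\<And>x. x \<notin> \<Omega> \<Longrightarrow> g x = 0"
    and a: "\<And>e. 0 < e \<Longrightarrow> \<exists>\<phi>\<in>test_functions \<Omega>. (LINT x|lborel. \<bar>u x - \<phi> x\<bar> powr p) + (LINT x|lborel. norm (g x - grad \<phi> x) powr p) < e"
    using assms(4) by (auto simp: sobolev_pair_def)
  have p: "0 < p" using assms(3) by simp
  have w: "has_weak_gradient \<Omega> u g" by (rule sobolev_pair_weak_gradient[OF assms])
  have ue: "(\<lambda>x. indicator \<Omega> x *\<^sub>R u x) = u" and ge: "(\<lambda>x. indicator \<Omega> x *\<^sub>R g x) = g"
    using z by (auto simp: indicator_def fun_eq_iff)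
  show "AE x in lborel. wgrad \<Omega> u x = g x" using wgrad_AE_eq(3)[OF assms(1) w] ge by (simp add: fun_eq_iff)
  have "\<exists>\<phi>\<in>test_functions \<Omega>. W1p_norm \<Omega> p (\<lambda>x. u x - \<phi> x) < e" if e: "0 < e" for e
  proof -
    obtain \<phi> where \<phi>: "\<phi> \<in> test_functions \<Omega>"
      "(LINT x|lborel. \<bar>u x - \<phi> x\<bar> powr p) + (LINT x|lborel. norm (g x - grad \<phi> x) powr p) < e powr p"
      using a[of "e powr p"] e by auto
    have "W1p_norm \<Omega> p (\<lambda>x. u x - \<phi> x) = ((LINT x|lborel. \<bar>u x - \<phi> x\<bar> powr p) + (LINT x|lborel. norm (g x - grad \<phi> x) powr p)) powr (1 / p)"
      using W1p_norm_diff_test_function[OF assms(1) p w \<phi>(1) z(1)] ge by (simp add: fun_eq_iff)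
    also have "\<dots> < (e powr p) powr (1 / p)"
      using \<phi>(2) p by (intro powr_less_mono2) auto
    also have "\<dots> = e" using e p by (simp add: powr_powr)
    finally show ?thesis using \<phi>(1) by blast
  qed
  moreover have "u \<in> Lp_space \<Omega> p" "g \<in> Lp_space \<Omega> p" using L unfolding Lp_space_iff ue ge by auto
  ultimately show "u \<in> W1p0 \<Omega> p" using z w unfolding W1p0_def W1p_def by blast
qed

lemma sobolev_pairD:
  assumes "sobolev_pair \<Omega> p u g"
  shows "in_Lp lborel p u" "in_Lp lborel p g" "x \<notin> \<Omega> \<Longrightarrow> u x = 0" "x \<notin> \<Omega> \<Longrightarrow> g x = 0"
  using assms by (auto simp: sobolev_pair_def)

lemma sobolev_pair_approx:
  assumes "sobolev_pair \<Omega> p u g" "0 < e"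
  obtains \<phi> where "\<phi> \<in> test_functions \<Omega>"
    "(LINT x|lborel. \<bar>u x - \<phi> x\<bar> powr p) + (LINT x|lborel. norm (g x - grad \<phi> x) powr p) < e"
  using assms by (auto simp: sobolev_pair_def)

text \<open>Being near members of the space is enough in place of being near test functions; this is
  how limits of minimizing sequences are recognized as members.\<close>

lemma sobolev_pair_closed:
  assumes p: "1 \<le> p" and L: "in_Lp lborel p u" "in_Lp lborel p g" "\<And>x. x \<notin> \<Omega> \<Longrightarrow> u x = 0 \<and> g x = 0"
    and a: "\<And>e. 0 < e \<Longrightarrow> \<exists>v h. sobolev_pair \<Omega> p v h \<and>
      (LINT x|lborel. \<bar>u x - v x\<bar> powr p) + (LINT x|lborel. norm (g x - h x) powr p) < e"
  shows "sobolev_pair \<Omega> p u g"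
proof -
  have "\<exists>\<phi>\<in>test_functions \<Omega>. (LINT x|lborel. \<bar>u x - \<phi> x\<bar> powr p) + (LINT x|lborel. norm (g x - grad \<phi> x) powr p) < e"
    if e: "0 < e" for e
  proof -
    define c where "c = (2::real) powr (p - 1)"
    have c: "0 < c" by (simp add: c_def)
    obtain v h where v: "sobolev_pair \<Omega> p v h"
      "(LINT x|lborel. \<bar>u x - v x\<bar> powr p) + (LINT x|lborel. norm (g x - h x) powr p) < e / (2 * c)"
      using a[of "e / (2 * c)"] e c by auto
    obtain \<phi> where \<phi>: "\<phi> \<in> test_functions \<Omega>"
      "(LINT x|lborel. \<bar>v x - \<phi> x\<bar> powr p) + (LINT x|lborel. norm (h x - grad \<phi> x) powr p) < e / (2 * c)"
      using sobolev_pair_approx[OF v(1), of "e / (2 * c)"] e c by auto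
    note vL = sobolev_pairD[OF v(1)] and \<phi>L = test_function_in_Lp[OF \<phi>(1), of p] test_function_grad_in_Lp[OF \<phi>(1), of p]
    have p0: "0 \<le> p" using p by simp
    have "(LINT x|lborel. norm ((u x - v x) + (v x - \<phi> x)) powr p) \<le> c * ((LINT x|lborel. norm (u x - v x) powr p) + (LINT x|lborel. norm (v x - \<phi> x) powr p))"
      unfolding c_def by (rule Lp_integral_add_le[OF in_Lp_diff[OF L(1) vL(1) p] in_Lp_diff[OF vL(1) \<phi>L(1)[OF p0] p] p])
    moreover have "(LINT x|lborel. norm ((g x - h x) + (h x - grad \<phi> x)) powr p) \<le> c * ((LINT x|lborel. norm (g x - h x) powr p) + (LINT x|lborel. norm (h x - grad \<phi> x) powr p))"
      unfolding c_def by (rule Lp_integral_add_le[OF in_Lp_diff[OF L(2) vL(2) p] in_Lp_diff[OF vL(2) \<phi>L(2)[OF p0] p] p])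
    moreover have "c * ((LINT x|lborel. \<bar>u x - v x\<bar> powr p) + (LINT x|lborel. norm (g x - h x) powr p)) < e / 2"
      using mult_strict_left_mono[OF v(2) c] c by simp
    moreover have "c * ((LINT x|lborel. \<bar>v x - \<phi> x\<bar> powr p) + (LINT x|lborel. norm (h x - grad \<phi> x) powr p)) < e / 2"
      using mult_strict_left_mono[OF \<phi>(2) c] c by simp
    ultimately have "(LINT x|lborel. \<bar>u x - \<phi> x\<bar> powr p) + (LINT x|lborel. norm (g x - grad \<phi> x) powr p) < e"
      by (simp add: distrib_left)
    then show ?thesis using \<phi>(1) by blast
  qed
  then show ?thesis using L by (auto simp: sobolev_pair_def)
qed

lemma sobolev_pair_cmult:
  assumes p: "1 \<le> p" and u: "sobolev_pair \<Omega> p u g"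
  shows "sobolev_pair \<Omega> p (\<lambda>x. c * u x) (\<lambda>x. c *\<^sub>R g x)"
  unfolding sobolev_pair_def
proof (intro conjI allI impI)
  note uL = sobolev_pairD[OF u]
  show "in_Lp lborel p (\<lambda>x. c * u x)" using in_Lp_scaleR[OF uL(1), of c] by simp
  show "in_Lp lborel p (\<lambda>x. c *\<^sub>R g x)" by (rule in_Lp_scaleR[OF uL(2)])
  show "c * u x = 0" "c *\<^sub>R g x = 0" if "x \<notin> \<Omega>" for x using uL(3,4)[OF that] by auto
  fix e :: real assume e: "0 < e"
  \<comment> \<open>The added 1 keeps \<open>k\<close> positive when \<open>c = 0\<close>.\<close>
  define k where "k = \<bar>c\<bar> powr p + 1"
  have k: "0 < k" by (simp add: k_def add_nonneg_pos)
  obtain \<phi> where \<phi>: "\<phi> \<in> test_functions \<Omega>"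
    "(LINT x|lborel. \<bar>u x - \<phi> x\<bar> powr p) + (LINT x|lborel. norm (g x - grad \<phi> x) powr p) < e / k"
    using sobolev_pair_approx[OF u, of "e / k"] e k by auto
  have gr: "grad (\<lambda>x. c * \<phi> x) x = c *\<^sub>R grad \<phi> x" for x
    by (intro grad_eqI) (auto intro!: derivative_eq_intros \<phi>(1)[THEN test_function_has_derivative])
  have "(LINT x|lborel. \<bar>c * u x - c * \<phi> x\<bar> powr p) + (LINT x|lborel. norm (c *\<^sub>R g x - grad (\<lambda>x. c * \<phi> x) x) powr p)
     = \<bar>c\<bar> powr p * ((LINT x|lborel. \<bar>u x - \<phi> x\<bar> powr p) + (LINT x|lborel. norm (g x - grad \<phi> x) powr p))"
    unfolding gr by (simp add: abs_mult powr_mult distrib_left flip: right_diff_distrib scaleR_right_diff_distrib)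
  also have "\<dots> \<le> k * ((LINT x|lborel. \<bar>u x - \<phi> x\<bar> powr p) + (LINT x|lborel. norm (g x - grad \<phi> x) powr p))"
    by (intro mult_right_mono) (auto simp: k_def)
  also have "\<dots> < k * (e / k)" by (rule mult_strict_left_mono[OF \<phi>(2) k])
  also have "\<dots> = e" using k by simp
  finally show "\<exists>\<phi>\<in>test_functions \<Omega>. (LINT x|lborel. \<bar>c * u x - \<phi> x\<bar> powr p) + (LINT x|lborel. norm (c *\<^sub>R g x - grad \<phi> x) powr p) < e"
    by (rule bexI[OF _ test_function_cmult[OF \<phi>(1)]])
qed

lemma sobolev_pair_add:
  assumes p: "1 \<le> p" and u: "sobolev_pair \<Omega> p u g" and v: "sobolev_pair \<Omega> p v h"
  shows "sobolev_pair \<Omega> p (\<lambda>x. u x + v x) (\<lambda>x. g x + h x)"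
  unfolding sobolev_pair_def
proof (intro conjI allI impI)
  note uL = sobolev_pairD[OF u] and vL = sobolev_pairD[OF v]
  show "in_Lp lborel p (\<lambda>x. u x + v x)" "in_Lp lborel p (\<lambda>x. g x + h x)"
    using in_Lp_add[OF uL(1) vL(1) p] in_Lp_add[OF uL(2) vL(2) p] by auto
  show "u x + v x = 0" "g x + h x = 0" if "x \<notin> \<Omega>" for x using uL(3,4)[OF that] vL(3,4)[OF that] by auto
  fix e :: real assume e: "0 < e"
  define c where "c = (2::real) powr (p - 1)"
  have c: "0 < c" by (simp add: c_def)
  obtain \<phi> where \<phi>: "\<phi> \<in> test_functions \<Omega>"
    "(LINT x|lborel. \<bar>u x - \<phi> x\<bar> powr p) + (LINT x|lborel. norm (g x - grad \<phi> x) powr p) < e / (2 * c)"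
    using sobolev_pair_approx[OF u, of "e / (2 * c)"] e c by auto
  obtain \<psi> where \<psi>: "\<psi> \<in> test_functions \<Omega>"
    "(LINT x|lborel. \<bar>v x - \<psi> x\<bar> powr p) + (LINT x|lborel. norm (h x - grad \<psi> x) powr p) < e / (2 * c)"
    using sobolev_pair_approx[OF v, of "e / (2 * c)"] e c by auto
  have p0: "0 \<le> p" using p by simp
  note \<phi>L = test_function_in_Lp[OF \<phi>(1) p0] test_function_grad_in_Lp[OF \<phi>(1) p0]
  note \<psi>L = test_function_in_Lp[OF \<psi>(1) p0] test_function_grad_in_Lp[OF \<psi>(1) p0]
  have gr: "grad (\<lambda>x. \<phi> x + \<psi> x) x = grad \<phi> x + grad \<psi> x" for x
    by (intro grad_eqI)
       (auto intro!: derivative_eq_intros \<phi>(1)[THEN test_function_has_derivative] \<psi>(1)[THEN test_function_has_derivative] simp: inner_add_left)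
  have "(LINT x|lborel. norm ((u x - \<phi> x) + (v x - \<psi> x)) powr p) \<le> c * ((LINT x|lborel. norm (u x - \<phi> x) powr p) + (LINT x|lborel. norm (v x - \<psi> x) powr p))"
    unfolding c_def by (rule Lp_integral_add_le[OF in_Lp_diff[OF uL(1) \<phi>L(1) p] in_Lp_diff[OF vL(1) \<psi>L(1) p] p])
  moreover have "(LINT x|lborel. norm ((g x - grad \<phi> x) + (h x - grad \<psi> x)) powr p) \<le> c * ((LINT x|lborel. norm (g x - grad \<phi> x) powr p) + (LINT x|lborel. norm (h x - grad \<psi> x) powr p))"
    unfolding c_def by (rule Lp_integral_add_le[OF in_Lp_diff[OF uL(2) \<phi>L(2) p] in_Lp_diff[OF vL(2) \<psi>L(2) p] p])
  moreover have "c * ((LINT x|lborel. \<bar>u x - \<phi> x\<bar> powr p) + (LINT x|lborel. norm (g x - grad \<phi> x) powr p)) < e / 2"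
    using mult_strict_left_mono[OF \<phi>(2) c] c by simp
  moreover have "c * ((LINT x|lborel. \<bar>v x - \<psi> x\<bar> powr p) + (LINT x|lborel. norm (h x - grad \<psi> x) powr p)) < e / 2"
    using mult_strict_left_mono[OF \<psi>(2) c] c by simp
  moreover have "(u x - \<phi> x) + (v x - \<psi> x) = u x + v x - (\<phi> x + \<psi> x)"
      "(g x - grad \<phi> x) + (h x - grad \<psi> x) = g x + h x - grad (\<lambda>x. \<phi> x + \<psi> x) x" for x
    by (auto simp: gr)
  ultimately have "(LINT x|lborel. \<bar>u x + v x - (\<phi> x + \<psi> x)\<bar> powr p) + (LINT x|lborel. norm (g x + h x - grad (\<lambda>x. \<phi> x + \<psi> x) x) powr p) < e"
    by (simp add: distrib_left)
  then show "\<exists>\<phi>\<in>test_functions \<Omega>. (LINT x|lborel. \<bar>u x + v x - \<phi> x\<bar> powr p) + (LINT x|lborel. norm (g x + h x - grad \<phi> x) powr p) < e"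
    by (rule bexI[OF _ test_function_add[OF \<phi>(1) \<psi>(1)]])
qed

lemma sobolev_pair_diff:
  assumes p: "1 \<le> p" and u: "sobolev_pair \<Omega> p u g" and v: "sobolev_pair \<Omega> p v h"
  shows "sobolev_pair \<Omega> p (\<lambda>x. u x - v x) (\<lambda>x. g x - h x)"
  using sobolev_pair_add[OF p u sobolev_pair_cmult[OF p v, of "-1"]] by simp

text \<open>Approximating test functions converge almost everywhere along a subsequence, so Fatou's
  lemma transports their bound; the approximation error \<open>e\<close> is sent to 0 at the end.
  This also shows that the seminorm is a genuine finite integral on the Sobolev space.\<close>

lemma gagliardo_sobolev_bound:
  fixes p t :: real
  assumes p: "1 \<le> p" and t: "0 < t" "t < 1"
  obtains C where "0 \<le> C" "\<And>\<Omega> (u :: 'a::euclidean_space \<Rightarrow> real) g. sobolev_pair \<Omega> p u g \<Longrightarrow>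
      in_Lp (lborel \<Otimes>\<^sub>M lborel) p (gag_quot p t u) \<and>
      gagliardo_pow p t u \<le> C * ((LINT x|lborel. \<bar>u x\<bar> powr p) + (LINT x|lborel. norm (g x) powr p))"
proof -
  obtain C where C: "0 \<le> C" "\<And>\<Omega> (\<phi> :: 'a \<Rightarrow> real). \<phi> \<in> test_functions \<Omega> \<Longrightarrow>
      in_Lp (lborel \<Otimes>\<^sub>M lborel) p (gag_quot p t \<phi>) \<and>
      gagliardo_pow p t \<phi> \<le> C * ((LINT x|lborel. \<bar>\<phi> x\<bar> powr p) + (LINT x|lborel. norm (grad \<phi> x) powr p))"
    using gagliardo_test_function_bound[OF p t] by blast
  define c where "c = (2::real) powr (p - 1)"
  have c: "0 < c" by (simp add: c_def)
  show ?thesis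
  proof (rule that)
    show "0 \<le> C * c" using C c by simp
    fix \<Omega> and u :: "'a \<Rightarrow> real" and g assume u: "sobolev_pair \<Omega> p u g"
    note uL = sobolev_pairD[OF u]
    define N where "N = (LINT x|lborel. \<bar>u x\<bar> powr p) + (LINT x|lborel. norm (g x) powr p)"
    have key: "in_Lp (lborel \<Otimes>\<^sub>M lborel) p (gag_quot p t u) \<and> gagliardo_pow p t u \<le> C * (c * (N + e))" if e: "0 < e" for e
    proof -
      have "\<exists>\<phi>. \<forall>n. \<phi> n \<in> test_functions \<Omega> \<and>
         (LINT x|lborel. \<bar>u x - \<phi> n x\<bar> powr p) + (LINT x|lborel. norm (g x - grad (\<phi> n) x) powr p) < min e (inverse (real (Suc n)))"
      proof (intro choice allI)
        fix n
        have "0 < min e (inverse (real (Suc n)))" using e by simp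
        then show "\<exists>\<phi>. \<phi> \<in> test_functions \<Omega> \<and> (LINT x|lborel. \<bar>u x - \<phi> x\<bar> powr p) + (LINT x|lborel. norm (g x - grad \<phi> x) powr p) < min e (inverse (real (Suc n)))"
          using sobolev_pair_approx[OF u] by metis
      qed
      then obtain \<phi> where \<phi>: "\<And>n. \<phi> n \<in> test_functions \<Omega>"
         "\<And>n. (LINT x|lborel. \<bar>u x - \<phi> n x\<bar> powr p) + (LINT x|lborel. norm (g x - grad (\<phi> n) x) powr p) < min e (inverse (real (Suc n)))"
        by blast
      have p0: "0 \<le> p" using p by simp
      note \<phi>L = test_function_in_Lp[OF \<phi>(1) p0] test_function_grad_in_Lp[OF \<phi>(1) p0]
      have pos: "0 \<le> (LINT x|lborel. \<bar>u x - \<phi> n x\<bar> powr p)" "0 \<le> (LINT x|lborel. norm (g x - grad (\<phi> n) x) powr p)" for n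
        by auto
      have "(\<lambda>n. LINT x|lborel. norm (\<phi> n x - u x) powr p) \<longlonglongrightarrow> 0"
      proof (rule Lim_null_comparison[OF _ LIMSEQ_inverse_real_of_nat])
        show "\<forall>\<^sub>F n in sequentially. norm (LINT x|lborel. norm (\<phi> n x - u x) powr p) \<le> inverse (real (Suc n))"
        proof (intro always_eventually allI)
          fix n
          have "(LINT x|lborel. \<bar>u x - \<phi> n x\<bar> powr p) \<le> inverse (real (Suc n))" using \<phi>(2)[of n] pos[of n] by linarith
          then show "norm (LINT x|lborel. norm (\<phi> n x - u x) powr p) \<le> inverse (real (Suc n))"
            using pos(1)[of n] by (simp add: abs_minus_commute)
        qed
      qed
      then obtain r :: "nat \<Rightarrow> nat" where r: "strict_mono r" "AE x in lborel. (\<lambda>n. \<phi> (r n) x) \<longlonglongrightarrow> u x"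
        using Lp_tendsto_AE_subseq[of lborel p \<phi> u, OF \<phi>L(1) uL(1) p] by blast
      have b: "gagliardo_pow p t (\<phi> n) \<le> C * (c * (N + e))" for n
      proof -
        have "(LINT x|lborel. norm (u x - (u x - \<phi> n x)) powr p) \<le> c * ((LINT x|lborel. norm (u x) powr p) + (LINT x|lborel. norm (u x - \<phi> n x) powr p))"
          unfolding c_def by (rule Lp_integral_diff_le[OF uL(1) in_Lp_diff[OF uL(1) \<phi>L(1) p] p])
        moreover have "(LINT x|lborel. norm (g x - (g x - grad (\<phi> n) x)) powr p) \<le> c * ((LINT x|lborel. norm (g x) powr p) + (LINT x|lborel. norm (g x - grad (\<phi> n) x) powr p))"
          unfolding c_def by (rule Lp_integral_diff_le[OF uL(2) in_Lp_diff[OF uL(2) \<phi>L(2) p] p])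
        moreover have "c * ((LINT x|lborel. \<bar>u x - \<phi> n x\<bar> powr p) + (LINT x|lborel. norm (g x - grad (\<phi> n) x) powr p)) \<le> c * e"
          using \<phi>(2)[of n] c by (intro mult_left_mono) auto
        ultimately have "(LINT x|lborel. \<bar>\<phi> n x\<bar> powr p) + (LINT x|lborel. norm (grad (\<phi> n) x) powr p) \<le> c * (N + e)"
          by (simp add: N_def distrib_left)
        then show ?thesis using C(2)[OF \<phi>(1)[of n]] C(1) by (meson mult_left_mono order_trans)
      qed
      show ?thesis
        using gagliardo_fatou[of p t "\<lambda>n. \<phi> (r n)" u "C * (c * (N + e))"] C(2)[OF \<phi>(1)] uL(1) p r(2) b
        by (auto simp: in_Lp_def)
    qed
    have "gagliardo_pow p t u \<le> C * c * N"
    proof (rule tendsto_lowerbound)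
      show "((\<lambda>e. C * (c * (N + e))) \<longlongrightarrow> C * c * N) (at_right 0)"
        by (auto intro!: tendsto_eq_intros)
      show "\<forall>\<^sub>F e in at_right 0. gagliardo_pow p t u \<le> C * (c * (N + e))"
        using key by (intro eventually_at_right_less[THEN eventually_mono]) auto
    qed simp
    then show "in_Lp (lborel \<Otimes>\<^sub>M lborel) p (gag_quot p t u) \<and>
      gagliardo_pow p t u \<le> C * c * ((LINT x|lborel. \<bar>u x\<bar> powr p) + (LINT x|lborel. norm (g x) powr p))"
      using key[of 1] by (simp add: N_def)
  qed
qed

lemma gag_quot_in_Lp:
  assumes "sobolev_pair \<Omega> p u g" "1 \<le> p" "0 < t" "t < 1"
  shows "in_Lp (lborel \<Otimes>\<^sub>M lborel) p (gag_quot p t u)"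
  using gagliardo_sobolev_bound[OF assms(2-4)] assms(1) by metis

text \<open>The share of one component in \<open>E\<close>. The gradient is a separate argument, so
  that linear operations act on it without passing through the choice in
  \<open>weak_gradient\<close>.\<close>

definition energy :: "real \<Rightarrow> real \<Rightarrow> ('a::euclidean_space \<Rightarrow> real) \<Rightarrow> ('a \<Rightarrow> 'a) \<Rightarrow> real" where
  "energy p t u g = (LINT x|lborel. norm (g x) powr p) + gagliardo_pow p t u"

lemma gagliardo_pow_nonneg: "0 \<le> gagliardo_pow p t u"
  unfolding gagliardo_pow_def by (intro integral_nonneg_AE AE_I2) auto

lemma energy_nonneg: "0 \<le> energy p t u g"
  by (simp add: energy_def gagliardo_pow_nonneg)

lemma energy_cmult:
  assumes "0 < p"
  shows "energy p t (\<lambda>x. c * u x) (\<lambda>x. c *\<^sub>R g x) = \<bar>c\<bar> powr p * energy p t u g"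
  using assms by (simp add: energy_def gagliardo_pow_eq gag_quot_cmult[abs_def] powr_mult abs_mult distrib_left)

lemma energy_clarkson:
  assumes p: "2 \<le> p" and t: "0 < t" "t < 1" and u: "sobolev_pair \<Omega> p u g" and v: "sobolev_pair \<Omega> p v h"
  shows "energy p t (\<lambda>x. (1/2) * (u x + v x)) (\<lambda>x. (1/2) *\<^sub>R (g x + h x))
    + energy p t (\<lambda>x. (1/2) * (u x - v x)) (\<lambda>x. (1/2) *\<^sub>R (g x - h x))
    \<le> 1/2 * energy p t u g + 1/2 * energy p t v h"
proof -
  have p': "1 \<le> p" "0 < p" using p by auto
  have e: "gag_quot p t (\<lambda>x. (1/2) * (u x + v x)) = (\<lambda>z. (1/2) *\<^sub>R (gag_quot p t u z + gag_quot p t v z))"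
    "gag_quot p t (\<lambda>x. (1/2) * (u x - v x)) = (\<lambda>z. (1/2) *\<^sub>R (gag_quot p t u z - gag_quot p t v z))"
    by (simp_all only: fun_eq_iff gag_quot_cmult gag_quot_add gag_quot_diff simp_thms)
  show ?thesis
    using add_mono[OF clarkson_integral[OF sobolev_pairD(2)[OF u] sobolev_pairD(2)[OF v] p]
      clarkson_integral[OF gag_quot_in_Lp[OF u p'(1) t] gag_quot_in_Lp[OF v p'(1) t] p]]
    unfolding energy_def gagliardo_pow_eq[OF p'(2)] e by (simp only: distrib_left add_ac)
qed

text \<open>A one-sided continuity estimate: with \<theta> fixed near 0 and the energy of the
  difference then made small enough, the energy of \<open>v\<close> exceeds that of \<open>u\<close>
  by as little as desired.\<close>

lemma energy_convex_comb:
  assumes p: "1 \<le> p" and t: "0 < t" "t < 1" and u: "sobolev_pair \<Omega> p u g" and v: "sobolev_pair \<Omega> p v h"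
    and \<theta>: "0 < \<theta>" "\<theta> < 1"
  shows "energy p t v h \<le> (1 - \<theta>) powr (1 - p) * energy p t u g + \<theta> powr (1 - p) * energy p t (\<lambda>x. v x - u x) (\<lambda>x. h x - g x)"
proof -
  have p': "0 < p" using p by auto
  note d = sobolev_pair_diff[OF p v u]
  have e: "(\<lambda>z. gag_quot p t u z + gag_quot p t (\<lambda>x. v x - u x) z) = gag_quot p t v"
    by (simp add: fun_eq_iff gag_quot_diff)
  have "(LINT x|lborel. norm (g x + (h x - g x)) powr p) \<le> (1 - \<theta>) powr (1 - p) * (LINT x|lborel. norm (g x) powr p) + \<theta> powr (1 - p) * (LINT x|lborel. norm (h x - g x) powr p)"
    by (rule Lp_integral_add_convex_comb[OF sobolev_pairD(2)[OF u] sobolev_pairD(2)[OF d] p \<theta>])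
  moreover have "gagliardo_pow p t v \<le> (1 - \<theta>) powr (1 - p) * gagliardo_pow p t u + \<theta> powr (1 - p) * gagliardo_pow p t (\<lambda>x. v x - u x)"
    using Lp_integral_add_convex_comb[OF gag_quot_in_Lp[OF u p t] gag_quot_in_Lp[OF d p t] p \<theta>]
    unfolding gagliardo_pow_eq[OF p'] fun_cong[OF e] by simp
  ultimately show ?thesis by (simp add: energy_def distrib_left)
qed

lemma energy_sobolev_bound:
  fixes p t :: real
  assumes "1 \<le> p" "0 < t" "t < 1"
  obtains C where "0 \<le> C" "\<And>\<Omega> (u :: 'a::euclidean_space \<Rightarrow> real) g. sobolev_pair \<Omega> p u g \<Longrightarrow>
      energy p t u g \<le> C * ((LINT x|lborel. \<bar>u x\<bar> powr p) + (LINT x|lborel. norm (g x) powr p))"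
proof -
  obtain C where C: "0 \<le> C" "\<And>\<Omega> (u :: 'a \<Rightarrow> real) g. sobolev_pair \<Omega> p u g \<Longrightarrow>
      gagliardo_pow p t u \<le> C * ((LINT x|lborel. \<bar>u x\<bar> powr p) + (LINT x|lborel. norm (g x) powr p))"
    using gagliardo_sobolev_bound[OF assms] by metis
  show ?thesis
  proof (rule that[of "C + 1"])
    fix \<Omega> and u :: "'a \<Rightarrow> real" and g assume u: "sobolev_pair \<Omega> p u g"
    define A where "A = (LINT x|lborel. \<bar>u x\<bar> powr p)"
    define B where "B = (LINT x|lborel. norm (g x) powr p)"
    have "0 \<le> A" by (simp add: A_def)
    moreover have "gagliardo_pow p t u \<le> C * (A + B)" using C(2)[OF u] by (simp add: A_def B_def)
    ultimately have "energy p t u g \<le> (C + 1) * (A + B)" by (simp add: energy_def B_def distrib_right)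
    then show "energy p t u g \<le> (C + 1) * ((LINT x|lborel. \<bar>u x\<bar> powr p) + (LINT x|lborel. norm (g x) powr p))"
      by (simp add: A_def B_def)
  qed (use C in simp)
qed

lemma convex_comb_factor_tendsto: "((\<lambda>\<theta>::real. (1 - \<theta>) powr (1 - p) * E) \<longlongrightarrow> E) (at_right 0)"
  by (auto intro!: tendsto_eq_intros)

text \<open>Only an upper bound for the energy is claimed: taking the smooth absolute value of a
  test function near \<open>w\<close> does not increase gradients or differences, while in L^p the
  result stays close to |w|.\<close>

lemma sobolev_nonneg_approx:
  fixes \<Omega> :: "'a::euclidean_space set"
  assumes \<Omega>: "open \<Omega>" "bounded \<Omega>" and p: "1 \<le> p" and t: "0 < t" "t < 1" and w: "sobolev_pair \<Omega> p w g" and \<eta>: "0 < \<eta>"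
  obtains \<phi> where "\<phi> \<in> test_functions \<Omega>" "\<And>x. 0 \<le> \<phi> x" "(LINT x|lborel. \<bar>\<phi> x - \<bar>w x\<bar>\<bar> powr p) < \<eta>"
    "energy p t \<phi> (grad \<phi>) < energy p t w g + \<eta>"
proof -
  have p0: "0 < p" "0 \<le> p" using p by auto
  obtain C where C: "0 \<le> C" "\<And>(u :: 'a \<Rightarrow> real) g. sobolev_pair \<Omega> p u g \<Longrightarrow>
      energy p t u g \<le> C * ((LINT x|lborel. \<bar>u x\<bar> powr p) + (LINT x|lborel. norm (g x) powr p))"
    using energy_sobolev_bound[OF p t] by metis
  have "\<forall>\<^sub>F \<theta> in at_right 0. (1 - \<theta>) powr (1 - p) * energy p t w g < energy p t w g + \<eta> / 2"
    using \<eta> by (intro order_tendstoD(2)[OF convex_comb_factor_tendsto]) auto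
  moreover have "\<forall>\<^sub>F \<theta> in at_right (0::real). 0 < \<theta> \<and> \<theta> < 1"
    by (auto simp: eventually_at_right_field intro: exI[of _ 1])
  ultimately have "\<forall>\<^sub>F \<theta> in at_right 0. (1 - \<theta>) powr (1 - p) * energy p t w g < energy p t w g + \<eta> / 2 \<and> 0 < \<theta> \<and> \<theta> < 1"
    by eventually_elim auto
  then obtain \<theta> where \<theta>: "(1 - \<theta>) powr (1 - p) * energy p t w g < energy p t w g + \<eta> / 2" "0 < \<theta>" "\<theta> < 1"
    using eventually_happens'[of "at_right (0::real)"] trivial_limit_at_right_real by blast
  define c where "c = (2::real) powr (p - 1)"
  have c: "0 < c" by (simp add: c_def)
  define k where "k = \<theta> powr (1 - p) * C + 1"
  have k: "0 < k" using C by (simp add: k_def add_nonneg_pos)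
  \<comment> \<open>\<theta> is fixed earlier, since its factor multiplies the approximation error.
    The two bounds let this error contribute at most \<eta>/2 to the L^p estimate and to the energy
    estimate respectively.\<close>
  define \<delta> where "\<delta> = min (\<eta> / (2 * c)) (\<eta> / (2 * k))"
  have \<delta>: "0 < \<delta>" using \<eta> c k by (simp add: \<delta>_def)
  obtain \<phi> where \<phi>: "\<phi> \<in> test_functions \<Omega>"
    "(LINT x|lborel. \<bar>w x - \<phi> x\<bar> powr p) + (LINT x|lborel. norm (g x - grad \<phi> x) powr p) < \<delta>"
    using sobolev_pair_approx[OF w \<delta>] by blast
  note \<phi>p = sobolev_pair_test_function[OF \<phi>(1) p0(1)]
  define m where "m = measure lborel \<Omega>"
  define M where "M = m + 1"
  have m: "0 < M" "m \<le> M" by (simp_all add: m_def M_def add_nonneg_pos)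
  \<comment> \<open>The smoothing error is at most \<open>e\<close> on \<Omega>, so its contribution
    \<open>c * (e powr p * m)\<close> to the L^p estimate is at most \<eta>/4.\<close>
  define e where "e = (\<eta> / (4 * c * M)) powr (1 / p)"
  have e: "0 < e" "e powr p = \<eta> / (4 * c * M)"
    using \<eta> c m p0 by (auto simp: e_def powr_powr)
  define \<psi> where "\<psi> x = smooth_abs e (\<phi> x)" for x
  have \<psi>: "\<psi> \<in> test_functions \<Omega>" "\<And>x. norm (grad \<psi> x) \<le> norm (grad \<phi> x)"
    using test_function_smooth_abs[OF \<phi>(1) e(1)] unfolding \<psi>_def[abs_def] by auto
  show ?thesis
  proof (rule that[OF \<psi>(1)])
    show "0 \<le> \<psi> x" for x using smooth_abs_bounds(1)[OF e(1)] by (simp add: \<psi>_def)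
    have "energy p t \<psi> (grad \<psi>) \<le> energy p t \<phi> (grad \<phi>)"
      unfolding energy_def gagliardo_pow_eq[OF p0(1)]
    proof (intro add_mono integral_mono)
      show "integrable lborel (\<lambda>x. norm (grad \<psi> x) powr p)" "integrable lborel (\<lambda>x. norm (grad \<phi> x) powr p)"
        using test_function_grad_in_Lp[OF \<psi>(1) p0(2)] test_function_grad_in_Lp[OF \<phi>(1) p0(2)] by (auto simp: in_Lp_def)
      show "integrable (lborel \<Otimes>\<^sub>M lborel) (\<lambda>z. norm (gag_quot p t \<psi> z) powr p)"
        by (rule in_LpD(2)[OF gag_quot_in_Lp[OF sobolev_pair_test_function[OF \<psi>(1) p0(1)] p t]])
      show "integrable (lborel \<Otimes>\<^sub>M lborel) (\<lambda>z. norm (gag_quot p t \<phi> z) powr p)"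
        by (rule in_LpD(2)[OF gag_quot_in_Lp[OF \<phi>p p t]])
      show "norm (grad \<psi> x) powr p \<le> norm (grad \<phi> x) powr p" for x
        using \<psi>(2) p0 by (intro powr_mono2) auto
      show "norm (gag_quot p t \<psi> z) powr p \<le> norm (gag_quot p t \<phi> z) powr p" for z
      proof (cases z)
        case (Pair x y)
        have "\<bar>\<psi> x - \<psi> y\<bar> \<le> \<bar>\<phi> x - \<phi> y\<bar>" unfolding \<psi>_def by (rule smooth_abs_lipschitz[OF e(1)])
        then show ?thesis using p0 by (intro powr_mono2) (auto simp: Pair gag_quot_def divide_right_mono)
      qed
    qed
    also have "\<dots> \<le> (1 - \<theta>) powr (1 - p) * energy p t w g + \<theta> powr (1 - p) * energy p t (\<lambda>x. \<phi> x - w x) (\<lambda>x. grad \<phi> x - g x)"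
      by (rule energy_convex_comb[OF p t w \<phi>p \<theta>(2,3)])
    also have "\<theta> powr (1 - p) * energy p t (\<lambda>x. \<phi> x - w x) (\<lambda>x. grad \<phi> x - g x) \<le> \<theta> powr (1 - p) * (C * \<delta>)"
    proof (intro mult_left_mono)
      have "energy p t (\<lambda>x. \<phi> x - w x) (\<lambda>x. grad \<phi> x - g x) \<le> C * ((LINT x|lborel. \<bar>\<phi> x - w x\<bar> powr p) + (LINT x|lborel. norm (grad \<phi> x - g x) powr p))"
        by (rule C(2)[OF sobolev_pair_diff[OF p \<phi>p w]])
      also have "\<dots> \<le> C * \<delta>" using \<phi>(2) C(1) by (intro mult_left_mono) (auto simp: abs_minus_commute norm_minus_commute)
      finally show "energy p t (\<lambda>x. \<phi> x - w x) (\<lambda>x. grad \<phi> x - g x) \<le> C * \<delta>" .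
    qed simp
    also have "\<theta> powr (1 - p) * (C * \<delta>) \<le> \<eta> / 2"
    proof -
      have "\<theta> powr (1 - p) * (C * \<delta>) \<le> k * \<delta>" using \<delta> by (simp add: k_def algebra_simps)
      also have "\<dots> \<le> k * (\<eta> / (2 * k))"
        using k by (intro mult_left_mono) (auto simp: \<delta>_def)
      also have "\<dots> = \<eta> / 2" using k by simp
      finally show ?thesis .
    qed
    finally show "energy p t \<psi> (grad \<psi>) < energy p t w g + \<eta>" using \<theta>(1) by linarith
    have [measurable]: "\<phi> \<in> borel_measurable borel" "\<psi> \<in> borel_measurable borel" "w \<in> borel_measurable borel" "\<Omega> \<in> sets borel"
      using \<phi>p sobolev_pair_test_function[OF \<psi>(1) p0(1)] w \<Omega> by (auto simp: sobolev_pair_def in_Lp_def)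
    have i1: "integrable lborel (\<lambda>x. e powr p * indicator \<Omega> x)"
      using emeasure_bounded_finite[OF \<Omega>(2)] by (intro integrable_mult_right integrable_real_indicator) auto
    have i2: "integrable lborel (\<lambda>x. \<bar>\<phi> x - w x\<bar> powr p)"
      using sobolev_pair_diff[OF p \<phi>p w] by (auto simp: sobolev_pair_def in_Lp_def)
    have "(LINT x|lborel. \<bar>\<psi> x - \<bar>w x\<bar>\<bar> powr p) \<le> (LINT x|lborel. c * (e powr p * indicator \<Omega> x + \<bar>\<phi> x - w x\<bar> powr p))"
    proof (rule integral_mono')
      show "integrable lborel (\<lambda>x. c * (e powr p * indicator \<Omega> x + \<bar>\<phi> x - w x\<bar> powr p))"
        using i1 i2 by simp
      fix x
      have "\<bar>\<psi> x - \<bar>w x\<bar>\<bar> powr p = norm ((\<psi> x - \<bar>\<phi> x\<bar>) + (\<bar>\<phi> x\<bar> - \<bar>w x\<bar>)) powr p" by simp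
      also have "\<dots> \<le> c * (norm (\<psi> x - \<bar>\<phi> x\<bar>) powr p + norm (\<bar>\<phi> x\<bar> - \<bar>w x\<bar>) powr p)"
        unfolding c_def by (rule norm_add_powr_le[OF p])
      also have "\<dots> \<le> c * (e powr p * indicator \<Omega> x + \<bar>\<phi> x - w x\<bar> powr p)"
      proof (intro mult_left_mono add_mono)
        show "norm (\<psi> x - \<bar>\<phi> x\<bar>) powr p \<le> e powr p * indicator \<Omega> x"
        proof (cases "x \<in> \<Omega>")
          case True
          have "norm (\<psi> x - \<bar>\<phi> x\<bar>) powr p \<le> e powr p"
            using smooth_abs_bounds(2)[OF e(1), of "\<phi> x"] p0 by (intro powr_mono2) (auto simp: \<psi>_def)
          then show ?thesis using True by simp
        next
          case False
          then show ?thesis using test_function_zero_outside[OF \<phi>(1)] test_function_zero_outside[OF \<psi>(1)] by simp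
        qed
        show "norm (\<bar>\<phi> x\<bar> - \<bar>w x\<bar>) powr p \<le> \<bar>\<phi> x - w x\<bar> powr p" using p0 by (intro powr_mono2) auto
      qed (use c in auto)
      finally show "\<bar>\<psi> x - \<bar>w x\<bar>\<bar> powr p \<le> c * (e powr p * indicator \<Omega> x + \<bar>\<phi> x - w x\<bar> powr p)" .
      show "0 \<le> c * (e powr p * indicator \<Omega> x + \<bar>\<phi> x - w x\<bar> powr p)" using c by simp
    qed
    also have "\<dots> = c * (e powr p * m + (LINT x|lborel. \<bar>\<phi> x - w x\<bar> powr p))"
      using i1 i2 by (simp add: m_def)
    also have "\<dots> < \<eta>"
    proof -
      have "c * (e powr p * m) \<le> c * (e powr p * M)" using c m by (intro mult_left_mono) auto
      also have "\<dots> = \<eta> / 4" using c m unfolding e(2) by (simp add: field_simps)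
      finally have 1: "c * (e powr p * m) \<le> \<eta> / 4" .
      have "0 \<le> (LINT x|lborel. norm (g x - grad \<phi> x) powr p)" by simp
      moreover have "\<delta> \<le> \<eta> / (2 * c)" by (simp add: \<delta>_def)
      ultimately have "(LINT x|lborel. \<bar>w x - \<phi> x\<bar> powr p) \<le> \<eta> / (2 * c)"
        using \<phi>(2) by linarith
      then have "(LINT x|lborel. \<bar>\<phi> x - w x\<bar> powr p) \<le> \<eta> / (2 * c)"
        by (simp add: abs_minus_commute)
      then have 2: "c * (LINT x|lborel. \<bar>\<phi> x - w x\<bar> powr p) \<le> \<eta> / 2" using c by (simp add: field_simps)
      show ?thesis using 1 2 \<eta> by (simp add: distrib_left)
    qed
    finally show "(LINT x|lborel. \<bar>\<psi> x - \<bar>w x\<bar>\<bar> powr p) < \<eta>" .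
  qed
qed

text \<open>The denominator \<open>G\<close>. Integrating over the whole space agrees with
  integrating over \<Omega> for functions that vanish outside \<Omega>.\<close>

definition coupling :: "real \<Rightarrow> real \<Rightarrow> ('a::euclidean_space \<Rightarrow> real) \<Rightarrow> ('a \<Rightarrow> real) \<Rightarrow> real" where
  "coupling \<alpha> \<beta> w z = (LINT x|lborel. \<bar>w x\<bar> powr \<alpha> * \<bar>z x\<bar> powr \<beta>)"

lemma coupling_nonneg: "0 \<le> coupling \<alpha> \<beta> w z"
  by (simp add: coupling_def)

lemma coupling_cmult: "coupling \<alpha> \<beta> (\<lambda>x. c * w x) (\<lambda>x. c * z x) = \<bar>c\<bar> powr (\<alpha> + \<beta>) * coupling \<alpha> \<beta> w z"
proof -
  have "\<bar>c * a\<bar> powr \<alpha> * \<bar>c * b\<bar> powr \<beta> = \<bar>c\<bar> powr (\<alpha> + \<beta>) * (\<bar>a\<bar> powr \<alpha> * \<bar>b\<bar> powr \<beta>)" for a b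
    by (simp add: abs_mult powr_mult powr_add mult_ac)
  then show ?thesis by (simp add: coupling_def)
qed

lemma coupling_integrable:
  assumes "in_Lp lborel (\<alpha> + \<beta>) w" "in_Lp lborel (\<alpha> + \<beta>) z" "0 \<le> \<alpha>" "0 \<le> \<beta>"
  shows "integrable lborel (\<lambda>x. \<bar>w x\<bar> powr \<alpha> * \<bar>z x\<bar> powr \<beta>)"
proof (rule Bochner_Integration.integrable_bound)
  have [measurable]: "w \<in> borel_measurable borel" "z \<in> borel_measurable borel" using assms by (auto simp: in_Lp_def)
  show "integrable lborel (\<lambda>x. \<bar>w x\<bar> powr (\<alpha> + \<beta>) + \<bar>z x\<bar> powr (\<alpha> + \<beta>))" using assms by (auto simp: in_Lp_def)
  show "(\<lambda>x. \<bar>w x\<bar> powr \<alpha> * \<bar>z x\<bar> powr \<beta>) \<in> borel_measurable lborel" by measurable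
  show "AE x in lborel. norm (\<bar>w x\<bar> powr \<alpha> * \<bar>z x\<bar> powr \<beta>) \<le> norm (\<bar>w x\<bar> powr (\<alpha> + \<beta>) + \<bar>z x\<bar> powr (\<alpha> + \<beta>))"
    using powr_prod_le[OF assms(3,4)] by (intro AE_I2) (simp add: abs_mult)
qed

lemma coupling_diff_le:
  assumes "in_Lp lborel p a" "in_Lp lborel p b" "in_Lp lborel p c" "in_Lp lborel p d"
    and "1 \<le> \<alpha>" "1 \<le> \<beta>" "\<alpha> + \<beta> = p" "0 < e"
  shows "\<bar>coupling \<alpha> \<beta> a b - coupling \<alpha> \<beta> c d\<bar>
    \<le> 2 * p * e * ((LINT x|lborel. \<bar>a x\<bar> powr p) + (LINT x|lborel. \<bar>b x\<bar> powr p) + (LINT x|lborel. \<bar>c x\<bar> powr p) + (LINT x|lborel. \<bar>d x\<bar> powr p))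
      + p * e powr (1 - p) * ((LINT x|lborel. \<bar>a x - c x\<bar> powr p) + (LINT x|lborel. \<bar>b x - d x\<bar> powr p))"
proof -
  have p: "1 \<le> p" using assms by simp
  have i: "integrable lborel (\<lambda>x. \<bar>a x\<bar> powr \<alpha> * \<bar>b x\<bar> powr \<beta>)" "integrable lborel (\<lambda>x. \<bar>c x\<bar> powr \<alpha> * \<bar>d x\<bar> powr \<beta>)"
    using coupling_integrable[of \<alpha> \<beta> a b] coupling_integrable[of \<alpha> \<beta> c d] assms by auto
  have j: "integrable lborel (\<lambda>x. \<bar>a x\<bar> powr p)" "integrable lborel (\<lambda>x. \<bar>b x\<bar> powr p)"
     "integrable lborel (\<lambda>x. \<bar>c x\<bar> powr p)" "integrable lborel (\<lambda>x. \<bar>d x\<bar> powr p)"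
     "integrable lborel (\<lambda>x. \<bar>a x - c x\<bar> powr p)" "integrable lborel (\<lambda>x. \<bar>b x - d x\<bar> powr p)"
    using assms(1-4) in_LpD(2)[OF in_Lp_diff[OF assms(1,3) p]] in_LpD(2)[OF in_Lp_diff[OF assms(2,4) p]] by (auto simp: in_Lp_def)
  have "\<bar>coupling \<alpha> \<beta> a b - coupling \<alpha> \<beta> c d\<bar> = \<bar>LINT x|lborel. \<bar>a x\<bar> powr \<alpha> * \<bar>b x\<bar> powr \<beta> - \<bar>c x\<bar> powr \<alpha> * \<bar>d x\<bar> powr \<beta>\<bar>"
    using i by (simp add: coupling_def)
  also have "\<dots> \<le> (LINT x|lborel. \<bar>\<bar>a x\<bar> powr \<alpha> * \<bar>b x\<bar> powr \<beta> - \<bar>c x\<bar> powr \<alpha> * \<bar>d x\<bar> powr \<beta>\<bar>)"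
    by (rule integral_abs_bound)
  also have "\<dots> \<le> (LINT x|lborel. 2 * p * e * (\<bar>a x\<bar> powr p + \<bar>b x\<bar> powr p + \<bar>c x\<bar> powr p + \<bar>d x\<bar> powr p)
      + p * e powr (1 - p) * (\<bar>a x - c x\<bar> powr p + \<bar>b x - d x\<bar> powr p))"
    using i j powr_prod_diff_le[OF assms(5,6,8)] unfolding assms(7)
    by (intro integral_mono integrable_abs Bochner_Integration.integrable_diff Bochner_Integration.integrable_add integrable_mult_right) auto
  also have "\<dots> = 2 * p * e * ((LINT x|lborel. \<bar>a x\<bar> powr p) + (LINT x|lborel. \<bar>b x\<bar> powr p) + (LINT x|lborel. \<bar>c x\<bar> powr p) + (LINT x|lborel. \<bar>d x\<bar> powr p))
      + p * e powr (1 - p) * ((LINT x|lborel. \<bar>a x - c x\<bar> powr p) + (LINT x|lborel. \<bar>b x - d x\<bar> powr p))"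
    using j by simp
  finally show ?thesis .
qed

text \<open>A single \<delta> serves all functions of bounded L^p norm. The bound is asked of
  \<open>c\<close> and \<open>d\<close> only, as \<open>a\<close> and \<open>b\<close> inherit one
  from their closeness. The parameter \<open>e\<close> is chosen against the norms, and then
  \<delta> against the large factor \<open>e powr (1 - p)\<close>.\<close>

lemma coupling_uniformly_continuous:
  assumes "1 \<le> \<alpha>" "1 \<le> \<beta>" "\<alpha> + \<beta> = p" "0 < \<eta>"
  obtains \<delta> where "0 < \<delta>" "\<And>a b c d :: 'a::euclidean_space \<Rightarrow> real. in_Lp lborel p a \<Longrightarrow> in_Lp lborel p b \<Longrightarrow> in_Lp lborel p c \<Longrightarrow> in_Lp lborel p d \<Longrightarrow>
    (LINT x|lborel. \<bar>c x\<bar> powr p) \<le> K \<Longrightarrow> (LINT x|lborel. \<bar>d x\<bar> powr p) \<le> K \<Longrightarrow>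
    (LINT x|lborel. \<bar>a x - c x\<bar> powr p) < \<delta> \<Longrightarrow> (LINT x|lborel. \<bar>b x - d x\<bar> powr p) < \<delta> \<Longrightarrow>
    \<bar>coupling \<alpha> \<beta> a b - coupling \<alpha> \<beta> c d\<bar> < \<eta>"
proof -
  have p: "1 \<le> p" "0 < p" using assms by auto
  define k where "k = (2::real) powr (p - 1)"
  have k: "0 < k" by (simp add: k_def)
  \<comment> \<open>The norms of \<open>a\<close> and \<open>b\<close> contribute
    \<open>k * (\<bar>K\<bar> + 1)\<close> each, those of \<open>c\<close> and \<open>d\<close>
    contribute \<open>\<bar>K\<bar>\<close> each; the extra 1 makes the estimate strict.\<close>
  define H where "H = 2 * (k * (\<bar>K\<bar> + 1)) + 2 * \<bar>K\<bar> + 1"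
  have H: "0 < H" using k by (simp add: H_def add_nonneg_pos)
  define e where "e = \<eta> / (4 * p * H)"
  have e: "0 < e" using assms p H by (simp add: e_def)
  define Q where "Q = p * e powr (1 - p)"
  have Q: "0 < Q" using p e by (simp add: Q_def)
  define \<delta> where "\<delta> = min 1 (\<eta> / (4 * Q))"
  show ?thesis
  proof (rule that)
    show "0 < \<delta>" using assms(4) Q by (simp add: \<delta>_def)
    fix a b c d :: "'a \<Rightarrow> real"
    assume L: "in_Lp lborel p a" "in_Lp lborel p b" "in_Lp lborel p c" "in_Lp lborel p d"
      and K: "(LINT x|lborel. \<bar>c x\<bar> powr p) \<le> K" "(LINT x|lborel. \<bar>d x\<bar> powr p) \<le> K"
      and small: "(LINT x|lborel. \<bar>a x - c x\<bar> powr p) < \<delta>" "(LINT x|lborel. \<bar>b x - d x\<bar> powr p) < \<delta>"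
    have *: "(LINT x|lborel. \<bar>f x\<bar> powr p) \<le> k * (\<bar>K\<bar> + 1)"
      if "in_Lp lborel p f" "in_Lp lborel p h" "(LINT x|lborel. \<bar>h x\<bar> powr p) \<le> K" "(LINT x|lborel. \<bar>f x - h x\<bar> powr p) < \<delta>" for f h :: "'a \<Rightarrow> real"
    proof -
      have "(LINT x|lborel. norm (h x + (f x - h x)) powr p) \<le> k * ((LINT x|lborel. norm (h x) powr p) + (LINT x|lborel. norm (f x - h x) powr p))"
        unfolding k_def by (rule Lp_integral_add_le[OF that(2) in_Lp_diff[OF that(1,2) p(1)] p(1)])
      also have "\<dots> \<le> k * (\<bar>K\<bar> + 1)" using that(3,4) k by (intro mult_left_mono add_mono) (auto simp: \<delta>_def)
      finally show ?thesis by simp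
    qed
    have "\<bar>coupling \<alpha> \<beta> a b - coupling \<alpha> \<beta> c d\<bar>
      \<le> 2 * p * e * ((LINT x|lborel. \<bar>a x\<bar> powr p) + (LINT x|lborel. \<bar>b x\<bar> powr p) + (LINT x|lborel. \<bar>c x\<bar> powr p) + (LINT x|lborel. \<bar>d x\<bar> powr p))
      + p * e powr (1 - p) * ((LINT x|lborel. \<bar>a x - c x\<bar> powr p) + (LINT x|lborel. \<bar>b x - d x\<bar> powr p))"
      by (rule coupling_diff_le[OF L assms(1-3) e])
    also have "\<dots> < \<eta>"
    proof -
      have "2 * p * e * ((LINT x|lborel. \<bar>a x\<bar> powr p) + (LINT x|lborel. \<bar>b x\<bar> powr p) + (LINT x|lborel. \<bar>c x\<bar> powr p) + (LINT x|lborel. \<bar>d x\<bar> powr p)) \<le> 2 * p * e * (H - 1)"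
        using *[OF L(1,3) K(1) small(1)] *[OF L(2,4) K(2) small(2)] K p e by (intro mult_left_mono) (auto simp: H_def)
      also have "\<dots> < 2 * p * e * H" using p e by simp
      also have "\<dots> = \<eta> / 2" using p H by (simp add: e_def)
      finally have 1: "2 * p * e * ((LINT x|lborel. \<bar>a x\<bar> powr p) + (LINT x|lborel. \<bar>b x\<bar> powr p) + (LINT x|lborel. \<bar>c x\<bar> powr p) + (LINT x|lborel. \<bar>d x\<bar> powr p)) < \<eta> / 2" .
      have "Q * ((LINT x|lborel. \<bar>a x - c x\<bar> powr p) + (LINT x|lborel. \<bar>b x - d x\<bar> powr p)) \<le> Q * (\<eta> / (4 * Q) + \<eta> / (4 * Q))"
        using small Q by (intro mult_left_mono add_mono) (auto simp: \<delta>_def)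
      also have "\<dots> = \<eta> / 2" using Q by (simp add: field_simps)
      finally show ?thesis using 1 unfolding Q_def by linarith
    qed
    finally show "\<bar>coupling \<alpha> \<beta> a b - coupling \<alpha> \<beta> c d\<bar> < \<eta>" .
  qed
qed

section \<open>Existence of a minimizer\<close>

text \<open>The limit from completeness is determined only up to null sets. Cutting it off produces
  a representative that vanishes at every point outside \<Omega>, as the definition of
  \<open>W1p0\<close> demands.\<close>

lemma Lp_complete_support:
  fixes f :: "nat \<Rightarrow> 'a \<Rightarrow> 'b::euclidean_space"
  assumes f: "\<And>n. in_Lp M p (f n)" and p: "1 \<le> p" and \<Omega>: "\<Omega> \<in> sets M" and supp: "\<And>n x. x \<notin> \<Omega> \<Longrightarrow> f n x = 0"
    and Cauchy: "\<And>e. 0 < e \<Longrightarrow> \<exists>N::nat. \<forall>i\<ge>N. \<forall>j\<ge>N. (LINT x|M. norm (f i x - f j x) powr p) < e"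
  obtains g where "in_Lp M p g" "\<And>x. x \<notin> \<Omega> \<Longrightarrow> g x = 0" "(\<lambda>n. LINT x|M. norm (f n x - g x) powr p) \<longlonglongrightarrow> 0"
proof -
  obtain g where g: "in_Lp M p g" "(\<lambda>n. LINT x|M. norm (f n x - g x) powr p) \<longlonglongrightarrow> 0"
    using Lp_complete[OF f p Cauchy] by blast
  define h where "h x = indicator \<Omega> x *\<^sub>R g x" for x
  have [measurable]: "g \<in> borel_measurable M" "\<Omega> \<in> sets M" using g(1) \<Omega> by (auto simp: in_Lp_def)
  have h: "in_Lp M p h"
  proof (rule in_Lp_bound[OF _ in_LpD(2)[OF g(1)]])
    show "h \<in> borel_measurable M" unfolding h_def[abs_def] by measurable
    show "AE x in M. norm (h x) powr p \<le> norm (g x) powr p" by (intro AE_I2) (auto simp: h_def indicator_def)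
  qed
  show ?thesis
  proof (rule that[OF h])
    show "h x = 0" if "x \<notin> \<Omega>" for x using that by (simp add: h_def)
    show "(\<lambda>n. LINT x|M. norm (f n x - h x) powr p) \<longlonglongrightarrow> 0"
    proof (rule Lim_null_comparison[OF _ g(2)])
      show "\<forall>\<^sub>F n in sequentially. norm (LINT x|M. norm (f n x - h x) powr p) \<le> (LINT x|M. norm (f n x - g x) powr p)"
      proof (intro always_eventually allI)
        fix n
        have "(LINT x|M. norm (f n x - h x) powr p) \<le> (LINT x|M. norm (f n x - g x) powr p)"
        proof (rule integral_mono)
          show "integrable M (\<lambda>x. norm (f n x - h x) powr p)" by (rule in_LpD(2)[OF in_Lp_diff[OF f h p]])
          show "integrable M (\<lambda>x. norm (f n x - g x) powr p)" by (rule in_LpD(2)[OF in_Lp_diff[OF f g(1) p]])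
          show "norm (f n x - h x) powr p \<le> norm (f n x - g x) powr p" for x
            using supp[of x n] by (cases "x \<in> \<Omega>") (auto simp: h_def)
        qed
        then show "norm (LINT x|M. norm (f n x - h x) powr p) \<le> (LINT x|M. norm (f n x - g x) powr p)" by simp
      qed
    qed
  qed
qed

lemma energy_cong_AE:
  assumes "g \<in> borel_measurable borel" "h \<in> borel_measurable borel" "AE x in lborel. g x = h x"
  shows "energy p t u g = energy p t u h"
proof -
  have "(LINT x|lborel. norm (g x) powr p) = (LINT x|lborel. norm (h x) powr p)"
    using assms by (intro integral_cong_AE) auto
  then show ?thesis by (simp add: energy_def)
qed

section \<open>The variational problem on a fixed domain\<close>

context
  fixes \<Omega> :: "'a::euclidean_space set" and p r s \<alpha> \<beta> :: real
  assumes \<Omega>: "open \<Omega>" "bounded \<Omega>" "\<Omega> \<noteq> {}"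
    and r: "0 < r" "r < 1" and s: "0 < s" "s < 1"
    and ab: "1 \<le> \<alpha>" "1 \<le> \<beta>" "\<alpha> + \<beta> = p"
begin

lemma p_ge_2: "2 \<le> p" "1 \<le> p" "0 < p"
  using ab by auto

lemma energy_wgrad_eq:
  assumes "sobolev_pair \<Omega> p u g"
  shows "energy p t u (wgrad \<Omega> u) = energy p t u g"
proof (rule energy_cong_AE)
  note w = sobolev_pair_imp_W1p0[OF \<Omega>(1,2) p_ge_2(2) assms]
  show "wgrad \<Omega> u \<in> borel_measurable borel"
    using sobolev_pairD(2)[OF W1p0_imp_sobolev_pair[OF \<Omega>(1) p_ge_2(3) w(1)]] by (simp add: in_Lp_def)
  show "g \<in> borel_measurable borel" using sobolev_pairD(2)[OF assms] by (simp add: in_Lp_def)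
qed (rule sobolev_pair_imp_W1p0(2)[OF \<Omega>(1,2) p_ge_2(2) assms])

lemma J_energy_eq:
  assumes w: "sobolev_pair \<Omega> p w g" and z: "sobolev_pair \<Omega> p z h"
  shows "J_energy \<Omega> p r s \<alpha> \<beta> w z = (energy p r w g + energy p s z h) / (2 * coupling \<alpha> \<beta> w z)"
proof -
  have "(LINT x:\<Omega>|lborel. \<bar>w x\<bar> powr \<alpha> * \<bar>z x\<bar> powr \<beta>) = coupling \<alpha> \<beta> w z"
    unfolding set_lebesgue_integral_def coupling_def using sobolev_pairD(3)[OF w]
    by (intro Bochner_Integration.integral_cong) (auto simp: indicator_def)
  moreover have "(LINT x|lborel. norm (wgrad \<Omega> w x) powr p) = (LINT x|lborel. norm (g x) powr p)"
    "(LINT x|lborel. norm (wgrad \<Omega> z x) powr p) = (LINT x|lborel. norm (h x) powr p)"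
    using energy_wgrad_eq[OF w, of r] energy_wgrad_eq[OF z, of s] by (simp_all add: energy_def)
  ultimately show ?thesis
    by (simp add: J_energy_def wgrad_powr[OF p_ge_2(3)] energy_def add.assoc)
qed

lemma coupling_eq_0_iff:
  assumes w: "sobolev_pair \<Omega> p w g" and z: "sobolev_pair \<Omega> p z h"
  shows "coupling \<alpha> \<beta> w z = 0 \<longleftrightarrow> (AE x in lborel. x \<in> \<Omega> \<longrightarrow> w x * z x = 0)"
proof -
  have i: "integrable lborel (\<lambda>x. \<bar>w x\<bar> powr \<alpha> * \<bar>z x\<bar> powr \<beta>)"
    using sobolev_pairD(1)[OF w] sobolev_pairD(1)[OF z] ab by (intro coupling_integrable) auto
  have "coupling \<alpha> \<beta> w z = 0 \<longleftrightarrow> (AE x in lborel. \<bar>w x\<bar> powr \<alpha> * \<bar>z x\<bar> powr \<beta> = 0)"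
    unfolding coupling_def by (rule integral_nonneg_eq_0_iff_AE[OF i]) auto
  also have "\<dots> \<longleftrightarrow> (AE x in lborel. x \<in> \<Omega> \<longrightarrow> w x * z x = 0)"
    using sobolev_pairD(3)[OF w] by (intro AE_cong) auto
  finally show ?thesis .
qed

lemma admissible_iff:
  assumes w: "sobolev_pair \<Omega> p w g" and z: "sobolev_pair \<Omega> p z h"
  shows "(w, z) \<in> admissible_pairs \<Omega> p \<longleftrightarrow> 0 < coupling \<alpha> \<beta> w z"
  using coupling_eq_0_iff[OF w z] coupling_nonneg[of \<alpha> \<beta> w z]
    sobolev_pair_imp_W1p0(1)[OF \<Omega>(1,2) p_ge_2(2) w] sobolev_pair_imp_W1p0(1)[OF \<Omega>(1,2) p_ge_2(2) z]
  by (auto simp: admissible_pairs_def)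

lemma admissible_pair_sobolev:
  assumes "(w, z) \<in> admissible_pairs \<Omega> p"
  shows "sobolev_pair \<Omega> p w (wgrad \<Omega> w)" "sobolev_pair \<Omega> p z (wgrad \<Omega> z)"
  using assms W1p0_imp_sobolev_pair[OF \<Omega>(1) p_ge_2(3)] by (auto simp: admissible_pairs_def)

lemma J_energy_nonneg:
  assumes "(w, z) \<in> admissible_pairs \<Omega> p"
  shows "0 \<le> J_energy \<Omega> p r s \<alpha> \<beta> w z"
  using J_energy_eq[OF admissible_pair_sobolev[OF assms]]
  by (simp add: energy_nonneg coupling_nonneg)

text \<open>One bump function serves as both components. Without this the infimum would be taken
  over an empty set of reals and carry no information.\<close>

lemma admissible_nonempty: "admissible_pairs \<Omega> p \<noteq> {}"
proof -
  obtain x0 where "x0 \<in> \<Omega>" using \<Omega> by blast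
  then obtain a c where ac: "cbox a c \<subseteq> \<Omega>" "x0 \<in> box a c" "\<forall>i\<in>Basis. a \<bullet> i < c \<bullet> i"
    using open_contains_cbox[OF \<Omega>(1)] by metis
  let ?\<phi> = "box_bump a c 0"
  have \<phi>: "?\<phi> \<in> test_functions \<Omega>" by (rule box_bump_test_function[OF ac(1)])
  note \<phi>p = sobolev_pair_test_function[OF \<phi> p_ge_2(3)]
  have "\<not> (AE x in lborel. x \<in> \<Omega> \<longrightarrow> ?\<phi> x * ?\<phi> x = 0)"
  proof
    assume "AE x in lborel. x \<in> \<Omega> \<longrightarrow> ?\<phi> x * ?\<phi> x = 0"
    then have "AE x in lborel. x \<notin> box a c"
    proof eventually_elim
      case (elim x)
      then show ?case using box_bump_neq_0[of a c 0 x] ac(1) box_subset_cbox[of a c] by auto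
    qed
    then have "emeasure lborel (box a c) = 0" by (subst AE_iff_measurable[symmetric, where P="\<lambda>x. x \<notin> box a c"]) auto
    moreover have "0 < (\<Prod>b\<in>Basis. (c - a) \<bullet> b)" using ac(3) by (intro prod_pos) (auto simp: inner_diff_left)
    moreover have "emeasure lborel (box a c) = ennreal (\<Prod>b\<in>Basis. (c - a) \<bullet> b)"
      using ac(3) by (intro emeasure_lborel_box) (auto simp: less_imp_le)
    ultimately show False by (metis ennreal_eq_0_iff not_le)
  qed
  then have "(?\<phi>, ?\<phi>) \<in> admissible_pairs \<Omega> p"
    using sobolev_pair_imp_W1p0(1)[OF \<Omega>(1,2) p_ge_2(2) \<phi>p] unfolding admissible_pairs_def by blast
  then show ?thesis by blast
qed

abbreviation (input) "lam1 \<equiv> lambda_inf \<Omega> p r s \<alpha> \<beta>"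

lemma lambda_inf_nonneg: "0 \<le> lam1"
  unfolding lambda_inf_def using admissible_nonempty J_energy_nonneg by (intro cINF_greatest) auto

lemma lambda_inf_le:
  assumes "(w, z) \<in> admissible_pairs \<Omega> p"
  shows "lam1 \<le> J_energy \<Omega> p r s \<alpha> \<beta> w z"
proof -
  have "bdd_below ((\<lambda>(w, z). J_energy \<Omega> p r s \<alpha> \<beta> w z) ` admissible_pairs \<Omega> p)"
    using J_energy_nonneg by (intro bdd_belowI2[where m=0]) auto
  from cINF_lower[OF this assms] show ?thesis by (simp add: lambda_inf_def)
qed

lemma lambda_inf_approx:
  assumes "0 < \<eta>"
  obtains w z where "(w, z) \<in> admissible_pairs \<Omega> p" "J_energy \<Omega> p r s \<alpha> \<beta> w z < lam1 + \<eta>"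
proof -
  have "\<exists>x\<in>admissible_pairs \<Omega> p. (case x of (w, z) \<Rightarrow> J_energy \<Omega> p r s \<alpha> \<beta> w z) < lam1 + \<eta>"
    unfolding lambda_inf_def using admissible_nonempty assms by (intro cInf_lessD[of "_ ` _", simplified]) (auto simp: image_def)
  then show ?thesis using that by auto
qed

text \<open>Minimality without the quotient. Where the coupling is 0 it holds because energies are
  nonnegative, so it applies to any pair in the space.\<close>

lemma lambda_inf_coupling_le:
  assumes w: "sobolev_pair \<Omega> p w g" and z: "sobolev_pair \<Omega> p z h"
  shows "2 * lam1 * coupling \<alpha> \<beta> w z \<le> energy p r w g + energy p s z h"
proof (cases "coupling \<alpha> \<beta> w z = 0")
  case False
  then have pos: "0 < coupling \<alpha> \<beta> w z" using coupling_nonneg[of \<alpha> \<beta> w z] by simp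
  then have "lam1 \<le> (energy p r w g + energy p s z h) / (2 * coupling \<alpha> \<beta> w z)"
    using lambda_inf_le[OF admissible_iff[OF w z, THEN iffD2]] unfolding J_energy_eq[OF w z] by blast
  then show ?thesis using pos by (simp add: field_simps)
qed (simp add: energy_nonneg add_nonneg_nonneg)

text \<open>The nonnegative approximations are compared with |w| and |z|, which have the same
  coupling as w and z; homogeneity then scales the coupling to 1.\<close>

lemma minimizing_sequence:
  assumes \<eta>: "0 < \<eta>"
  shows "\<exists>u g v h. sobolev_pair \<Omega> p u g \<and> sobolev_pair \<Omega> p v h \<and> (\<forall>x. 0 \<le> u x \<and> 0 \<le> v x) \<and>
    coupling \<alpha> \<beta> u v = 1 \<and> energy p r u g + energy p s v h \<le> 2 * lam1 + \<eta>"
proof -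
  obtain w z where wz: "(w, z) \<in> admissible_pairs \<Omega> p" "J_energy \<Omega> p r s \<alpha> \<beta> w z < lam1 + \<eta> / 4"
    using lambda_inf_approx[of "\<eta> / 4"] \<eta> by auto
  note w = admissible_pair_sobolev(1)[OF wz(1)] and z = admissible_pair_sobolev(2)[OF wz(1)]
  define G where "G = coupling \<alpha> \<beta> w z"
  define E1 where "E1 = energy p r w (wgrad \<Omega> w)"
  define E2 where "E2 = energy p s z (wgrad \<Omega> z)"
  have G: "0 < G" using wz(1) admissible_iff[OF w z] by (simp add: G_def)
  have E: "E1 + E2 < (2 * lam1 + \<eta> / 2) * G"
    using wz(2) G unfolding J_energy_eq[OF w z] by (simp add: G_def E1_def E2_def field_simps)
  define L where "L = 2 * lam1 + \<eta>"
  have L: "0 < L" using \<eta> lambda_inf_nonneg by (simp add: L_def)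
  \<comment> \<open>The first bound keeps the new coupling \<open>A\<close> positive. The second
    limits the loss \<open>L * \<kappa>\<close> to \<open>\<eta> * G / 4\<close>, and with
    \<open>2 * \<epsilon> \<le> \<eta> * G / 4\<close> this exactly fills the gap between
    \<open>2 * lam1 + \<eta> / 2\<close> and \<open>L\<close>.\<close>
  define \<kappa> where "\<kappa> = min (G / 2) (\<eta> * G / (4 * L))"
  have \<kappa>: "0 < \<kappa>" using G \<eta> L by (simp add: \<kappa>_def)
  define K where "K = max (LINT x|lborel. \<bar>w x\<bar> powr p) (LINT x|lborel. \<bar>z x\<bar> powr p)"
  obtain \<delta> where \<delta>: "0 < \<delta>" "\<And>a b c d :: 'a \<Rightarrow> real. in_Lp lborel p a \<Longrightarrow> in_Lp lborel p b \<Longrightarrow> in_Lp lborel p c \<Longrightarrow> in_Lp lborel p d \<Longrightarrow>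
    (LINT x|lborel. \<bar>c x\<bar> powr p) \<le> K \<Longrightarrow> (LINT x|lborel. \<bar>d x\<bar> powr p) \<le> K \<Longrightarrow>
    (LINT x|lborel. \<bar>a x - c x\<bar> powr p) < \<delta> \<Longrightarrow> (LINT x|lborel. \<bar>b x - d x\<bar> powr p) < \<delta> \<Longrightarrow>
    \<bar>coupling \<alpha> \<beta> a b - coupling \<alpha> \<beta> c d\<bar> < \<kappa>"
    using coupling_uniformly_continuous[OF ab \<kappa>] by blast
  define \<epsilon> where "\<epsilon> = min \<delta> (\<eta> * G / 8)"
  have \<epsilon>: "0 < \<epsilon>" using \<delta>(1) \<eta> G by (simp add: \<epsilon>_def)
  obtain \<phi> where \<phi>: "\<phi> \<in> test_functions \<Omega>" "\<And>x. 0 \<le> \<phi> x" "(LINT x|lborel. \<bar>\<phi> x - \<bar>w x\<bar>\<bar> powr p) < \<epsilon>"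
    "energy p r \<phi> (grad \<phi>) < E1 + \<epsilon>"
    using sobolev_nonneg_approx[OF \<Omega>(1,2) p_ge_2(2) r w \<epsilon>] unfolding E1_def by blast
  obtain \<psi> where \<psi>: "\<psi> \<in> test_functions \<Omega>" "\<And>x. 0 \<le> \<psi> x" "(LINT x|lborel. \<bar>\<psi> x - \<bar>z x\<bar>\<bar> powr p) < \<epsilon>"
    "energy p s \<psi> (grad \<psi>) < E2 + \<epsilon>"
    using sobolev_nonneg_approx[OF \<Omega>(1,2) p_ge_2(2) s z \<epsilon>] unfolding E2_def by blast
  note \<phi>p = sobolev_pair_test_function[OF \<phi>(1) p_ge_2(3)] and \<psi>p = sobolev_pair_test_function[OF \<psi>(1) p_ge_2(3)]
  have abs_Lp: "in_Lp lborel p (\<lambda>x. \<bar>f x\<bar>)" if "in_Lp lborel p f" for f :: "'a \<Rightarrow> real"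
    using that by (auto simp: in_Lp_def)
  define A where "A = coupling \<alpha> \<beta> \<phi> \<psi>"
  have "\<bar>coupling \<alpha> \<beta> \<phi> \<psi> - coupling \<alpha> \<beta> (\<lambda>x. \<bar>w x\<bar>) (\<lambda>x. \<bar>z x\<bar>)\<bar> < \<kappa>"
    using \<phi>(3) \<psi>(3) by (intro \<delta>(2) abs_Lp sobolev_pairD(1)[OF \<phi>p] sobolev_pairD(1)[OF \<psi>p] sobolev_pairD(1)[OF w] sobolev_pairD(1)[OF z])
      (auto simp: K_def \<epsilon>_def)
  also have "coupling \<alpha> \<beta> (\<lambda>x. \<bar>w x\<bar>) (\<lambda>x. \<bar>z x\<bar>) = G" by (simp add: G_def coupling_def)
  finally have AG: "\<bar>A - G\<bar> < \<kappa>" by (simp add: A_def)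
  have "\<kappa> \<le> G / 2" "\<kappa> \<le> \<eta> * G / (4 * L)" by (simp_all add: \<kappa>_def)
  then have A: "0 < A" using AG G by linarith
  have "L * \<kappa> \<le> L * (\<eta> * G / (4 * L))" using L by (intro mult_left_mono) (auto simp: \<kappa>_def)
  also have "\<dots> = \<eta> * G / 4" using L by (simp add: field_simps)
  finally have "L * \<kappa> \<le> \<eta> * G / 4" .
  moreover have "L * (G - \<kappa>) \<le> L * A" using AG L by (intro mult_left_mono) auto
  moreover have "2 * \<epsilon> \<le> \<eta> * G / 4" by (simp add: \<epsilon>_def min_def)
  ultimately have EA: "energy p r \<phi> (grad \<phi>) + energy p s \<psi> (grad \<psi>) \<le> L * A"
    using \<phi>(4) \<psi>(4) E by (simp add: L_def algebra_simps)
  define c where "c = (1 / A) powr (1 / p)"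
  have c: "0 < c" "\<bar>c\<bar> powr p = 1 / A" using A p_ge_2 by (auto simp: c_def powr_powr)
  show ?thesis
  proof (intro exI conjI)
    show "sobolev_pair \<Omega> p (\<lambda>x. c * \<phi> x) (\<lambda>x. c *\<^sub>R grad \<phi> x)" "sobolev_pair \<Omega> p (\<lambda>x. c * \<psi> x) (\<lambda>x. c *\<^sub>R grad \<psi> x)"
      by (intro sobolev_pair_cmult \<phi>p \<psi>p p_ge_2)+
    show "\<forall>x. 0 \<le> c * \<phi> x \<and> 0 \<le> c * \<psi> x" using c \<phi>(2) \<psi>(2) by simp
    show "coupling \<alpha> \<beta> (\<lambda>x. c * \<phi> x) (\<lambda>x. c * \<psi> x) = 1"
      using A by (simp add: coupling_cmult ab(3) c(2) flip: A_def)
    have "energy p r (\<lambda>x. c * \<phi> x) (\<lambda>x. c *\<^sub>R grad \<phi> x) + energy p s (\<lambda>x. c * \<psi> x) (\<lambda>x. c *\<^sub>R grad \<psi> x)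
        = (energy p r \<phi> (grad \<phi>) + energy p s \<psi> (grad \<psi>)) / A"
      unfolding energy_cmult[OF p_ge_2(3)] c(2) by (simp add: add_divide_distrib)
    also have "\<dots> \<le> L" using EA A by (simp add: field_simps)
    finally show "energy p r (\<lambda>x. c * \<phi> x) (\<lambda>x. c *\<^sub>R grad \<phi> x) + energy p s (\<lambda>x. c * \<psi> x) (\<lambda>x. c *\<^sub>R grad \<psi> x) \<le> 2 * lam1 + \<eta>"
      by (simp add: L_def)
  qed
qed

text \<open>By Clarkson's inequality, and because the midpoints of a minimizing sequence that is Cauchy in
  \<open>L\<^sup>p\<close> are again nearly minimizing, the gradients of the sequence are Cauchy too. This replaces weak
  compactness.\<close>

lemma minimizer_exists:
  obtains u g v h where "sobolev_pair \<Omega> p u g" "sobolev_pair \<Omega> p v h"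
    "AE x in lborel. 0 \<le> u x" "AE x in lborel. 0 \<le> v x"
    "coupling \<alpha> \<beta> u v = 1" "energy p r u g + energy p s v h = 2 * lam1"
proof -
  have "\<exists>S. \<forall>n. case S n of (u, g, v, h) \<Rightarrow> sobolev_pair \<Omega> p u g \<and> sobolev_pair \<Omega> p v h \<and> (\<forall>x. 0 \<le> u x \<and> 0 \<le> v x) \<and>
    coupling \<alpha> \<beta> u v = 1 \<and> energy p r u g + energy p s v h \<le> 2 * lam1 + inverse (real (Suc n))"
    by (intro choice allI) (use minimizing_sequence[of "inverse (real (Suc n))" for n] in fastforce)
  then obtain S where S: "\<And>n. case S n of (u, g, v, h) \<Rightarrow> sobolev_pair \<Omega> p u g \<and> sobolev_pair \<Omega> p v h \<and> (\<forall>x. 0 \<le> u x \<and> 0 \<le> v x) \<and>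
    coupling \<alpha> \<beta> u v = 1 \<and> energy p r u g + energy p s v h \<le> 2 * lam1 + inverse (real (Suc n))" by blast
  define u0 where "u0 n = fst (S n)" for n
  define g0 where "g0 n = fst (snd (S n))" for n
  define v0 where "v0 n = fst (snd (snd (S n)))" for n
  define h0 where "h0 n = snd (snd (snd (S n)))" for n
  have S0: "sobolev_pair \<Omega> p (u0 n) (g0 n)" "sobolev_pair \<Omega> p (v0 n) (h0 n)" "0 \<le> u0 n x" "0 \<le> v0 n x"
    "coupling \<alpha> \<beta> (u0 n) (v0 n) = 1" "energy p r (u0 n) (g0 n) + energy p s (v0 n) (h0 n) \<le> 2 * lam1 + inverse (real (Suc n))" for n x
    using S[of n] by (auto simp: u0_def g0_def v0_def h0_def split: prod.splits)
  define B where "B = 2 * lam1 + 1"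
  have inv1: "inverse (real (Suc n)) \<le> 1" for n by (simp add: inverse_le_1_iff)
  have gb: "gagliardo_pow p r (u0 n) \<le> B" "gagliardo_pow p s (v0 n) \<le> B" for n
  proof -
    have "0 \<le> (LINT x|lborel. norm (g0 n x) powr p)" "0 \<le> (LINT x|lborel. norm (h0 n x) powr p)"
      "0 \<le> gagliardo_pow p r (u0 n)" "0 \<le> gagliardo_pow p s (v0 n)"
      by (auto simp: gagliardo_pow_nonneg)
    then show "gagliardo_pow p r (u0 n) \<le> B" "gagliardo_pow p s (v0 n) \<le> B"
      using S0(6)[of n] inv1[of n] unfolding energy_def B_def by linarith+
  qed
  have \<Omega>s: "\<Omega> \<in> sets borel" using \<Omega> by simp
  obtain k1 :: "nat \<Rightarrow> nat" where k1: "strict_mono k1"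
    "\<And>e. 0 < e \<Longrightarrow> \<exists>N. \<forall>m\<ge>N. \<forall>n\<ge>N. (LINT x|lborel. \<bar>u0 (k1 m) x - u0 (k1 n) x\<bar> powr p) < e"
    using gagliardo_compact[of \<Omega> p r u0 B, OF \<Omega>(2) \<Omega>s p_ge_2(2) r(1) sobolev_pairD(1)[OF S0(1)] sobolev_pairD(3)[OF S0(1)]
        gag_quot_in_Lp[OF S0(1) p_ge_2(2) r] gb(1)] by blast
  \<comment> \<open>The second extraction runs along \<open>k1\<close>, so that both components
    converge along the composition.\<close>
  obtain k2 :: "nat \<Rightarrow> nat" where k2: "strict_mono k2"
    "\<And>e. 0 < e \<Longrightarrow> \<exists>N. \<forall>m\<ge>N. \<forall>n\<ge>N. (LINT x|lborel. \<bar>v0 (k1 (k2 m)) x - v0 (k1 (k2 n)) x\<bar> powr p) < e"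
    using gagliardo_compact[of \<Omega> p s "\<lambda>n. v0 (k1 n)" B, OF \<Omega>(2) \<Omega>s p_ge_2(2) s(1) sobolev_pairD(1)[OF S0(2)] sobolev_pairD(3)[OF S0(2)]
        gag_quot_in_Lp[OF S0(2) p_ge_2(2) s] gb(2)] by blast
  define k where "k n = k1 (k2 n)" for n
  have k_ge: "n \<le> k n" for n
    using seq_suble[OF k1(1), of "k2 n"] seq_suble[OF k2(1), of n] by (simp add: k_def)
  define U where "U n = u0 (k n)" for n
  define U' where "U' n = g0 (k n)" for n
  define V where "V n = v0 (k n)" for n
  define V' where "V' n = h0 (k n)" for n
  have UV: "sobolev_pair \<Omega> p (U n) (U' n)" "sobolev_pair \<Omega> p (V n) (V' n)" "0 \<le> U n x" "0 \<le> V n x"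
    "coupling \<alpha> \<beta> (U n) (V n) = 1" for n x
    by (simp_all only: U_def U'_def V_def V'_def S0)
  have E: "energy p r (U n) (U' n) + energy p s (V n) (V' n) \<le> 2 * lam1 + inverse (real (Suc n))" for n
  proof -
    have "inverse (real (Suc (k n))) \<le> inverse (real (Suc n))" using k_ge[of n] by (intro le_imp_inverse_le) auto
    then show ?thesis using S0(6)[of "k n"] unfolding U_def U'_def V_def V'_def by linarith
  qed
  have CU: "\<exists>N. \<forall>m\<ge>N. \<forall>n\<ge>N. (LINT x|lborel. \<bar>U m x - U n x\<bar> powr p) < e" if e: "0 < e" for e
  proof -
    obtain N where N: "\<forall>m\<ge>N. \<forall>n\<ge>N. (LINT x|lborel. \<bar>u0 (k1 m) x - u0 (k1 n) x\<bar> powr p) < e" using k1(2)[OF e] by blast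
    have "\<forall>m\<ge>N. \<forall>n\<ge>N. (LINT x|lborel. \<bar>U m x - U n x\<bar> powr p) < e"
      unfolding U_def k_def using N seq_suble[OF k2(1)] le_trans by blast
    then show ?thesis by blast
  qed
  have CV: "\<exists>N. \<forall>m\<ge>N. \<forall>n\<ge>N. (LINT x|lborel. \<bar>V m x - V n x\<bar> powr p) < e" if e: "0 < e" for e
    using k2(2)[OF e] by (simp only: V_def k_def)
  obtain P1 where P1: "0 \<le> P1" "\<And>w. in_Lp lborel p w \<Longrightarrow> (\<And>x. x \<notin> \<Omega> \<Longrightarrow> w x = 0) \<Longrightarrow>
     in_Lp (lborel \<Otimes>\<^sub>M lborel) p (gag_quot p r w) \<Longrightarrow> (LINT x|lborel. \<bar>w x\<bar> powr p) \<le> P1 * gagliardo_pow p r w"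
    using gagliardo_poincare[OF \<Omega>(2) p_ge_2(2) r(1)] by blast
  obtain P2 where P2: "0 \<le> P2" "\<And>w. in_Lp lborel p w \<Longrightarrow> (\<And>x. x \<notin> \<Omega> \<Longrightarrow> w x = 0) \<Longrightarrow>
     in_Lp (lborel \<Otimes>\<^sub>M lborel) p (gag_quot p s w) \<Longrightarrow> (LINT x|lborel. \<bar>w x\<bar> powr p) \<le> P2 * gagliardo_pow p s w"
    using gagliardo_poincare[OF \<Omega>(2) p_ge_2(2) s(1)] by blast
  define K where "K = max (P1 * B) (P2 * B)"
  have KU: "(LINT x|lborel. \<bar>U n x\<bar> powr p) \<le> K" for n
  proof -
    have "(LINT x|lborel. \<bar>U n x\<bar> powr p) \<le> P1 * gagliardo_pow p r (U n)"
      by (rule P1(2)[OF sobolev_pairD(1)[OF UV(1)] sobolev_pairD(3)[OF UV(1)] gag_quot_in_Lp[OF UV(1) p_ge_2(2) r]])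
    also have "\<dots> \<le> P1 * B" unfolding U_def by (intro mult_left_mono gb P1)
    finally show ?thesis by (simp add: K_def)
  qed
  have KV: "(LINT x|lborel. \<bar>V n x\<bar> powr p) \<le> K" for n
  proof -
    have "(LINT x|lborel. \<bar>V n x\<bar> powr p) \<le> P2 * gagliardo_pow p s (V n)"
      by (rule P2(2)[OF sobolev_pairD(1)[OF UV(2)] sobolev_pairD(3)[OF UV(2)] gag_quot_in_Lp[OF UV(2) p_ge_2(2) s]])
    also have "\<dots> \<le> P2 * B" unfolding V_def by (intro mult_left_mono gb P2)
    finally show ?thesis by (simp add: K_def)
  qed
  have half: "(1 / 2 :: real) powr p \<le> 1" using p_ge_2 by (intro powr_le1) auto
  have CG: "\<exists>N. \<forall>m\<ge>N. \<forall>n\<ge>N. (LINT x|lborel. norm (U' m x - U' n x) powr p) < e \<and> (LINT x|lborel. norm (V' m x - V' n x) powr p) < e"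
    if e: "0 < e" for e
  proof -
    \<comment> \<open>Clarkson's inequality controls the energy of half the difference, hence the
      rescaling by \<open>(1 / 2) powr p\<close>.\<close>
    define e' where "e' = e * (1 / 2) powr p"
    have e': "0 < e'" using e by (simp add: e'_def)
    \<comment> \<open>This gives \<open>2 * lam1 * \<kappa> \<le> e' / 2\<close>; dividing by
      \<open>B\<close> rather than by \<open>2 * lam1\<close> avoids the question whether
      \<open>lam1\<close> is positive.\<close>
    define \<kappa> where "\<kappa> = e' / (2 * B)"
    have B: "0 < B" using lambda_inf_nonneg by (simp add: B_def)
    have \<kappa>: "0 < \<kappa>" using e' B by (simp add: \<kappa>_def)
    obtain \<delta> where \<delta>: "0 < \<delta>" "\<And>a b c d :: 'a \<Rightarrow> real. in_Lp lborel p a \<Longrightarrow> in_Lp lborel p b \<Longrightarrow> in_Lp lborel p c \<Longrightarrow> in_Lp lborel p d \<Longrightarrow>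
      (LINT x|lborel. \<bar>c x\<bar> powr p) \<le> K \<Longrightarrow> (LINT x|lborel. \<bar>d x\<bar> powr p) \<le> K \<Longrightarrow>
      (LINT x|lborel. \<bar>a x - c x\<bar> powr p) < \<delta> \<Longrightarrow> (LINT x|lborel. \<bar>b x - d x\<bar> powr p) < \<delta> \<Longrightarrow>
      \<bar>coupling \<alpha> \<beta> a b - coupling \<alpha> \<beta> c d\<bar> < \<kappa>"
      using coupling_uniformly_continuous[OF ab \<kappa>] by blast
    obtain N1 where N1: "\<forall>m\<ge>N1. \<forall>n\<ge>N1. (LINT x|lborel. \<bar>U m x - U n x\<bar> powr p) < \<delta>" using CU[OF \<delta>(1)] by blast
    obtain N2 where N2: "\<forall>m\<ge>N2. \<forall>n\<ge>N2. (LINT x|lborel. \<bar>V m x - V n x\<bar> powr p) < \<delta>" using CV[OF \<delta>(1)] by blast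
    obtain N3 where N3: "inverse (real (Suc N3)) < e' / 2" using reals_Archimedean[of "e' / 2"] e' by auto
    define N where "N = max N1 (max N2 N3)"
    have "(LINT x|lborel. norm (U' m x - U' n x) powr p) < e \<and> (LINT x|lborel. norm (V' m x - V' n x) powr p) < e" if mn: "N \<le> m" "N \<le> n" for m n
    proof -
      note pm = sobolev_pair_cmult[OF p_ge_2(2) sobolev_pair_add[OF p_ge_2(2) UV(1)[of m] UV(1)[of n]], of "1/2"]
        and qm = sobolev_pair_cmult[OF p_ge_2(2) sobolev_pair_add[OF p_ge_2(2) UV(2)[of m] UV(2)[of n]], of "1/2"]
      have sh: "(LINT x|lborel. \<bar>(1/2) * (f m x + f n x) - f m x\<bar> powr p) < \<delta>"
        if "(LINT x|lborel. \<bar>f n x - f m x\<bar> powr p) < \<delta>" for f :: "nat \<Rightarrow> 'a \<Rightarrow> real"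
      proof -
        have "\<bar>(1/2) * (f m x + f n x) - f m x\<bar> powr p = (1/2) powr p * \<bar>f n x - f m x\<bar> powr p" for x
        proof -
          have "(1/2) * (f m x + f n x) - f m x = (1/2) * (f n x - f m x)" by (simp add: field_simps)
          then show ?thesis by (simp only: abs_mult powr_mult)
        qed
        then have "(LINT x|lborel. \<bar>(1/2) * (f m x + f n x) - f m x\<bar> powr p) = (1/2) powr p * (LINT x|lborel. \<bar>f n x - f m x\<bar> powr p)"
          by simp
        also have "\<dots> \<le> 1 * (LINT x|lborel. \<bar>f n x - f m x\<bar> powr p)" by (intro mult_right_mono half) auto
        finally show ?thesis using that by simp
      qed
      have "\<bar>coupling \<alpha> \<beta> (\<lambda>x. (1/2) * (U m x + U n x)) (\<lambda>x. (1/2) * (V m x + V n x)) - coupling \<alpha> \<beta> (U m) (V m)\<bar> < \<kappa>"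
      proof -
        have "(LINT x|lborel. \<bar>U n x - U m x\<bar> powr p) < \<delta>" "(LINT x|lborel. \<bar>V n x - V m x\<bar> powr p) < \<delta>"
          using N1 N2 mn by (simp_all add: N_def)
        then show ?thesis
          by (intro \<delta>(2) sobolev_pairD(1)[OF pm] sobolev_pairD(1)[OF qm] sobolev_pairD(1)[OF UV(1)] sobolev_pairD(1)[OF UV(2)] KU KV sh)
      qed
      then have cm: "1 - \<kappa> \<le> coupling \<alpha> \<beta> (\<lambda>x. (1/2) * (U m x + U n x)) (\<lambda>x. (1/2) * (V m x + V n x))"
        unfolding UV(5) by linarith
      have "2 * lam1 * (1 - \<kappa>) \<le> 2 * lam1 * coupling \<alpha> \<beta> (\<lambda>x. (1/2) * (U m x + U n x)) (\<lambda>x. (1/2) * (V m x + V n x))"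
        using lambda_inf_nonneg cm by (intro mult_left_mono) auto
      also have "\<dots> \<le> energy p r (\<lambda>x. (1/2) * (U m x + U n x)) (\<lambda>x. (1/2) *\<^sub>R (U' m x + U' n x))
          + energy p s (\<lambda>x. (1/2) * (V m x + V n x)) (\<lambda>x. (1/2) *\<^sub>R (V' m x + V' n x))"
        by (rule lambda_inf_coupling_le[OF pm qm])
      finally have low: "2 * lam1 * (1 - \<kappa>) \<le> energy p r (\<lambda>x. (1/2) * (U m x + U n x)) (\<lambda>x. (1/2) *\<^sub>R (U' m x + U' n x))
          + energy p s (\<lambda>x. (1/2) * (V m x + V n x)) (\<lambda>x. (1/2) *\<^sub>R (V' m x + V' n x))" .
      have inv: "inverse (real (Suc i)) < e' / 2" if "N \<le> i" for i
      proof -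
        have "inverse (real (Suc i)) \<le> inverse (real (Suc N3))" using that by (intro le_imp_inverse_le) (auto simp: N_def)
        then show ?thesis using N3 by linarith
      qed
      have "2 * lam1 * \<kappa> \<le> B * \<kappa>" using \<kappa> by (intro mult_right_mono) (auto simp: B_def)
      also have "\<dots> = e' / 2" using B by (simp add: \<kappa>_def)
      finally have lk: "2 * lam1 * \<kappa> \<le> e' / 2" .
      \<comment> \<open>The two energies average to less than \<open>2 * lam1 + e' / 2\<close>,
        while the midpoint costs at least \<open>2 * lam1 - e' / 2\<close>; less than
        \<open>e'\<close> remains for the half difference.\<close>
      have up: "energy p r (\<lambda>x. (1/2) * (U m x - U n x)) (\<lambda>x. (1/2) *\<^sub>R (U' m x - U' n x))
          + energy p s (\<lambda>x. (1/2) * (V m x - V n x)) (\<lambda>x. (1/2) *\<^sub>R (V' m x - V' n x)) < e'"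
        using energy_clarkson[OF p_ge_2(1) r UV(1)[of m] UV(1)[of n]] energy_clarkson[OF p_ge_2(1) s UV(2)[of m] UV(2)[of n]]
          low lk E[of m] E[of n] inv[OF mn(1)] inv[OF mn(2)] by (simp add: right_diff_distrib)
      have gl: "(LINT x|lborel. norm (F m x - F n x) powr p) < e" if "(LINT x|lborel. norm ((1/2) *\<^sub>R (F m x - F n x)) powr p) < e'"
        for F :: "nat \<Rightarrow> 'a \<Rightarrow> 'a"
        using that unfolding Lp_integral_scaleR e'_def by (simp add: mult.commute[of e])
      have ge: "(LINT x|lborel. norm (g x) powr p) \<le> energy p t w g" for t w and g :: "'a \<Rightarrow> 'a"
        by (simp add: energy_def gagliardo_pow_nonneg)
      show ?thesis
        using up energy_nonneg[of p r "\<lambda>x. (1/2) * (U m x - U n x)" "\<lambda>x. (1/2) *\<^sub>R (U' m x - U' n x)"]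
          energy_nonneg[of p s "\<lambda>x. (1/2) * (V m x - V n x)" "\<lambda>x. (1/2) *\<^sub>R (V' m x - V' n x)"]
          ge[of "\<lambda>x. (1/2) *\<^sub>R (U' m x - U' n x)" r "\<lambda>x. (1/2) * (U m x - U n x)"]
          ge[of "\<lambda>x. (1/2) *\<^sub>R (V' m x - V' n x)" s "\<lambda>x. (1/2) * (V m x - V n x)"]
        by (intro conjI gl) linarith+
    qed
    then show ?thesis by blast
  qed
  obtain u where u: "in_Lp lborel p u" "\<And>x. x \<notin> \<Omega> \<Longrightarrow> u x = 0" "(\<lambda>n. LINT x|lborel. norm (U n x - u x) powr p) \<longlonglongrightarrow> 0"
    by (rule Lp_complete_support[of lborel p U \<Omega>]) (use UV(1) p_ge_2 \<Omega>s CU in \<open>auto simp: sobolev_pair_def\<close>)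
  obtain v where v: "in_Lp lborel p v" "\<And>x. x \<notin> \<Omega> \<Longrightarrow> v x = 0" "(\<lambda>n. LINT x|lborel. norm (V n x - v x) powr p) \<longlonglongrightarrow> 0"
    by (rule Lp_complete_support[of lborel p V \<Omega>]) (use UV(2) p_ge_2 \<Omega>s CV in \<open>auto simp: sobolev_pair_def\<close>)
  obtain g where g: "in_Lp lborel p g" "\<And>x. x \<notin> \<Omega> \<Longrightarrow> g x = 0" "(\<lambda>n. LINT x|lborel. norm (U' n x - g x) powr p) \<longlonglongrightarrow> 0"
  proof (rule Lp_complete_support[of lborel p U' \<Omega>])
    show "\<exists>N. \<forall>i\<ge>N. \<forall>j\<ge>N. (LINT x|lborel. norm (U' i x - U' j x) powr p) < e" if "0 < e" for e using CG[OF that] by blast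
  qed (use UV(1) p_ge_2 \<Omega>s in \<open>auto simp: sobolev_pair_def\<close>)
  obtain h where h: "in_Lp lborel p h" "\<And>x. x \<notin> \<Omega> \<Longrightarrow> h x = 0" "(\<lambda>n. LINT x|lborel. norm (V' n x - h x) powr p) \<longlonglongrightarrow> 0"
  proof (rule Lp_complete_support[of lborel p V' \<Omega>])
    show "\<exists>N. \<forall>i\<ge>N. \<forall>j\<ge>N. (LINT x|lborel. norm (V' i x - V' j x) powr p) < e" if "0 < e" for e using CG[OF that] by blast
  qed (use UV(2) p_ge_2 \<Omega>s in \<open>auto simp: sobolev_pair_def\<close>)
  have closed: "sobolev_pair \<Omega> p w d" if "in_Lp lborel p w" "in_Lp lborel p d" "\<And>x. x \<notin> \<Omega> \<Longrightarrow> w x = 0" "\<And>x. x \<notin> \<Omega> \<Longrightarrow> d x = 0"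
    "\<And>n. sobolev_pair \<Omega> p (W n) (W' n)" "(\<lambda>n. LINT x|lborel. norm (W n x - w x) powr p) \<longlonglongrightarrow> 0" "(\<lambda>n. LINT x|lborel. norm (W' n x - d x) powr p) \<longlonglongrightarrow> 0"
    for w d W W'
  proof (rule sobolev_pair_closed[OF p_ge_2(2) that(1,2)])
    fix e :: real assume e: "0 < e"
    have "(\<lambda>n. (LINT x|lborel. norm (W n x - w x) powr p) + (LINT x|lborel. norm (W' n x - d x) powr p)) \<longlonglongrightarrow> 0 + 0"
      by (intro tendsto_add that)
    then have "\<forall>\<^sub>F n in sequentially. (LINT x|lborel. norm (W n x - w x) powr p) + (LINT x|lborel. norm (W' n x - d x) powr p) < e"
      using e by (intro order_tendstoD(2)) auto
    then obtain n where "(LINT x|lborel. norm (W n x - w x) powr p) + (LINT x|lborel. norm (W' n x - d x) powr p) < e"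
      by (auto simp: eventually_sequentially)
    then show "\<exists>v h. sobolev_pair \<Omega> p v h \<and> (LINT x|lborel. \<bar>w x - v x\<bar> powr p) + (LINT x|lborel. norm (d x - h x) powr p) < e"
      using that(5)[of n] by (intro exI[of _ "W n"] exI[of _ "W' n"]) (simp add: abs_minus_commute norm_minus_commute)
  qed (use that in auto)
  have up: "sobolev_pair \<Omega> p u g" by (rule closed[OF u(1) g(1) u(2) g(2) UV(1) u(3) g(3)])
  have vp: "sobolev_pair \<Omega> p v h" by (rule closed[OF v(1) h(1) v(2) h(2) UV(2) v(3) h(3)])
  have nonneg: "AE x in lborel. 0 \<le> w x" if W: "\<And>n. in_Lp lborel p (W n)" "in_Lp lborel p w" "\<And>n x. 0 \<le> W n x"
     "(\<lambda>n. LINT x|lborel. norm (W n x - w x) powr p) \<longlonglongrightarrow> 0" for W and w :: "'a \<Rightarrow> real"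
  proof -
    obtain q :: "nat \<Rightarrow> nat" where "AE x in lborel. (\<lambda>n. W (q n) x) \<longlonglongrightarrow> w x"
      using Lp_tendsto_AE_subseq[of lborel p W w, OF W(1,2) p_ge_2(2) W(4)] by blast
    then show ?thesis
    proof eventually_elim
      case (elim x)
      then show ?case by (rule LIMSEQ_le_const) (use W(3) in auto)
    qed
  qed
  have coup: "coupling \<alpha> \<beta> u v = 1"
  proof -
    have "\<bar>1 - coupling \<alpha> \<beta> u v\<bar> \<le> 0"
    proof (rule field_le_epsilon)
      fix \<eta> :: real assume \<eta>: "0 < \<eta>"
      obtain \<delta> where \<delta>: "0 < \<delta>" "\<And>a b c d :: 'a \<Rightarrow> real. in_Lp lborel p a \<Longrightarrow> in_Lp lborel p b \<Longrightarrow> in_Lp lborel p c \<Longrightarrow> in_Lp lborel p d \<Longrightarrow>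
        (LINT x|lborel. \<bar>c x\<bar> powr p) \<le> max (LINT x|lborel. \<bar>u x\<bar> powr p) (LINT x|lborel. \<bar>v x\<bar> powr p) \<Longrightarrow>
        (LINT x|lborel. \<bar>d x\<bar> powr p) \<le> max (LINT x|lborel. \<bar>u x\<bar> powr p) (LINT x|lborel. \<bar>v x\<bar> powr p) \<Longrightarrow>
        (LINT x|lborel. \<bar>a x - c x\<bar> powr p) < \<delta> \<Longrightarrow> (LINT x|lborel. \<bar>b x - d x\<bar> powr p) < \<delta> \<Longrightarrow>
        \<bar>coupling \<alpha> \<beta> a b - coupling \<alpha> \<beta> c d\<bar> < \<eta>"
        using coupling_uniformly_continuous[OF ab \<eta>] by blast
      have "\<forall>\<^sub>F n in sequentially. (LINT x|lborel. norm (U n x - u x) powr p) < \<delta> \<and> (LINT x|lborel. norm (V n x - v x) powr p) < \<delta>"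
        using \<delta>(1) by (intro eventually_conj order_tendstoD(2)[OF u(3)] order_tendstoD(2)[OF v(3)])
      then obtain n where n: "(LINT x|lborel. norm (U n x - u x) powr p) < \<delta>" "(LINT x|lborel. norm (V n x - v x) powr p) < \<delta>"
        by (auto simp: eventually_sequentially)
      have "\<bar>coupling \<alpha> \<beta> (U n) (V n) - coupling \<alpha> \<beta> u v\<bar> < \<eta>"
        by (rule \<delta>(2)[OF sobolev_pairD(1)[OF UV(1)] sobolev_pairD(1)[OF UV(2)] u(1) v(1)]) (use n in auto)
      then show "\<bar>1 - coupling \<alpha> \<beta> u v\<bar> \<le> 0 + \<eta>" by (simp add: UV(5))
    qed
    then show ?thesis by simp
  qed
  obtain C1 where C1: "0 \<le> C1" "\<And>(u :: 'a \<Rightarrow> real) g. sobolev_pair \<Omega> p u g \<Longrightarrow>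
      energy p r u g \<le> C1 * ((LINT x|lborel. \<bar>u x\<bar> powr p) + (LINT x|lborel. norm (g x) powr p))"
    using energy_sobolev_bound[OF p_ge_2(2) r] by metis
  obtain C2 where C2: "0 \<le> C2" "\<And>(u :: 'a \<Rightarrow> real) g. sobolev_pair \<Omega> p u g \<Longrightarrow>
      energy p s u g \<le> C2 * ((LINT x|lborel. \<bar>u x\<bar> powr p) + (LINT x|lborel. norm (g x) powr p))"
    using energy_sobolev_bound[OF p_ge_2(2) s] by metis
  define \<epsilon> where "\<epsilon> n = C1 * ((LINT x|lborel. norm (U n x - u x) powr p) + (LINT x|lborel. norm (U' n x - g x) powr p))
      + C2 * ((LINT x|lborel. norm (V n x - v x) powr p) + (LINT x|lborel. norm (V' n x - h x) powr p))" for n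
  have "\<epsilon> \<longlonglongrightarrow> C1 * (0 + 0) + C2 * (0 + 0)"
    unfolding \<epsilon>_def by (intro tendsto_intros u(3) v(3) g(3) h(3))
  then have \<epsilon>: "\<epsilon> \<longlonglongrightarrow> 0" by simp
  \<comment> \<open>The limit in n is taken for fixed \<theta>, because the factor
    \<open>\<theta> powr (1 - p)\<close> of the vanishing error \<open>\<epsilon> n\<close> blows up
    as \<theta> tends to 0.\<close>
  have Et: "energy p r u g + energy p s v h \<le> (1 - \<theta>) powr (1 - p) * (2 * lam1)" if \<theta>: "0 < \<theta>" "\<theta> < 1" for \<theta>
  proof (rule LIMSEQ_le_const)
    have "(\<lambda>n. (1 - \<theta>) powr (1 - p) * (2 * lam1 + inverse (real (Suc n))) + \<theta> powr (1 - p) * \<epsilon> n)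
       \<longlonglongrightarrow> (1 - \<theta>) powr (1 - p) * (2 * lam1 + 0) + \<theta> powr (1 - p) * 0"
      by (intro tendsto_intros \<epsilon> LIMSEQ_inverse_real_of_nat)
    then show "(\<lambda>n. (1 - \<theta>) powr (1 - p) * (2 * lam1 + inverse (real (Suc n))) + \<theta> powr (1 - p) * \<epsilon> n) \<longlonglongrightarrow> (1 - \<theta>) powr (1 - p) * (2 * lam1)"
      by simp
    have "energy p r u g + energy p s v h \<le> (1 - \<theta>) powr (1 - p) * (2 * lam1 + inverse (real (Suc n))) + \<theta> powr (1 - p) * \<epsilon> n" for n
    proof -
      have d1: "energy p r (\<lambda>x. u x - U n x) (\<lambda>x. g x - U' n x) \<le> C1 * ((LINT x|lborel. norm (U n x - u x) powr p) + (LINT x|lborel. norm (U' n x - g x) powr p))"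
        using C1(2)[OF sobolev_pair_diff[OF p_ge_2(2) up UV(1)[of n]]] by (simp add: abs_minus_commute norm_minus_commute)
      have d2: "energy p s (\<lambda>x. v x - V n x) (\<lambda>x. h x - V' n x) \<le> C2 * ((LINT x|lborel. norm (V n x - v x) powr p) + (LINT x|lborel. norm (V' n x - h x) powr p))"
        using C2(2)[OF sobolev_pair_diff[OF p_ge_2(2) vp UV(2)[of n]]] by (simp add: abs_minus_commute norm_minus_commute)
      have "energy p r u g + energy p s v h \<le> (1 - \<theta>) powr (1 - p) * (energy p r (U n) (U' n) + energy p s (V n) (V' n))
          + \<theta> powr (1 - p) * (energy p r (\<lambda>x. u x - U n x) (\<lambda>x. g x - U' n x) + energy p s (\<lambda>x. v x - V n x) (\<lambda>x. h x - V' n x))"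
        using energy_convex_comb[OF p_ge_2(2) r UV(1)[of n] up \<theta>] energy_convex_comb[OF p_ge_2(2) s UV(2)[of n] vp \<theta>]
        by (simp add: distrib_left)
      also have "\<dots> \<le> (1 - \<theta>) powr (1 - p) * (2 * lam1 + inverse (real (Suc n))) + \<theta> powr (1 - p) * \<epsilon> n"
        unfolding \<epsilon>_def by (intro add_mono mult_left_mono E d1 d2) auto
      finally show ?thesis .
    qed
    then show "\<exists>N. \<forall>n\<ge>N. energy p r u g + energy p s v h \<le> (1 - \<theta>) powr (1 - p) * (2 * lam1 + inverse (real (Suc n))) + \<theta> powr (1 - p) * \<epsilon> n"
      by blast
  qed
  have "energy p r u g + energy p s v h \<le> 2 * lam1"
  proof (rule tendsto_lowerbound[OF convex_comb_factor_tendsto])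
    show "\<forall>\<^sub>F \<theta> in at_right 0. energy p r u g + energy p s v h \<le> (1 - \<theta>) powr (1 - p) * (2 * lam1)"
      using Et by (auto simp: eventually_at_right_field intro!: exI[of _ 1])
  qed simp
  then have "energy p r u g + energy p s v h = 2 * lam1"
    using lambda_inf_coupling_le[OF up vp] by (simp add: coup)
  then show ?thesis
    using that[OF up vp] nonneg[OF sobolev_pairD(1)[OF UV(1)] u(1) UV(3) u(3)]
      nonneg[OF sobolev_pairD(1)[OF UV(2)] v(1) UV(4) v(3)] coup by blast
qed

end

section \<open>The Euler-Lagrange equations\<close>

text \<open>At \<open>y = 0\<close> the factor \<open>norm (x n) powr (p - 2)\<close> alone may fail
  to converge to its value there, but the product is bounded by
  \<open>norm (x n) powr (p - 1) * norm h\<close>, whose exponent is positive.\<close>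

lemma tendsto_powr_mult_inner:
  fixes y h :: "'a::real_inner"
  assumes "1 < p" "x \<longlonglongrightarrow> y"
  shows "(\<lambda>n. norm (x n) powr (p - 2) * (x n \<bullet> h)) \<longlonglongrightarrow> norm y powr (p - 2) * (y \<bullet> h)"
proof (cases "y = 0")
  case False
  then show ?thesis using assms(2) by (intro tendsto_intros) auto
next
  case True
  have "(\<lambda>n. norm (x n) powr (p - 1) * norm h) \<longlonglongrightarrow> norm y powr (p - 1) * norm h"
    using assms by (intro tendsto_intros tendsto_powr') auto
  then have "(\<lambda>n. norm (x n) powr (p - 1) * norm h) \<longlonglongrightarrow> 0" using True by simp
  moreover have "norm (norm (x n) powr (p - 2) * (x n \<bullet> h)) \<le> norm (x n) powr (p - 1) * norm h" for n
  proof -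
    have "norm (x n) powr (p - 2) * \<bar>x n \<bullet> h\<bar> \<le> norm (x n) powr (p - 2) * (norm (x n) * norm h)"
      by (intro mult_left_mono Cauchy_Schwarz_ineq2) auto
    also have "\<dots> = norm (x n) powr (p - 1) * norm h"
      using powr_mult_base[of "norm (x n)" "p - 2"] by (simp add: mult_ac)
    finally show ?thesis by (simp add: abs_mult)
  qed
  ultimately have "(\<lambda>n. norm (x n) powr (p - 2) * (x n \<bullet> h)) \<longlonglongrightarrow> 0"
    by (rule Lim_null_comparison[OF always_eventually[OF allI], rotated])
  then show ?thesis using True by simp
qed

text \<open>Up to the factor p this is the first variation of the p-th power of the L^p norm at
  \<open>f\<close> in the direction \<open>h\<close>. Gradients give the local form, difference
  quotients the nonlocal one.\<close>

definition Lp_form :: "'a measure \<Rightarrow> real \<Rightarrow> ('a \<Rightarrow> 'b::euclidean_space) \<Rightarrow> ('a \<Rightarrow> 'b) \<Rightarrow> real" where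
  "Lp_form M p f h = (LINT x|M. norm (f x) powr (p - 2) * (f x \<bullet> h x))"

lemma Lp_form_self:
  "Lp_form M p f f = (LINT x|M. norm (f x) powr p)"
proof -
  have "norm a powr (p - 2) * (a \<bullet> a) = norm a powr p" for a :: 'b
  proof (cases "a = 0")
    case False
    then show ?thesis by (simp add: power2_norm_eq_inner[symmetric] powr_diff)
  qed simp
  then show ?thesis by (simp add: Lp_form_def)
qed

lemma Lp_form_pointwise_bound:
  fixes a b :: "'a::real_inner"
  assumes "1 \<le> p"
  shows "\<bar>norm a powr (p - 2) * (a \<bullet> b)\<bar> \<le> norm a powr p + norm b powr p"
proof -
  have "\<bar>norm a powr (p - 2) * (a \<bullet> b)\<bar> = norm a powr (p - 2) * \<bar>a \<bullet> b\<bar>"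
    by (simp add: abs_mult)
  also have "\<dots> \<le> norm a powr (p - 2) * (norm a * norm b)"
    by (intro mult_left_mono Cauchy_Schwarz_ineq2) auto
  also have "\<dots> = norm a powr (p - 1) * norm b powr 1"
    using powr_mult_base[of "norm a" "p - 2"] by (simp add: mult_ac)
  also have "\<dots> \<le> norm a powr p + norm b powr p"
    using powr_prod_le[of "p - 1" 1 "norm a" "norm b"] assms by simp
  finally show ?thesis .
qed

lemma Lp_form_integrable:
  assumes "in_Lp M p f" "in_Lp M p h" "1 \<le> p"
  shows "integrable M (\<lambda>x. norm (f x) powr (p - 2) * (f x \<bullet> h x))"
proof (rule Bochner_Integration.integrable_bound)
  have [measurable]: "f \<in> borel_measurable M" "h \<in> borel_measurable M" using assms by (auto simp: in_Lp_def)
  show "integrable M (\<lambda>x. norm (f x) powr p + norm (h x) powr p)" using assms by (auto simp: in_Lp_def)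
  show "(\<lambda>x. norm (f x) powr (p - 2) * (f x \<bullet> h x)) \<in> borel_measurable M" by measurable
  show "AE x in M. norm (norm (f x) powr (p - 2) * (f x \<bullet> h x)) \<le> norm (norm (f x) powr p + norm (h x) powr p)"
    using Lp_form_pointwise_bound[OF assms(3)] by (intro AE_I2) simp
qed

text \<open>The tangent inequality taken at the perturbed point and read backwards bounds the
  increment from above. Continuity of the form in t then does the work of differentiating the
  norm.\<close>

lemma Lp_integral_below_tangent:
  assumes f: "in_Lp M p f" and h: "in_Lp M p h" and p: "1 \<le> p"
  shows "(LINT x|M. norm (f x + t *\<^sub>R h x) powr p) - (LINT x|M. norm (f x) powr p) \<le> t * p * Lp_form M p (\<lambda>x. f x + t *\<^sub>R h x) h"
proof -
  have y: "in_Lp M p (\<lambda>x. f x + t *\<^sub>R h x)" by (intro in_Lp_add in_Lp_scaleR f h p)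
  have "(LINT x|M. norm (f x + t *\<^sub>R h x) powr p - t * p * (norm (f x + t *\<^sub>R h x) powr (p - 2) * ((f x + t *\<^sub>R h x) \<bullet> h x))) \<le> (LINT x|M. norm (f x) powr p)"
  proof (rule integral_mono)
    show "integrable M (\<lambda>x. norm (f x + t *\<^sub>R h x) powr p - t * p * (norm (f x + t *\<^sub>R h x) powr (p - 2) * ((f x + t *\<^sub>R h x) \<bullet> h x)))"
      by (intro Bochner_Integration.integrable_diff integrable_mult_right Lp_form_integrable[OF y h p] in_LpD(2)[OF y])
    show "integrable M (\<lambda>x. norm (f x) powr p)" by (rule in_LpD(2)[OF f])
    fix x
    show "norm (f x + t *\<^sub>R h x) powr p - t * p * (norm (f x + t *\<^sub>R h x) powr (p - 2) * ((f x + t *\<^sub>R h x) \<bullet> h x)) \<le> norm (f x) powr p"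
      using norm_powr_above_tangent[OF p, of "f x + t *\<^sub>R h x" "f x"] by (simp add: mult_ac)
  qed
  then show ?thesis
    using Lp_form_integrable[OF y h p] in_LpD(2)[OF y] by (simp add: Lp_form_def)
qed

lemma Lp_form_tendsto:
  assumes f: "in_Lp M p f" and h: "in_Lp M p h" and p: "1 < p"
    and t: "t \<longlonglongrightarrow> 0" "\<And>n. \<bar>t n\<bar> \<le> 1"
  shows "(\<lambda>n. Lp_form M p (\<lambda>x. f x + t n *\<^sub>R h x) h) \<longlonglongrightarrow> Lp_form M p f h"
  unfolding Lp_form_def
proof (rule integral_dominated_convergence)
  have [measurable]: "f \<in> borel_measurable M" "h \<in> borel_measurable M" using f h by (auto simp: in_Lp_def)
  have p1: "1 \<le> p" using p by simp
  show "integrable M (\<lambda>x. 2 powr (p - 1) * (norm (f x) powr p + norm (h x) powr p) + norm (h x) powr p)"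
    using f h by (auto simp: in_Lp_def)
  show "(\<lambda>x. norm (f x) powr (p - 2) * (f x \<bullet> h x)) \<in> borel_measurable M" by measurable
  show "(\<lambda>x. norm (f x + t n *\<^sub>R h x) powr (p - 2) * ((f x + t n *\<^sub>R h x) \<bullet> h x)) \<in> borel_measurable M" for n by measurable
  show "AE x in M. (\<lambda>n. norm (f x + t n *\<^sub>R h x) powr (p - 2) * ((f x + t n *\<^sub>R h x) \<bullet> h x)) \<longlonglongrightarrow> norm (f x) powr (p - 2) * (f x \<bullet> h x)"
  proof (intro AE_I2 tendsto_powr_mult_inner p)
    fix x
    have "(\<lambda>n. f x + t n *\<^sub>R h x) \<longlonglongrightarrow> f x + 0 *\<^sub>R h x" by (intro tendsto_intros t)
    then show "(\<lambda>n. f x + t n *\<^sub>R h x) \<longlonglongrightarrow> f x" by simp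
  qed
  show "AE x in M. norm (norm (f x + t n *\<^sub>R h x) powr (p - 2) * ((f x + t n *\<^sub>R h x) \<bullet> h x))
     \<le> 2 powr (p - 1) * (norm (f x) powr p + norm (h x) powr p) + norm (h x) powr p" for n
  proof (intro AE_I2)
    fix x
    have "norm (norm (f x + t n *\<^sub>R h x) powr (p - 2) * ((f x + t n *\<^sub>R h x) \<bullet> h x)) \<le> norm (f x + t n *\<^sub>R h x) powr p + norm (h x) powr p"
      using Lp_form_pointwise_bound[OF p1] by simp
    also have "norm (f x + t n *\<^sub>R h x) powr p \<le> 2 powr (p - 1) * (norm (f x) powr p + norm (t n *\<^sub>R h x) powr p)"
      by (rule norm_add_powr_le[OF p1])
    also have "norm (t n *\<^sub>R h x) powr p \<le> norm (h x) powr p"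
      using t(2)[of n] p by (intro powr_mono2) (auto intro: mult_left_le_one_le)
    finally show "norm (norm (f x + t n *\<^sub>R h x) powr (p - 2) * ((f x + t n *\<^sub>R h x) \<bullet> h x))
      \<le> 2 powr (p - 1) * (norm (f x) powr p + norm (h x) powr p) + norm (h x) powr p" by simp
  qed
qed

text \<open>The kernel is the p-th power of \<open>k\<close>: p - 2 factors go to the modulus and
  one to each of the two differences. On the diagonal both sides are 0 through division by
  0.\<close>

lemma form_nonloc_eq:
  assumes "0 < p"
  shows "form_nonloc t p w \<psi> = Lp_form (lborel \<Otimes>\<^sub>M lborel) p (gag_quot p t w) (gag_quot p t \<psi>)"
  unfolding form_nonloc_def Lp_form_def
proof (intro Bochner_Integration.integral_cong refl)
  fix z :: "'a \<times> 'a"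
  obtain x y where z: "z = (x, y)" by (cases z)
  define k where "k = norm (x - y) powr ((real DIM('a) + t * p) / p)"
  have k: "0 \<le> k" "k powr p = norm (x - y) powr (real DIM('a) + t * p)"
    using assms by (simp_all add: k_def powr_powr)
  have "\<bar>w x - w y\<bar> powr (p - 2) * (w x - w y) * (\<psi> x - \<psi> y) / k powr p
      = \<bar>(w x - w y) / k\<bar> powr (p - 2) * ((w x - w y) / k * ((\<psi> x - \<psi> y) / k))"
  proof (cases "k = 0")
    case False
    then have "k powr p = k powr (p - 2) * k * k"
      using k(1) by (simp add: powr_diff power2_eq_square)
    then show ?thesis using k(1) by (simp add: powr_divide)
  qed simp
  then show "(case z of (x, y) \<Rightarrow> \<bar>w x - w y\<bar> powr (p - 2) * (w x - w y) * (\<psi> x - \<psi> y) / norm (x - y) powr (real DIM('a) + t * p))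
     = norm (gag_quot p t w z) powr (p - 2) * (gag_quot p t w z \<bullet> gag_quot p t \<psi> z)"
    by (simp add: z gag_quot_def k(2) flip: k_def)
qed

lemma form_loc_eq:
  assumes \<Omega>: "open \<Omega>" "bounded \<Omega>" and p: "1 \<le> p" and u: "sobolev_pair \<Omega> p u g" and \<psi>: "sobolev_pair \<Omega> p \<psi> k"
  shows "form_loc \<Omega> p u \<psi> = Lp_form lborel p g k"
proof -
  note wu = sobolev_pair_imp_W1p0[OF \<Omega> p u] and w\<psi> = sobolev_pair_imp_W1p0[OF \<Omega> p \<psi>]
  have p0: "0 < p" using p by simp
  have [measurable]: "wgrad \<Omega> u \<in> borel_measurable borel" "wgrad \<Omega> \<psi> \<in> borel_measurable borel"
    "g \<in> borel_measurable borel" "k \<in> borel_measurable borel"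
    using sobolev_pairD(2)[OF W1p0_imp_sobolev_pair[OF \<Omega>(1) p0 wu(1)]] sobolev_pairD(2)[OF W1p0_imp_sobolev_pair[OF \<Omega>(1) p0 w\<psi>(1)]]
      sobolev_pairD(2)[OF u] sobolev_pairD(2)[OF \<psi>] by (auto simp: in_Lp_def)
  have "form_loc \<Omega> p u \<psi> = (LINT x|lborel. norm (wgrad \<Omega> u x) powr (p - 2) * (wgrad \<Omega> u x \<bullet> wgrad \<Omega> \<psi> x))"
    unfolding form_loc_def set_lebesgue_integral_def
    by (intro Bochner_Integration.integral_cong) (auto simp: wgrad_def indicator_def)
  also have "\<dots> = (LINT x|lborel. norm (g x) powr (p - 2) * (g x \<bullet> k x))"
    using wu(2) w\<psi>(2) by (intro integral_cong_AE) auto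
  finally show ?thesis by (simp add: Lp_form_def)
qed

definition energy_form :: "real \<Rightarrow> real \<Rightarrow> ('a::euclidean_space \<Rightarrow> real) \<Rightarrow> ('a \<Rightarrow> 'a) \<Rightarrow> ('a \<Rightarrow> real) \<Rightarrow> ('a \<Rightarrow> 'a) \<Rightarrow> real" where
  "energy_form p t u g \<psi> k = Lp_form lborel p g k + Lp_form (lborel \<Otimes>\<^sub>M lborel) p (gag_quot p t u) (gag_quot p t \<psi>)"

lemma energy_form_self: "0 < p \<Longrightarrow> energy_form p t u g u g = energy p t u g"
  by (simp add: energy_form_def energy_def Lp_form_self gagliardo_pow_eq)

lemma energy_form_minus: "energy_form p t u g (\<lambda>x. - \<psi> x) (\<lambda>x. - k x) = - energy_form p t u g \<psi> k"
proof -
  have "gag_quot p t (\<lambda>x. - \<psi> x) = (\<lambda>z. - gag_quot p t \<psi> z)"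
    using gag_quot_cmult[of p t "-1" \<psi>] by (simp add: fun_eq_iff)
  then show ?thesis by (simp add: energy_form_def Lp_form_def)
qed

lemma energy_below_tangent:
  assumes p: "1 \<le> p" and t: "0 < t" "t < 1" and u: "sobolev_pair \<Omega> p u g" and \<psi>: "sobolev_pair \<Omega> p \<psi> k"
  shows "energy p t (\<lambda>x. u x + \<tau> * \<psi> x) (\<lambda>x. g x + \<tau> *\<^sub>R k x) - energy p t u g
     \<le> \<tau> * p * energy_form p t (\<lambda>x. u x + \<tau> * \<psi> x) (\<lambda>x. g x + \<tau> *\<^sub>R k x) \<psi> k"
proof -
  have p0: "0 < p" using p by simp
  have e: "gag_quot p t (\<lambda>x. u x + \<tau> * \<psi> x) = (\<lambda>z. gag_quot p t u z + \<tau> *\<^sub>R gag_quot p t \<psi> z)"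
    by (simp only: fun_eq_iff gag_quot_add gag_quot_cmult simp_thms)
  show ?thesis
    using Lp_integral_below_tangent[OF sobolev_pairD(2)[OF u] sobolev_pairD(2)[OF \<psi>] p, of \<tau>]
      Lp_integral_below_tangent[OF gag_quot_in_Lp[OF u p t] gag_quot_in_Lp[OF \<psi> p t] p, of \<tau>]
    unfolding energy_def energy_form_def gagliardo_pow_eq[OF p0] e distrib_left by linarith
qed

lemma energy_form_tendsto:
  assumes p: "1 < p" and t: "0 < t" "t < 1" and u: "sobolev_pair \<Omega> p u g" and \<psi>: "sobolev_pair \<Omega> p \<psi> k"
    and \<tau>: "\<tau> \<longlonglongrightarrow> 0" "\<And>n. \<bar>\<tau> n\<bar> \<le> 1"
  shows "(\<lambda>n. energy_form p t (\<lambda>x. u x + \<tau> n * \<psi> x) (\<lambda>x. g x + \<tau> n *\<^sub>R k x) \<psi> k) \<longlonglongrightarrow> energy_form p t u g \<psi> k"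
proof -
  have p1: "1 \<le> p" using p by simp
  have e: "gag_quot p t (\<lambda>x. u x + \<tau> n * \<psi> x) = (\<lambda>z. gag_quot p t u z + \<tau> n *\<^sub>R gag_quot p t \<psi> z)" for n
    by (simp only: fun_eq_iff gag_quot_add gag_quot_cmult simp_thms)
  show ?thesis unfolding energy_form_def e
    by (intro tendsto_add Lp_form_tendsto[OF sobolev_pairD(2)[OF u] sobolev_pairD(2)[OF \<psi>] p \<tau>]
        Lp_form_tendsto[OF gag_quot_in_Lp[OF u p1 t] gag_quot_in_Lp[OF \<psi> p1 t] p \<tau>])
qed

lemma coupling_derivative_integrable:
  fixes u v \<psi> :: "'a::euclidean_space \<Rightarrow> real"
  assumes "in_Lp lborel p u" "in_Lp lborel p v" "in_Lp lborel p \<psi>" and ab: "1 \<le> \<alpha>" "0 \<le> \<beta>" "\<alpha> + \<beta> = p"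
  shows "integrable lborel (\<lambda>x. \<bar>u x\<bar> powr (\<alpha> - 2) * u x * \<bar>v x\<bar> powr \<beta> * \<psi> x)"
proof (rule Bochner_Integration.integrable_bound)
  have [measurable]: "u \<in> borel_measurable borel" "v \<in> borel_measurable borel" "\<psi> \<in> borel_measurable borel"
    using assms by (auto simp: in_Lp_def)
  show "integrable lborel (\<lambda>x. \<bar>u x\<bar> powr p + \<bar>v x\<bar> powr p + \<bar>\<psi> x\<bar> powr p)" using assms by (auto simp: in_Lp_def)
  show "(\<lambda>x. \<bar>u x\<bar> powr (\<alpha> - 2) * u x * \<bar>v x\<bar> powr \<beta> * \<psi> x) \<in> borel_measurable lborel" by measurable
  show "AE x in lborel. norm (\<bar>u x\<bar> powr (\<alpha> - 2) * u x * \<bar>v x\<bar> powr \<beta> * \<psi> x) \<le> norm (\<bar>u x\<bar> powr p + \<bar>v x\<bar> powr p + \<bar>\<psi> x\<bar> powr p)"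
  proof (intro AE_I2)
    fix x
    define M where "M = max \<bar>u x\<bar> (max \<bar>v x\<bar> \<bar>\<psi> x\<bar>)"
    have M: "\<bar>u x\<bar> \<le> M" "\<bar>v x\<bar> \<le> M" "\<bar>\<psi> x\<bar> \<le> M" "0 \<le> M" unfolding M_def by linarith+
    have "norm (\<bar>u x\<bar> powr (\<alpha> - 2) * u x * \<bar>v x\<bar> powr \<beta> * \<psi> x) = (\<bar>u x\<bar> * \<bar>u x\<bar> powr (\<alpha> - 2)) * \<bar>v x\<bar> powr \<beta> * \<bar>\<psi> x\<bar>"
      by (simp add: abs_mult mult_ac)
    also have "\<bar>u x\<bar> * \<bar>u x\<bar> powr (\<alpha> - 2) = \<bar>u x\<bar> powr (\<alpha> - 1)"
      using powr_mult_base[of "\<bar>u x\<bar>" "\<alpha> - 2"] by simp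
    also have "\<bar>u x\<bar> powr (\<alpha> - 1) * \<bar>v x\<bar> powr \<beta> * \<bar>\<psi> x\<bar> \<le> M powr (\<alpha> - 1) * M powr \<beta> * M powr 1"
      using M ab by (intro mult_mono powr_mono2) auto
    also have "\<dots> = M powr p" using ab(3) by (simp only: powr_add[symmetric]) (simp add: algebra_simps)
    also have "\<dots> \<le> \<bar>u x\<bar> powr p + \<bar>v x\<bar> powr p + \<bar>\<psi> x\<bar> powr p"
      unfolding M_def max_def by (auto simp: add_increasing add_increasing2)
    finally show "norm (\<bar>u x\<bar> powr (\<alpha> - 2) * u x * \<bar>v x\<bar> powr \<beta> * \<psi> x) \<le> norm (\<bar>u x\<bar> powr p + \<bar>v x\<bar> powr p + \<bar>\<psi> x\<bar> powr p)"
      by simp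
  qed
qed

text \<open>Convexity of the \<alpha>-th power at each point, multiplied by the nonnegative weight
  |v|^\<beta>. For \<alpha> = 1 the expression
  \<open>\<bar>u x\<bar> powr (\<alpha> - 2) * u x\<close> is the sign of \<open>u x\<close>, with
  value 0 at 0, which is a subgradient of the absolute value.\<close>

lemma coupling_above_tangent:
  fixes u v \<psi> :: "'a::euclidean_space \<Rightarrow> real"
  assumes L: "in_Lp lborel p u" "in_Lp lborel p v" "in_Lp lborel p \<psi>" and ab: "1 \<le> \<alpha>" "1 \<le> \<beta>" "\<alpha> + \<beta> = p"
  shows "coupling \<alpha> \<beta> u v + \<tau> * \<alpha> * (LINT x|lborel. \<bar>u x\<bar> powr (\<alpha> - 2) * u x * \<bar>v x\<bar> powr \<beta> * \<psi> x)
    \<le> coupling \<alpha> \<beta> (\<lambda>x. u x + \<tau> * \<psi> x) v"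
proof -
  have ab': "0 \<le> \<alpha>" "0 \<le> \<beta>" "1 \<le> p" using ab by auto
  have ut: "in_Lp lborel p (\<lambda>x. u x + \<tau> * \<psi> x)"
    using in_Lp_add[OF L(1) in_Lp_scaleR[OF L(3), of \<tau>] ab'(3)] by simp
  have i: "integrable lborel (\<lambda>x. \<bar>u x\<bar> powr \<alpha> * \<bar>v x\<bar> powr \<beta>)" "integrable lborel (\<lambda>x. \<bar>u x + \<tau> * \<psi> x\<bar> powr \<alpha> * \<bar>v x\<bar> powr \<beta>)"
    using coupling_integrable[of \<alpha> \<beta> u v] coupling_integrable[of \<alpha> \<beta> "\<lambda>x. u x + \<tau> * \<psi> x" v] L ut ab' ab(3) by auto
  have j: "integrable lborel (\<lambda>x. \<bar>u x\<bar> powr (\<alpha> - 2) * u x * \<bar>v x\<bar> powr \<beta> * \<psi> x)"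
    by (rule coupling_derivative_integrable[OF L ab(1) ab'(2) ab(3)])
  have "(LINT x|lborel. \<bar>u x\<bar> powr \<alpha> * \<bar>v x\<bar> powr \<beta> + \<tau> * \<alpha> * (\<bar>u x\<bar> powr (\<alpha> - 2) * u x * \<bar>v x\<bar> powr \<beta> * \<psi> x))
     \<le> (LINT x|lborel. \<bar>u x + \<tau> * \<psi> x\<bar> powr \<alpha> * \<bar>v x\<bar> powr \<beta>)"
  proof (rule integral_mono)
    show "integrable lborel (\<lambda>x. \<bar>u x\<bar> powr \<alpha> * \<bar>v x\<bar> powr \<beta> + \<tau> * \<alpha> * (\<bar>u x\<bar> powr (\<alpha> - 2) * u x * \<bar>v x\<bar> powr \<beta> * \<psi> x))"
      by (intro Bochner_Integration.integrable_add integrable_mult_right i j)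
    fix x
    have "\<bar>u x\<bar> powr \<alpha> + \<alpha> * \<bar>u x\<bar> powr (\<alpha> - 2) * (u x * (\<tau> * \<psi> x)) \<le> \<bar>u x + \<tau> * \<psi> x\<bar> powr \<alpha>"
      using norm_powr_above_tangent[OF ab(1), of "u x" "u x + \<tau> * \<psi> x"] by simp
    then have "(\<bar>u x\<bar> powr \<alpha> + \<alpha> * \<bar>u x\<bar> powr (\<alpha> - 2) * (u x * (\<tau> * \<psi> x))) * \<bar>v x\<bar> powr \<beta> \<le> \<bar>u x + \<tau> * \<psi> x\<bar> powr \<alpha> * \<bar>v x\<bar> powr \<beta>"
      by (intro mult_right_mono) auto
    then show "\<bar>u x\<bar> powr \<alpha> * \<bar>v x\<bar> powr \<beta> + \<tau> * \<alpha> * (\<bar>u x\<bar> powr (\<alpha> - 2) * u x * \<bar>v x\<bar> powr \<beta> * \<psi> x) \<le> \<bar>u x + \<tau> * \<psi> x\<bar> powr \<alpha> * \<bar>v x\<bar> powr \<beta>"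
      by (simp add: algebra_simps)
  qed fact
  then show ?thesis using i j by (simp add: coupling_def)
qed

text \<open>The coupling need not be differentiable (when \<open>\<alpha> = 1\<close>), but it lies above its tangent, so
  one-sided difference quotients suffice; the case of \<open>- \<psi>\<close> turns the inequality into an equation.\<close>

lemma euler_lagrange:
  fixes u v :: "'a::euclidean_space \<Rightarrow> real"
  assumes ab: "1 \<le> \<alpha>" "1 \<le> \<beta>" "\<alpha> + \<beta> = p" and t: "0 < t" "t < 1" and lam: "0 \<le> lam"
    and u: "sobolev_pair \<Omega> p u g" and v: "in_Lp lborel p v" and \<psi>: "sobolev_pair \<Omega> p \<psi> k"
    and min: "\<And>w d. sobolev_pair \<Omega> p w d \<Longrightarrow> 2 * lam * coupling \<alpha> \<beta> w v \<le> energy p t w d + E0"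
    and eq: "energy p t u g + E0 \<le> 2 * lam * coupling \<alpha> \<beta> u v"
  shows "energy_form p t u g \<psi> k = lam * (2 * \<alpha> / (\<alpha> + \<beta>)) * (LINT x|lborel. \<bar>u x\<bar> powr (\<alpha> - 2) * u x * \<bar>v x\<bar> powr \<beta> * \<psi> x)"
proof -
  have p: "1 < p" "1 \<le> p" "0 < p" using ab by auto
  define D where "D \<psi> = (LINT x|lborel. \<bar>u x\<bar> powr (\<alpha> - 2) * u x * \<bar>v x\<bar> powr \<beta> * \<psi> x)" for \<psi>
  have ge: "lam * (2 * \<alpha> / p) * D \<psi> \<le> energy_form p t u g \<psi> k" if \<psi>: "sobolev_pair \<Omega> p \<psi> k" for \<psi> k
  proof (rule LIMSEQ_le_const)
    define \<tau> where "\<tau> n = inverse (real (Suc n))" for n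
    have \<tau>: "0 < \<tau> n" "\<bar>\<tau> n\<bar> \<le> 1" for n by (auto simp: \<tau>_def inverse_le_1_iff)
    show "(\<lambda>n. energy_form p t (\<lambda>x. u x + \<tau> n * \<psi> x) (\<lambda>x. g x + \<tau> n *\<^sub>R k x) \<psi> k) \<longlonglongrightarrow> energy_form p t u g \<psi> k"
      by (rule energy_form_tendsto[OF p(1) t u \<psi> _ \<tau>(2)]) (simp only: \<tau>_def LIMSEQ_inverse_real_of_nat)
    have "lam * (2 * \<alpha> / p) * D \<psi> \<le> energy_form p t (\<lambda>x. u x + \<tau> n * \<psi> x) (\<lambda>x. g x + \<tau> n *\<^sub>R k x) \<psi> k" for n
    proof -
      let ?u = "\<lambda>x. u x + \<tau> n * \<psi> x" and ?g = "\<lambda>x. g x + \<tau> n *\<^sub>R k x"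
      have pair: "sobolev_pair \<Omega> p ?u ?g" by (intro sobolev_pair_add sobolev_pair_cmult u \<psi> p)
      have "2 * lam * (coupling \<alpha> \<beta> u v + \<tau> n * \<alpha> * D \<psi>) \<le> 2 * lam * coupling \<alpha> \<beta> ?u v"
        unfolding D_def using lam
        by (intro mult_left_mono coupling_above_tangent[OF sobolev_pairD(1)[OF u] v sobolev_pairD(1)[OF \<psi>] ab]) auto
      also have "\<dots> \<le> energy p t ?u ?g + E0" by (rule min[OF pair])
      \<comment> \<open>The assumption \<open>eq\<close> is the reverse inequality at
        \<open>u\<close> itself; subtracting it cancels \<open>E0\<close> and leaves only the
        increments.\<close>
      finally have "2 * lam * (\<tau> n * \<alpha> * D \<psi>) \<le> energy p t ?u ?g - energy p t u g"
        using eq by (simp add: distrib_left)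
      also have "\<dots> \<le> \<tau> n * p * energy_form p t ?u ?g \<psi> k"
        by (rule energy_below_tangent[OF p(2) t u \<psi>])
      finally have "\<tau> n * (2 * lam * \<alpha> * D \<psi>) \<le> \<tau> n * (p * energy_form p t ?u ?g \<psi> k)"
        by (simp add: mult_ac)
      then have "2 * lam * \<alpha> * D \<psi> \<le> p * energy_form p t ?u ?g \<psi> k" using \<tau>(1)[of n] by simp
      then show ?thesis using p(3) by (simp add: field_simps)
    qed
    then show "\<exists>N. \<forall>n\<ge>N. lam * (2 * \<alpha> / p) * D \<psi> \<le> energy_form p t (\<lambda>x. u x + \<tau> n * \<psi> x) (\<lambda>x. g x + \<tau> n *\<^sub>R k x) \<psi> k" by blast
  qed
  have "sobolev_pair \<Omega> p (\<lambda>x. - \<psi> x) (\<lambda>x. - k x)"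
    using sobolev_pair_cmult[OF p(2) \<psi>, of "-1"] by simp
  from ge[OF this] have "lam * (2 * \<alpha> / p) * D (\<lambda>x. - \<psi> x) \<le> - energy_form p t u g \<psi> k"
    by (simp only: energy_form_minus)
  moreover have "D (\<lambda>x. - \<psi> x) = - D \<psi>" by (simp add: D_def)
  ultimately show ?thesis using ge[OF \<psi>] by (simp add: D_def ab(3))
qed

section \<open>Eigenpairs and the smallest eigenvalue\<close>

lemma coupling_commute: "coupling \<alpha> \<beta> u v = coupling \<beta> \<alpha> v u"
  by (simp add: coupling_def mult.commute)

text \<open>The seminorm alone controls the L^p norm, by the Poincare inequality for functions
  vanishing off a bounded set.\<close>

lemma energy_zero_imp_AE_zero:
  assumes \<Omega>: "bounded \<Omega>" and p: "1 \<le> p" and t: "0 < t" "t < 1" and u: "sobolev_pair \<Omega> p u g" and E: "energy p t u g = 0"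
  shows "AE x in lborel. u x = 0"
proof -
  obtain C where C: "0 \<le> C" "\<And>w. in_Lp lborel p w \<Longrightarrow> (\<And>x. x \<notin> \<Omega> \<Longrightarrow> w x = 0) \<Longrightarrow>
     in_Lp (lborel \<Otimes>\<^sub>M lborel) p (gag_quot p t w) \<Longrightarrow> (LINT x|lborel. \<bar>w x\<bar> powr p) \<le> C * gagliardo_pow p t w"
    using gagliardo_poincare[OF \<Omega> p t(1)] by blast
  have "0 \<le> (LINT x|lborel. norm (g x) powr p)" by simp
  then have g0: "gagliardo_pow p t u = 0" using E gagliardo_pow_nonneg[of p t u] unfolding energy_def by linarith
  have "(LINT x|lborel. \<bar>u x\<bar> powr p) \<le> C * gagliardo_pow p t u"
    by (rule C(2)[OF sobolev_pairD(1)[OF u] sobolev_pairD(3)[OF u] gag_quot_in_Lp[OF u p t]])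
  moreover have "0 \<le> (LINT x|lborel. \<bar>u x\<bar> powr p)" by simp
  ultimately have "(LINT x|lborel. norm (u x) powr p) = 0" unfolding g0 real_norm_def by linarith
  then have "AE x in lborel. norm (u x) powr p = 0"
    using integral_nonneg_eq_0_iff_AE[OF in_LpD(2)[OF sobolev_pairD(1)[OF u]]] by auto
  then show ?thesis by eventually_elim simp
qed

lemma set_integral_mult_vanishing_outside:
  assumes "\<And>x. x \<notin> \<Omega> \<Longrightarrow> \<psi> x = (0::real)"
  shows "(LINT x:\<Omega>|lborel. F x * \<psi> x) = (LINT x|lborel. F x * \<psi> x)"
  unfolding set_lebesgue_integral_def using assms
  by (intro Bochner_Integration.integral_cong) (auto simp: indicator_def)

theorem theorem1p1:
  fixes \<Omega> :: "'a::euclidean_space set" and p r s \<alpha> \<beta> :: real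
  assumes "bounded \<Omega>" and "open \<Omega>" and "connected \<Omega>" and "\<Omega> \<noteq> {}"
    and "1 < p" and "r \<in> {0<..<1}" and "s \<in> {0<..<1}"
    and "1 \<le> \<alpha>" and "1 \<le> \<beta>" and "\<alpha> + \<beta> = p"
  shows "(\<exists>u v. (u, v) \<in> admissible_pairs \<Omega> p
            \<and> J_energy \<Omega> p r s \<alpha> \<beta> u v = lambda_inf \<Omega> p r s \<alpha> \<beta>
            \<and> no_sign_change \<Omega> u \<and> no_sign_change \<Omega> v
            \<and> eigenpair \<Omega> p r s \<alpha> \<beta> (lambda_inf \<Omega> p r s \<alpha> \<beta>) u v)
       \<and> eigenvalue \<Omega> p r s \<alpha> \<beta> (lambda_inf \<Omega> p r s \<alpha> \<beta>)
       \<and> (\<forall>lam. eigenvalue \<Omega> p r s \<alpha> \<beta> lam \<longrightarrow> lambda_inf \<Omega> p r s \<alpha> \<beta> \<le> lam)"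
proof -
  have \<Omega>: "open \<Omega>" "bounded \<Omega>" "\<Omega> \<noteq> {}" and r: "0 < r" "r < 1" and s: "0 < s" "s < 1"
    and ab: "1 \<le> \<alpha>" "1 \<le> \<beta>" "\<alpha> + \<beta> = p" and p: "1 < p" "1 \<le> p" "0 < p"
    using assms by auto
  note setting = \<Omega> r s ab
  define lam where "lam = lambda_inf \<Omega> p r s \<alpha> \<beta>"
  have lam: "0 \<le> lam" unfolding lam_def by (rule lambda_inf_nonneg[OF setting])
  note below = lambda_inf_coupling_le[OF setting, folded lam_def]
  obtain u g v h where u: "sobolev_pair \<Omega> p u g" and v: "sobolev_pair \<Omega> p v h"
    and nonneg: "AE x in lborel. 0 \<le> u x" "AE x in lborel. 0 \<le> v x"
    and c: "coupling \<alpha> \<beta> u v = 1" and E: "energy p r u g + energy p s v h = 2 * lam"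
    using minimizer_exists[OF setting] unfolding lam_def by blast
  have adm: "(u, v) \<in> admissible_pairs \<Omega> p" using admissible_iff[OF setting u v] c by simp
  have W: "u \<in> W1p0 \<Omega> p" "v \<in> W1p0 \<Omega> p"
    using sobolev_pair_imp_W1p0(1)[OF \<Omega>(1,2) p(2)] u v by auto
  have J: "J_energy \<Omega> p r s \<alpha> \<beta> u v = lam" using J_energy_eq[OF setting u v] c E by simp
  have forms: "form_loc \<Omega> p w \<psi> + form_nonloc t p w \<psi> = energy_form p t w d \<psi> (wgrad \<Omega> \<psi>)"
    if "sobolev_pair \<Omega> p w d" "\<psi> \<in> W1p0 \<Omega> p" for w d \<psi> t
    using form_loc_eq[OF \<Omega>(1,2) p(2) that(1) W1p0_imp_sobolev_pair[OF \<Omega>(1) p(3) that(2)]]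
    by (simp add: form_nonloc_eq[OF p(3)] energy_form_def)
  have ws: "weak_solution \<Omega> p r s \<alpha> \<beta> lam u v"
    unfolding weak_solution_def
  proof (intro conjI W ballI)
    fix \<psi> assume \<psi>: "\<psi> \<in> W1p0 \<Omega> p"
    note \<psi>p = W1p0_imp_sobolev_pair[OF \<Omega>(1) p(3) \<psi>]
    have "energy_form p r u g \<psi> (wgrad \<Omega> \<psi>) = lam * (2 * \<alpha> / (\<alpha> + \<beta>)) * (LINT x|lborel. \<bar>u x\<bar> powr (\<alpha> - 2) * u x * \<bar>v x\<bar> powr \<beta> * \<psi> x)"
      by (rule euler_lagrange[OF ab r lam u sobolev_pairD(1)[OF v] \<psi>p below[OF _ v]]) (simp_all add: c E)
    then show "form_loc \<Omega> p u \<psi> + form_nonloc r p u \<psi>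
        = lam * (2 * \<alpha> / (\<alpha> + \<beta>)) * (LINT x:\<Omega>|lborel. \<bar>u x\<bar> powr (\<alpha> - 2) * u x * \<bar>v x\<bar> powr \<beta> * \<psi> x)"
      using forms[OF u \<psi>] set_integral_mult_vanishing_outside[of \<Omega> \<psi>] sobolev_pairD(3)[OF \<psi>p] by simp
  next
    fix \<psi> assume \<psi>: "\<psi> \<in> W1p0 \<Omega> p"
    note \<psi>p = W1p0_imp_sobolev_pair[OF \<Omega>(1) p(3) \<psi>]
    have ba: "\<beta> + \<alpha> = p" using ab by simp
    have "energy_form p s v h \<psi> (wgrad \<Omega> \<psi>) = lam * (2 * \<beta> / (\<beta> + \<alpha>)) * (LINT x|lborel. \<bar>v x\<bar> powr (\<beta> - 2) * v x * \<bar>u x\<bar> powr \<alpha> * \<psi> x)"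
    proof (rule euler_lagrange[OF ab(2,1) ba s lam v sobolev_pairD(1)[OF u] \<psi>p])
      show "2 * lam * coupling \<beta> \<alpha> w u \<le> energy p s w d + energy p r u g" if "sobolev_pair \<Omega> p w d" for w d
        using below[OF u that] by (simp add: coupling_commute[of \<beta>] add.commute)
      show "energy p s v h + energy p r u g \<le> 2 * lam * coupling \<beta> \<alpha> v u"
        using c E by (simp add: coupling_commute[of \<beta>] add.commute)
    qed
    also have "(\<lambda>x. \<bar>v x\<bar> powr (\<beta> - 2) * v x * \<bar>u x\<bar> powr \<alpha> * \<psi> x) = (\<lambda>x. \<bar>u x\<bar> powr \<alpha> * \<bar>v x\<bar> powr (\<beta> - 2) * v x * \<psi> x)"
      by (simp add: mult_ac)
    finally show "form_loc \<Omega> p v \<psi> + form_nonloc s p v \<psi>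
        = lam * (2 * \<beta> / (\<alpha> + \<beta>)) * (LINT x:\<Omega>|lborel. \<bar>u x\<bar> powr \<alpha> * \<bar>v x\<bar> powr (\<beta> - 2) * v x * \<psi> x)"
      using forms[OF v \<psi>] set_integral_mult_vanishing_outside[of \<Omega> \<psi>] sobolev_pairD(3)[OF \<psi>p] by (simp add: add.commute)
  qed
  have "\<not> (AE x in lborel. x \<in> \<Omega> \<longrightarrow> u x = 0 \<and> v x = 0)"
  proof
    assume "AE x in lborel. x \<in> \<Omega> \<longrightarrow> u x = 0 \<and> v x = 0"
    then have "AE x in lborel. x \<in> \<Omega> \<longrightarrow> u x * v x = 0" by eventually_elim auto
    then show False using adm by (simp add: admissible_pairs_def)
  qed
  then have ep: "eigenpair \<Omega> p r s \<alpha> \<beta> lam u v" using ws by (simp add: eigenpair_def)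
  have "no_sign_change \<Omega> u" "no_sign_change \<Omega> v"
    unfolding no_sign_change_def using nonneg by (auto elim: eventually_mono)
  moreover have "lam \<le> \<mu>" if "eigenvalue \<Omega> p r s \<alpha> \<beta> \<mu>" for \<mu>
  proof -
    obtain a b where ws: "weak_solution \<Omega> p r s \<alpha> \<beta> \<mu> a b" and nt: "\<not> (AE x in lborel. x \<in> \<Omega> \<longrightarrow> a x = 0 \<and> b x = 0)"
      using \<open>eigenvalue \<Omega> p r s \<alpha> \<beta> \<mu>\<close> by (auto simp: eigenvalue_def eigenpair_def)
    have aW: "a \<in> W1p0 \<Omega> p" and bW: "b \<in> W1p0 \<Omega> p" using ws by (auto simp: weak_solution_def)
    note a = W1p0_imp_sobolev_pair[OF \<Omega>(1) p(3) aW] and b = W1p0_imp_sobolev_pair[OF \<Omega>(1) p(3) bW]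
    define G where "G = coupling \<alpha> \<beta> a b"
    \<comment> \<open>Valid at \<open>y = 0\<close> as well, where both sides are 0 for every
      exponent q.\<close>
    have sq: "\<bar>y\<bar> powr (q - 2) * y * y = \<bar>y\<bar> powr q" for y q :: real
      by (cases "y = 0") (simp_all add: powr_diff power2_eq_square mult.assoc abs_mult_self_eq)
    have "energy p r a (wgrad \<Omega> a) = \<mu> * (2 * \<alpha> / (\<alpha> + \<beta>)) * (LINT x:\<Omega>|lborel. \<bar>a x\<bar> powr (\<alpha> - 2) * a x * \<bar>b x\<bar> powr \<beta> * a x)"
      using ws aW forms[OF a aW, of r] by (simp add: weak_solution_def energy_form_self[OF p(3)])
    also have "(LINT x:\<Omega>|lborel. \<bar>a x\<bar> powr (\<alpha> - 2) * a x * \<bar>b x\<bar> powr \<beta> * a x) = G"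
    proof -
      have pw: "\<bar>a x\<bar> powr (\<alpha> - 2) * a x * \<bar>b x\<bar> powr \<beta> * a x = \<bar>a x\<bar> powr \<alpha> * \<bar>b x\<bar> powr \<beta>" for x
        using sq[of "a x" \<alpha>] by (simp add: mult_ac)
      have "(LINT x:\<Omega>|lborel. \<bar>a x\<bar> powr (\<alpha> - 2) * a x * \<bar>b x\<bar> powr \<beta> * a x) = (LINT x|lborel. \<bar>a x\<bar> powr (\<alpha> - 2) * a x * \<bar>b x\<bar> powr \<beta> * a x)"
        by (rule set_integral_mult_vanishing_outside) (rule sobolev_pairD(3)[OF a])
      then show ?thesis by (simp only: pw G_def coupling_def)
    qed
    finally have Ea: "energy p r a (wgrad \<Omega> a) = \<mu> * (2 * \<alpha> / (\<alpha> + \<beta>)) * G" .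
    have "energy p s b (wgrad \<Omega> b) = \<mu> * (2 * \<beta> / (\<alpha> + \<beta>)) * (LINT x:\<Omega>|lborel. \<bar>a x\<bar> powr \<alpha> * \<bar>b x\<bar> powr (\<beta> - 2) * b x * b x)"
      using ws bW forms[OF b bW, of s] by (simp add: weak_solution_def energy_form_self[OF p(3)])
    also have "(LINT x:\<Omega>|lborel. \<bar>a x\<bar> powr \<alpha> * \<bar>b x\<bar> powr (\<beta> - 2) * b x * b x) = G"
    proof -
      have pw: "\<bar>a x\<bar> powr \<alpha> * \<bar>b x\<bar> powr (\<beta> - 2) * b x * b x = \<bar>a x\<bar> powr \<alpha> * \<bar>b x\<bar> powr \<beta>" for x
        using sq[of "b x" \<beta>] by (simp add: mult_ac)
      have "(LINT x:\<Omega>|lborel. \<bar>a x\<bar> powr \<alpha> * \<bar>b x\<bar> powr (\<beta> - 2) * b x * b x) = (LINT x|lborel. \<bar>a x\<bar> powr \<alpha> * \<bar>b x\<bar> powr (\<beta> - 2) * b x * b x)"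
        by (rule set_integral_mult_vanishing_outside) (rule sobolev_pairD(3)[OF b])
      then show ?thesis by (simp only: pw G_def coupling_def)
    qed
    finally have Eb: "energy p s b (wgrad \<Omega> b) = \<mu> * (2 * \<beta> / (\<alpha> + \<beta>)) * G" .
    have "2 * \<alpha> / (\<alpha> + \<beta>) + 2 * \<beta> / (\<alpha> + \<beta>) = 2" using ab p(3) by (simp add: field_simps)
    then have sum: "energy p r a (wgrad \<Omega> a) + energy p s b (wgrad \<Omega> b) = 2 * \<mu> * G"
      unfolding Ea Eb by (simp only: distrib_left[symmetric] distrib_right[symmetric] mult_ac)
    \<comment> \<open>An eigenpair is only known not to vanish in both components at once. If
      \<open>G\<close> were 0, the two tested equations would make both energies 0 and hence both
      components trivial.\<close>
    have "G \<noteq> 0"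
    proof
      assume G: "G = 0"
      have "AE x in lborel. a x = 0"
        using Ea G by (intro energy_zero_imp_AE_zero[OF \<Omega>(2) p(2) r a]) simp
      moreover have "AE x in lborel. b x = 0"
        using Eb G by (intro energy_zero_imp_AE_zero[OF \<Omega>(2) p(2) s b]) simp
      ultimately have "AE x in lborel. x \<in> \<Omega> \<longrightarrow> a x = 0 \<and> b x = 0" by eventually_elim auto
      then show False using nt by simp
    qed
    then have "0 < G" using coupling_nonneg[of \<alpha> \<beta> a b] by (simp add: G_def)
    moreover have "2 * lam * G \<le> 2 * \<mu> * G" using below[OF a b] sum by (simp add: G_def)
    ultimately show ?thesis by simp
  qed
  ultimately show ?thesis
    using adm J ep unfolding lam_def eigenvalue_def by blast
qed

end
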